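(* Let $n\ge1$ and let $\Lambda_n$ be the algebra of lower triangular $n\times n$ matrices over a field. The map $M\mapsto \mathrm{sh}(M)$ is a bijection between the set of isomorphism classes of basic faithfully balanced $\Lambda_n$-modules with exactly $n$ indecomposable summands and the set of tree-like tableaux with $n$ pointed cells.
   Context: A module $M$ is faithfully balanced if the natural map $\Lambda\to\mathrm{End}_E(M)$, $E=\mathrm{End}_\Lambda(M)$, is bijective; basic means that the indecomposable summands occur with multiplicity one. $\Lambda_n$ is the path algebra of $1\to2\to\cdots\to n$, with indecomposable modules $M_{ij}$ ($1\le i\le j\le n$), $M_{ij}$ being the uniserial module with top the simple $S[i]$ and socle the simple $S[j]$. Display the pairs $(i,j)$, $1\le i\le j\le n$, as the cells of the staircase Young diagram $(n,n-1,\dots,1)$: row $i$ (counted from the top) consists, from left to right, of the cells $(i,n),(i,n-1),\dots,(i,i)$, so that the cells with a fixed $j$ form a column and the top left cell is $(1,n)$. A basic module $M$ is identified with the filling of this diagram in which the cell $(i,j)$ is pointed exactly when $M_{ij}$ is a summand of $M$. $\mathrm{sh}(M)$ denotes the diagram with pointed cells obtained by removing all rows and all columns which contain no pointed cell and shrinking the diagram. A tree-like tableau is a Ferrers (Young) diagram, left- and top-justified, some of whose cells are pointed, such that: the top left cell is pointed; for every other pointed cell $c$, there is either a pointed cell above $c$ in the same column, or a pointed cell to the left of $c$ in the same row, but not both; and every row and every column contains at least one pointed cell. *)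

theory Defs
  imports "HOL-Algebra.Module" "HOL-Algebra.AbelCoset" "Jordan_Normal_Form.Matrix"
begin

section \<open>Left modules over a possibly noncommutative ring\<close>

text \<open>The locale \<^locale>\<open>module\<close> requires a commutative base ring, so its axioms are
  repeated here over an arbitrary ring. The locale \<^locale>\<open>submodule\<close> has no such restriction
  and is used as it is. As always with the record type of modules, the fields for
  multiplication and unit of a module are meaningless.\<close>

locale left_module = R?: ring R + M?: abelian_group M
  for R :: "('a, 'c) ring_scheme" (structure) and M :: "('a, 'v) module" (structure) +
  assumes smult_closed [simp, intro]:
      "\<lbrakk>a \<in> carrier R; x \<in> carrier M\<rbrakk> \<Longrightarrow> a \<odot>\<^bsub>M\<^esub> x \<in> carrier M"
    and smult_l_distr:
      "\<lbrakk>a \<in> carrier R; b \<in> carrier R; x \<in> carrier M\<rbrakk> \<Longrightarrow>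
        (a \<oplus>\<^bsub>R\<^esub> b) \<odot>\<^bsub>M\<^esub> x = a \<odot>\<^bsub>M\<^esub> x \<oplus>\<^bsub>M\<^esub> b \<odot>\<^bsub>M\<^esub> x"
    and smult_r_distr:
      "\<lbrakk>a \<in> carrier R; x \<in> carrier M; y \<in> carrier M\<rbrakk> \<Longrightarrow>
        a \<odot>\<^bsub>M\<^esub> (x \<oplus>\<^bsub>M\<^esub> y) = a \<odot>\<^bsub>M\<^esub> x \<oplus>\<^bsub>M\<^esub> a \<odot>\<^bsub>M\<^esub> y"
    and smult_assoc1:
      "\<lbrakk>a \<in> carrier R; b \<in> carrier R; x \<in> carrier M\<rbrakk> \<Longrightarrow>
        (a \<otimes>\<^bsub>R\<^esub> b) \<odot>\<^bsub>M\<^esub> x = a \<odot>\<^bsub>M\<^esub> (b \<odot>\<^bsub>M\<^esub> x)"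
    and smult_one [simp]:
      "x \<in> carrier M \<Longrightarrow> \<one>\<^bsub>R\<^esub> \<odot>\<^bsub>M\<^esub> x = x"

definition fin_gen :: "('a, 'c) ring_scheme \<Rightarrow> ('a, 'v) module \<Rightarrow> bool" where
  "fin_gen R M \<longleftrightarrow> (\<exists>B. finite B \<and> B \<subseteq> carrier M \<and>
     (\<forall>x\<in>carrier M. \<exists>r\<in>B \<rightarrow> carrier R. x = (\<Oplus>\<^bsub>M\<^esub>b\<in>B. r b \<odot>\<^bsub>M\<^esub> b)))"

text \<open>Homomorphisms are extensional functions, so that equality of homomorphisms is equality
  on the carrier.\<close>

definition mod_hom :: "('a, 'c) ring_scheme \<Rightarrow> ('a, 'v) module \<Rightarrow> ('a, 'w) module \<Rightarrow> ('v \<Rightarrow> 'w) set" where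
  "mod_hom R M N = {f \<in> carrier M \<rightarrow>\<^sub>E carrier N.
     (\<forall>x\<in>carrier M. \<forall>y\<in>carrier M. f (x \<oplus>\<^bsub>M\<^esub> y) = f x \<oplus>\<^bsub>N\<^esub> f y) \<and>
     (\<forall>a\<in>carrier R. \<forall>x\<in>carrier M. f (a \<odot>\<^bsub>M\<^esub> x) = a \<odot>\<^bsub>N\<^esub> f x)}"

definition mod_iso :: "('a, 'c) ring_scheme \<Rightarrow> ('a, 'v) module \<Rightarrow> ('a, 'w) module \<Rightarrow> bool" where
  "mod_iso R M N \<longleftrightarrow> (\<exists>f\<in>mod_hom R M N. bij_betw f (carrier M) (carrier N))"

definition End_ring :: "('a, 'c) ring_scheme \<Rightarrow> ('a, 'v) module \<Rightarrow> ('v \<Rightarrow> 'v) ring" where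
  "End_ring R M = \<lparr>carrier = mod_hom R M M,
     monoid.mult = compose (carrier M),
     one = (\<lambda>x\<in>carrier M. x),
     zero = (\<lambda>x\<in>carrier M. \<zero>\<^bsub>M\<^esub>),
     add = (\<lambda>f g. \<lambda>x\<in>carrier M. f x \<oplus>\<^bsub>M\<^esub> g x)\<rparr>"

text \<open>The additive group of \<open>M\<close> with functions acting by evaluation; over
  \<open>End_ring R M\<close> this is \<open>M\<close> as a module over its endomorphism ring.\<close>

definition eval_module :: "('a, 'v) module \<Rightarrow> ('v \<Rightarrow> 'v, 'v) module" where
  "eval_module M = \<lparr>carrier = carrier M, monoid.mult = monoid.mult M, one = one M,
     zero = zero M, add = add M, smult = (\<lambda>f x. f x)\<rparr>"

definition faithfully_balanced :: "('a, 'c) ring_scheme \<Rightarrow> ('a, 'v) module \<Rightarrow> bool" where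
  "faithfully_balanced R M \<longleftrightarrow>
     bij_betw (\<lambda>a. \<lambda>x\<in>carrier M. a \<odot>\<^bsub>M\<^esub> x) (carrier R)
       (carrier (End_ring (End_ring R M) (eval_module M)))"

definition internal_sum2 :: "('a, 'c) ring_scheme \<Rightarrow> ('a, 'v) module \<Rightarrow> 'v set \<Rightarrow> 'v set \<Rightarrow> bool" where
  "internal_sum2 R M A B \<longleftrightarrow> submodule A R M \<and> submodule B R M \<and>
     A \<inter> B = {\<zero>\<^bsub>M\<^esub>} \<and> A <+>\<^bsub>M\<^esub> B = carrier M"

definition indecomposable :: "('a, 'c) ring_scheme \<Rightarrow> ('a, 'v) module \<Rightarrow> bool" where
  "indecomposable R M \<longleftrightarrow> carrier M \<noteq> {\<zero>\<^bsub>M\<^esub>} \<and>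
     (\<forall>A B. internal_sum2 R M A B \<longrightarrow> A = {\<zero>\<^bsub>M\<^esub>} \<or> B = {\<zero>\<^bsub>M\<^esub>})"

definition is_summand :: "('a, 'c) ring_scheme \<Rightarrow> ('a, 'w) module \<Rightarrow> ('a, 'v) module \<Rightarrow> bool" where
  "is_summand R N M \<longleftrightarrow> (\<exists>A B. internal_sum2 R M A B \<and> mod_iso R N (M\<lparr>carrier := A\<rparr>))"

definition indec_decomp ::
    "('a, 'c) ring_scheme \<Rightarrow> ('a, 'v) module \<Rightarrow> nat \<Rightarrow> (nat \<Rightarrow> 'v set) \<Rightarrow> bool" where
  "indec_decomp R M m N \<longleftrightarrow>
     (\<forall>i<m. submodule (N i) R M \<and> indecomposable R (M\<lparr>carrier := N i\<rparr>)) \<and>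
     bij_betw (\<lambda>x. \<Oplus>\<^bsub>M\<^esub>i\<in>{..<m}. x i) (\<Pi>\<^sub>E i\<in>{..<m}. N i) (carrier M)"

definition basic :: "('a, 'c) ring_scheme \<Rightarrow> ('a, 'v) module \<Rightarrow> bool" where
  "basic R M \<longleftrightarrow> (\<exists>m N. indec_decomp R M m N \<and>
     (\<forall>i<m. \<forall>j<m. i \<noteq> j \<longrightarrow> \<not> mod_iso R (M\<lparr>carrier := N i\<rparr>) (M\<lparr>carrier := N j\<rparr>)))"

definition num_indec_summands :: "('a, 'c) ring_scheme \<Rightarrow> ('a, 'v) module \<Rightarrow> nat \<Rightarrow> bool" where
  "num_indec_summands R M m \<longleftrightarrow> (\<exists>N. indec_decomp R M m N)"


section \<open>The algebra of lower triangular matrices\<close>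

definition Lambda :: "nat \<Rightarrow> 'k::field mat ring" where
  "Lambda n = (ring_mat TYPE('k) n ())
     \<lparr>carrier := {A \<in> carrier_mat n n. \<forall>r<n. \<forall>c<n. r < c \<longrightarrow> A $$ (r, c) = 0}\<rparr>"

text \<open>The module \<open>M\<^sub>i\<^sub>j\<close>. With \<open>e\<^sub>1, \<dots>, e\<^sub>n\<close> the standard basis of the column
  vectors, it is \<open>\<langle>e\<^sub>i, \<dots>, e\<^sub>n\<rangle> / \<langle>e\<^sub>j\<^sub>+\<^sub>1, \<dots>, e\<^sub>n\<rangle>\<close>, realised on the vectors supported on
  the coordinates \<open>i, \<dots>, j\<close>. The matrix unit in row \<open>k + 1\<close> and column \<open>k\<close>, which is
  the arrow from \<open>k\<close> to \<open>k + 1\<close>, sends \<open>e\<^sub>k\<close> to \<open>e\<^sub>k\<^sub>+\<^sub>1\<close>, so the top is spanned by \<open>e\<^sub>i\<close>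
  and the socle by \<open>e\<^sub>j\<close>. Library vectors are indexed from 0, so \<open>e\<^sub>k\<close> is coordinate \<open>k - 1\<close>.\<close>

definition interval_module :: "nat \<Rightarrow> nat \<Rightarrow> nat \<Rightarrow> ('k::field mat, 'k vec) module" where
  "interval_module n i j = \<lparr>
     carrier = {v \<in> carrier_vec n. \<forall>k<n. \<not> (i \<le> Suc k \<and> Suc k \<le> j) \<longrightarrow> v $ k = 0},
     monoid.mult = undefined, one = undefined,
     zero = 0\<^sub>v n, add = (+),
     smult = (\<lambda>A v. vec n (\<lambda>k. if i \<le> Suc k \<and> Suc k \<le> j then (A *\<^sub>v v) $ k else 0))\<rparr>"

text \<open>A finitely generated module has finite dimension over the field, so each one is isomorphic
  to one whose carrier is a set of vectors over the field. The module operations on the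
  carrier are arbitrary.\<close>

definition fb_modules :: "nat \<Rightarrow> ('k::field mat, 'k vec) module set" where
  "fb_modules n = {M. left_module (Lambda n) M \<and> fin_gen (Lambda n) M \<and>
     basic (Lambda n) M \<and> faithfully_balanced (Lambda n) M \<and>
     num_indec_summands (Lambda n) M n}"

definition iso_rel :: "('a, 'c) ring_scheme \<Rightarrow> ('a, 'v) module set \<Rightarrow>
    (('a, 'v) module \<times> ('a, 'v) module) set" where
  "iso_rel R X = {(M, N). M \<in> X \<and> N \<in> X \<and> mod_iso R M N}"


section \<open>Diagrams with pointed cells\<close>

text \<open>A cell is a pair of a row (from the top) and a column (from the left), both counted
  from 0. A pointed diagram is the pair of its set of cells and its set of pointed cells.\<close>

type_synonym pointed_diagram = "(nat \<times> nat) set \<times> (nat \<times> nat) set"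

definition young_diagram :: "(nat \<times> nat) set \<Rightarrow> bool" where
  "young_diagram D \<longleftrightarrow> finite D \<and>
     (\<forall>r c r' c'. (r, c) \<in> D \<and> r' \<le> r \<and> c' \<le> c \<longrightarrow> (r', c') \<in> D)"

definition tree_like_tableau :: "pointed_diagram \<Rightarrow> bool" where
  "tree_like_tableau T \<longleftrightarrow> (case T of (D, P) \<Rightarrow>
     young_diagram D \<and> P \<subseteq> D \<and> (0, 0) \<in> P \<and>
     (\<forall>(r, c)\<in>P. (r, c) \<noteq> (0, 0) \<longrightarrow>
        (\<exists>r'<r. (r', c) \<in> P) \<noteq> (\<exists>c'<c. (r, c') \<in> P)) \<and>
     (\<forall>(r, c)\<in>D. (\<exists>c'. (r, c') \<in> P) \<and> (\<exists>r'. (r', c) \<in> P)))"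

text \<open>Row \<open>i\<close> of the staircase consists of the cells \<open>(i, n), (i, n - 1), \<dots>, (i, i)\<close>.\<close>

definition cell_pos :: "nat \<Rightarrow> nat \<times> nat \<Rightarrow> nat \<times> nat" where
  "cell_pos n = (\<lambda>(i, j). (i - 1, n - j))"

definition staircase :: "nat \<Rightarrow> (nat \<times> nat) set" where
  "staircase n = cell_pos n ` {(i, j). 1 \<le> i \<and> i \<le> j \<and> j \<le> n}"

definition filling :: "nat \<Rightarrow> ('k::field mat, 'k vec) module \<Rightarrow> pointed_diagram" where
  "filling n M = (staircase n,
     cell_pos n ` {(i, j). 1 \<le> i \<and> i \<le> j \<and> j \<le> n \<and>
       is_summand (Lambda n) (interval_module n i j :: ('k mat, 'k vec) module) M})"

text \<open>A row or column that is kept moves to the position given by the number of kept rows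
  above it or kept columns to its left.\<close>

definition shrink :: "pointed_diagram \<Rightarrow> pointed_diagram" where
  "shrink T = (case T of (D, P) \<Rightarrow>
     let R = fst ` P; C = snd ` P;
         pos = (\<lambda>(r, c). (card {r'\<in>R. r' < r}, card {c'\<in>C. c' < c}))
     in (pos ` (D \<inter> R \<times> C), pos ` P))"

definition sh :: "nat \<Rightarrow> ('k::field mat, 'k vec) module \<Rightarrow> pointed_diagram" where
  "sh n M = shrink (filling n M)"


section \<open>Basic facts\<close>

lemma Lambda_simps:
  "carrier (Lambda n) = {A \<in> carrier_mat n n. \<forall>r<n. \<forall>c<n. r < c \<longrightarrow> A $$ (r, c) = 0}"
  "monoid.mult (Lambda n) = (*)" "one (Lambda n) = 1\<^sub>m n"
  "zero (Lambda n) = 0\<^sub>m n n" "add (Lambda n) = (+)"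
  by (simp_all add: Lambda_def ring_mat_def)

lemma staircase_eq: "staircase n = {(r, c). r + c < n}"
proof -
  have "(r, c) \<in> staircase n" if "r + c < n" for r c
    unfolding staircase_def cell_pos_def using that
    by (intro image_eqI[where x = "(Suc r, n - c)"]) auto
  then show ?thesis
    by (auto simp: staircase_def cell_pos_def)
qed

lemma ring_Lambda: "ring (Lambda n :: 'k::field mat ring)"
proof (rule ringI)
  show "abelian_group (Lambda n :: 'k mat ring)"
  proof (rule abelian_groupI)
    fix A :: "'k mat" assume "A \<in> carrier (Lambda n)"
    then show "\<exists>B\<in>carrier (Lambda n). B \<oplus>\<^bsub>Lambda n\<^esub> A = \<zero>\<^bsub>Lambda n\<^esub>"
      by (intro bexI[of _ "- A"]) (auto simp: Lambda_simps)
  qed (auto simp: Lambda_simps)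
  have closed: "A * B \<in> carrier (Lambda n)"
    if "A \<in> carrier (Lambda n)" "B \<in> carrier (Lambda n)" for A B :: "'k mat"
  proof -
    have "(A * B) $$ (r, c) = 0" if "r < n" "c < n" "r < c" for r c
    proof -
      have "A $$ (r, l) * B $$ (l, c) = 0" if "l < n" for l
        using \<open>A \<in> carrier (Lambda n)\<close> \<open>B \<in> carrier (Lambda n)\<close> \<open>r < n\<close> \<open>c < n\<close> \<open>r < c\<close> that
        by (cases "r < l") (auto simp: Lambda_simps)
      moreover have "A \<in> carrier_mat n n" "B \<in> carrier_mat n n"
        using \<open>A \<in> carrier (Lambda n)\<close> \<open>B \<in> carrier (Lambda n)\<close> by (simp_all add: Lambda_simps)
      ultimately show ?thesis
        using \<open>r < n\<close> \<open>c < n\<close> by (simp add: scalar_prod_def sum.neutral del: mult_eq_0_iff)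
    qed
    then show ?thesis using that by (auto simp: Lambda_simps)
  qed
  show "monoid (Lambda n :: 'k mat ring)"
  proof (rule monoidI)
    fix A B C :: "'k mat"
    assume "A \<in> carrier (Lambda n)" "B \<in> carrier (Lambda n)" "C \<in> carrier (Lambda n)"
    then have "A \<in> carrier_mat n n" "B \<in> carrier_mat n n" "C \<in> carrier_mat n n"
      by (simp_all add: Lambda_simps)
    then have "A * B * C = A * (B * C)" by (rule assoc_mult_mat)
    then show "A \<otimes>\<^bsub>Lambda n\<^esub> B \<otimes>\<^bsub>Lambda n\<^esub> C = A \<otimes>\<^bsub>Lambda n\<^esub> (B \<otimes>\<^bsub>Lambda n\<^esub> C)"
      by (simp add: Lambda_simps)
  next
    show "A \<otimes>\<^bsub>Lambda n\<^esub> B \<in> carrier (Lambda n)"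
      if "A \<in> carrier (Lambda n)" "B \<in> carrier (Lambda n)" for A B :: "'k mat"
      using closed[OF that] by (simp add: Lambda_simps(2))
  qed (simp_all add: Lambda_simps left_mult_one_mat[of _ n n] right_mult_one_mat[of _ n n])
  fix A B C :: "'k mat"
  assume "A \<in> carrier (Lambda n)" "B \<in> carrier (Lambda n)" "C \<in> carrier (Lambda n)"
  then have "A \<in> carrier_mat n n" "B \<in> carrier_mat n n" "C \<in> carrier_mat n n"
    by (simp_all add: Lambda_simps)
  then have "(A + B) * C = A * C + B * C" "C * (A + B) = C * A + C * B"
    by (metis add_mult_distrib_mat, metis mult_add_distrib_mat)
  then show "(A \<oplus>\<^bsub>Lambda n\<^esub> B) \<otimes>\<^bsub>Lambda n\<^esub> C =
        A \<otimes>\<^bsub>Lambda n\<^esub> C \<oplus>\<^bsub>Lambda n\<^esub> B \<otimes>\<^bsub>Lambda n\<^esub> C"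
      "C \<otimes>\<^bsub>Lambda n\<^esub> (A \<oplus>\<^bsub>Lambda n\<^esub> B) =
        C \<otimes>\<^bsub>Lambda n\<^esub> A \<oplus>\<^bsub>Lambda n\<^esub> C \<otimes>\<^bsub>Lambda n\<^esub> B"
    by (simp_all add: Lambda_simps)
qed

lemma interval_module_simps:
  "carrier (interval_module n i j) =
     {v \<in> carrier_vec n. \<forall>k<n. \<not> (i \<le> Suc k \<and> Suc k \<le> j) \<longrightarrow> v $ k = 0}"
  "zero (interval_module n i j) = 0\<^sub>v n"
  "add (interval_module n i j) = (+)"
  "smult (interval_module n i j) =
     (\<lambda>A v. vec n (\<lambda>k. if i \<le> Suc k \<and> Suc k \<le> j then (A *\<^sub>v v) $ k else 0))"
  by (simp_all add: interval_module_def)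

lemma left_module_interval_module:
  "left_module (Lambda n) (interval_module n i j :: ('k::field mat, 'k vec) module)"
proof (intro left_module.intro left_module_axioms.intro ring_Lambda)
  let ?M = "interval_module n i j :: ('k mat, 'k vec) module"
  show "abelian_group ?M"
  proof (rule abelian_groupI)
    fix v assume "v \<in> carrier ?M"
    then show "\<exists>w\<in>carrier ?M. w \<oplus>\<^bsub>?M\<^esub> v = \<zero>\<^bsub>?M\<^esub>"
      by (intro bexI[of _ "- v"]) (auto simp: interval_module_simps)
  qed (auto simp: interval_module_simps)
  show "(A \<otimes>\<^bsub>Lambda n\<^esub> B) \<odot>\<^bsub>?M\<^esub> v = A \<odot>\<^bsub>?M\<^esub> (B \<odot>\<^bsub>?M\<^esub> v)"
    if "A \<in> carrier (Lambda n)" "B \<in> carrier (Lambda n)" "v \<in> carrier ?M"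
    for A B :: "'k mat" and v
  proof -
    have A: "A \<in> carrier_mat n n" and B: "B \<in> carrier_mat n n" and v: "v \<in> carrier_vec n"
      using that by (auto simp: Lambda_simps interval_module_simps)
    have "(A * B *\<^sub>v v) $ k =
        (A *\<^sub>v vec n (\<lambda>k. if i \<le> Suc k \<and> Suc k \<le> j then (B *\<^sub>v v) $ k else 0)) $ k"
      if k: "k < n" "i \<le> Suc k" "Suc k \<le> j" for k
    proof -
      have "A $$ (k, l) * (B *\<^sub>v v) $ l =
          A $$ (k, l) * (if i \<le> Suc l \<and> Suc l \<le> j then (B *\<^sub>v v) $ l else 0)"
        if l: "l < n" for l
      proof (cases "i \<le> Suc l \<and> Suc l \<le> j")
        case False
        show ?thesis
        proof (cases "k < l")
          case True
          then show ?thesis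
            using \<open>A \<in> carrier (Lambda n)\<close> l by (simp add: Lambda_simps)
        next
          case False
          with \<open>\<not> (i \<le> Suc l \<and> Suc l \<le> j)\<close> k have li: "Suc l < i" by auto
          have "B $$ (l, m) * v $ m = 0" if "m < n" for m
            using \<open>B \<in> carrier (Lambda n)\<close> \<open>v \<in> carrier ?M\<close> li l that
            by (cases "l < m") (auto simp: Lambda_simps interval_module_simps)
          then have "(B *\<^sub>v v) $ l = 0"
            using B v l by (auto simp: scalar_prod_def intro!: sum.neutral)
          then show ?thesis by simp
        qed
      qed simp
      note eq = this
      have "(A * B *\<^sub>v v) $ k = (A *\<^sub>v (B *\<^sub>v v)) $ k"
        using A B v by (simp only: assoc_mult_mat_vec)
      also have "\<dots> = (\<Sum>l = 0..<n. A $$ (k, l) * (B *\<^sub>v v) $ l)"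
        using A B k by (auto simp: scalar_prod_def intro!: sum.cong)
      also have "\<dots> = (\<Sum>l = 0..<n. A $$ (k, l) *
          (if i \<le> Suc l \<and> Suc l \<le> j then (B *\<^sub>v v) $ l else 0))"
        by (intro sum.cong refl eq) simp
      also have "\<dots> = (A *\<^sub>v vec n (\<lambda>k. if i \<le> Suc k \<and> Suc k \<le> j then (B *\<^sub>v v) $ k else 0)) $ k"
        using A k by (auto simp: scalar_prod_def intro!: sum.cong)
      finally show ?thesis .
    qed
    then show ?thesis
      by (simp add: Lambda_simps interval_module_simps cong: if_cong) (intro eq_vecI; simp)
  qed
  show "\<one>\<^bsub>Lambda n\<^esub> \<odot>\<^bsub>?M\<^esub> v = v" if "v \<in> carrier ?M" for v
    using that by (intro eq_vecI) (auto simp: Lambda_simps interval_module_simps)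
  fix A B :: "'k mat" and v w
  assume "A \<in> carrier (Lambda n)" "B \<in> carrier (Lambda n)" "v \<in> carrier ?M" "w \<in> carrier ?M"
  then have carr: "A \<in> carrier_mat n n" "B \<in> carrier_mat n n" "v \<in> carrier_vec n" "w \<in> carrier_vec n"
    by (simp_all add: Lambda_simps interval_module_simps)
  show "A \<odot>\<^bsub>?M\<^esub> v \<in> carrier ?M"
    by (simp add: interval_module_simps)
  have "(A + B) *\<^sub>v v = A *\<^sub>v v + B *\<^sub>v v" "A *\<^sub>v (v + w) = A *\<^sub>v v + A *\<^sub>v w"
    using carr by (metis add_mult_distrib_mat_vec, metis mult_add_distrib_mat_vec)
  then show "(A \<oplus>\<^bsub>Lambda n\<^esub> B) \<odot>\<^bsub>?M\<^esub> v = A \<odot>\<^bsub>?M\<^esub> v \<oplus>\<^bsub>?M\<^esub> B \<odot>\<^bsub>?M\<^esub> v"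
      "A \<odot>\<^bsub>?M\<^esub> (v \<oplus>\<^bsub>?M\<^esub> w) = A \<odot>\<^bsub>?M\<^esub> v \<oplus>\<^bsub>?M\<^esub> A \<odot>\<^bsub>?M\<^esub> w"
    using carr by (auto simp: Lambda_simps interval_module_simps intro!: eq_vecI simp del: index_mult_mat_vec)
qed

text \<open>The submodules of \<open>M\<^sub>i\<^sub>j\<close> form a chain. The maximal one omits \<open>e\<^sub>i\<close> and the minimal
  nonzero one is spanned by \<open>e\<^sub>j\<close>.\<close>

lemma submodule_interval_module:
  assumes "1 \<le> i" "i \<le> j" "j \<le> n"
  assumes H: "submodule H (Lambda n) (interval_module n i j :: ('k::field mat, 'k vec) module)"
  shows "\<exists>l\<in>{i..Suc j}. H = carrier (interval_module n l j :: ('k mat, 'k vec) module)"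
proof -
  let ?M = "\<lambda>l. interval_module n l j :: ('k mat, 'k vec) module"
  note subgrp = submodule.axioms(1)[OF H]
  have carr: "v \<in> carrier (?M l) \<longleftrightarrow>
      dim_vec v = n \<and> (\<forall>k<n. \<not> (l \<le> Suc k \<and> Suc k \<le> j) \<longrightarrow> v $ k = 0)" for l v
    by (auto simp: interval_module_simps)
  have subc: "v \<in> carrier (?M i)" if "v \<in> H" for v
    using subgroup.subset[OF subgrp] that by auto
  have sub: "dim_vec v = n" "k < n \<Longrightarrow> \<not> (i \<le> Suc k \<and> Suc k \<le> j) \<Longrightarrow> v $ k = 0" if "v \<in> H" for v k
    using subc[OF that] unfolding carr by blast+
  have z: "0\<^sub>v n \<in> H" using subgroup.one_closed[OF subgrp] by (simp add: interval_module_simps)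
  define l where "l = (LEAST l. l = Suc j \<or> (1 \<le> l \<and> l \<le> n \<and> (\<exists>v\<in>H. v $ (l - 1) \<noteq> 0)))"
  have l: "l = Suc j \<or> (1 \<le> l \<and> l \<le> n \<and> (\<exists>v\<in>H. v $ (l - 1) \<noteq> 0))"
    unfolding l_def by (rule LeastI) blast
  have min: "l \<le> m" if "m = Suc j \<or> (1 \<le> m \<and> m \<le> n \<and> (\<exists>v\<in>H. v $ (m - 1) \<noteq> 0))" for m
    unfolding l_def using that by (rule Least_le)
  have lj: "l \<le> Suc j" by (rule min) simp
  have il: "i \<le> l"
  proof (rule ccontr)
    assume "\<not> i \<le> l"
    with l assms(2) obtain v where v: "v \<in> H" "v $ (l - 1) \<noteq> 0" and ln: "1 \<le> l" "l \<le> n"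
      by auto
    have "l - 1 < n" "\<not> (i \<le> Suc (l - 1) \<and> Suc (l - 1) \<le> j)"
      using ln \<open>\<not> i \<le> l\<close> by auto
    with v show False using sub(2) by blast
  qed
  have "H \<subseteq> carrier (?M l)"
  proof
    fix v assume v: "v \<in> H"
    have "v $ k = 0" if "k < n" "\<not> (l \<le> Suc k \<and> Suc k \<le> j)" for k
    proof (cases "l \<le> Suc k")
      case True
      with il that have "\<not> (i \<le> Suc k \<and> Suc k \<le> j)" by linarith
      then show ?thesis using sub(2) v that(1) by blast
    next
      case False
      then show ?thesis using min[of "Suc k"] v that by auto
    qed
    then show "v \<in> carrier (?M l)" using sub(1)[OF v] by (simp add: carr)
  qed
  moreover have "carrier (?M l) \<subseteq> H"
  proof
    fix w assume w: "w \<in> carrier (?M l)"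
    show "w \<in> H"
    proof (cases "l = Suc j")
      case True
      then have "w = 0\<^sub>v n" using w unfolding carr by (intro eq_vecI) auto
      then show ?thesis using z by simp
    next
      case False
      with l obtain v where v: "v \<in> H" "v $ (l - 1) \<noteq> 0" and ln: "1 \<le> l" "l \<le> n" by auto
      define A where "A = mat n n (\<lambda>(r, c). if c = l - 1 then w $ r / v $ (l - 1) else 0)"
      have w0: "w $ r = 0" if "r < l - 1" for r
      proof -
        have "r < n" "\<not> (l \<le> Suc r \<and> Suc r \<le> j)" using that ln by auto
        then show ?thesis using w unfolding carr by blast
      qed
      have "A \<in> carrier (Lambda n)" by (auto simp: A_def Lambda_simps w0)
      from submodule.smult_closed[OF H this v(1)] have AH: "A \<odot>\<^bsub>?M i\<^esub> v \<in> H" .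
      have vn: "dim_vec v = n" "dim_vec w = n"
        using sub(1)[OF v(1)] w unfolding carr by auto
      have "(A *\<^sub>v v) $ r = w $ r" if "r < n" for r
      proof -
        have "(A *\<^sub>v v) $ r =
            (\<Sum>c = 0..<n. (if c = l - 1 then w $ r / v $ (l - 1) else 0) * v $ c)"
          using that vn by (simp add: A_def scalar_prod_def)
        also have "\<dots> = (\<Sum>c = 0..<n. if c = l - 1 then w $ r else 0)"
          using v(2) by (intro sum.cong) auto
        also have "\<dots> = w $ r" using ln by simp
        finally show ?thesis .
      qed
      note Av = this
      have w1: "w $ k = 0" if "k < n" "\<not> (i \<le> Suc k \<and> Suc k \<le> j)" for k
        using w that il unfolding carr by auto
      have "A \<odot>\<^bsub>?M i\<^esub> v = w"
        unfolding interval_module_simps by (rule eq_vecI) (use Av w1 vn in \<open>simp_all del: index_mult_mat_vec\<close>)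
      then show ?thesis using AH by simp
    qed
  qed
  ultimately show ?thesis using il lj by auto
qed

end

theory Submission
  imports Defs
begin

text \<open>An indecomposable module over \<open>Lambda n\<close> is an interval module: a vector
  at the first nonzero vertex generates an interval module that splits off. So a module is
  determined by the set of its pointed cells once the multiplicities are one, and these are
  recovered from the module, since a nonzero composition of two maps between interval modules that
  begins and ends at the same one passes through that one only. Computing the double centraliser of
  a direct sum of distinct interval modules shows that it is faithfully balanced iff the top left
  cell is pointed, every other pointed cell has a pointed cell above it or to its left, and for
  \<open>0 < b < n\<close> row \<open>b\<close> or column \<open>n - b\<close> contains a pointed
  cell. The second condition bounds the number of nonempty rows and columns by the number of pointed
  cells plus one, the third bounds it by \<open>n + 1\<close> from below. With \<open>n\<close>
  pointed cells both bounds are sharp: no pointed cell has pointed cells both above and to the left,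
  and exactly one of row \<open>b\<close> and column \<open>n - b\<close> is kept, so that the kept
  rows and columns are the steps of the boundary path of the shrunk diagram and can be read off from
  it.\<close>

section \<open>Modules and homomorphisms\<close>

text \<open>A pointed cell above \<open>(r, c)\<close> is an interval module that contains the one
  at \<open>(r, c)\<close> as a submodule, and a pointed cell to its left is one that has it as a
  quotient. Following such cells leads to the origin, the module of all column vectors. A map in the
  double centraliser respects these embeddings and quotients, so its matrix at the origin controls
  it on every summand. In terms of vertices, a cell in row \<open>b\<close> has top
  \<open>S[b + 1]\<close> and a cell in column \<open>n - b\<close> has socle \<open>S[b]\<close>,
  so the third condition says that the support of some summand separates the two ends of each arrow.
  Two obstacles shape the rest. The hypotheses provide one decomposition with pairwise nonisomorphic
  summands and another one with \<open>n\<close> summands; they are compared through the scalars of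
  maps between interval modules. And vectors are inconvenient for direct sums, so the computations
  take place in modules of functions, and every notion is carried along isomorphisms.\<close>

lemma (in left_module) smult_r_null [simp]:
  assumes "a \<in> carrier R" shows "a \<odot>\<^bsub>M\<^esub> \<zero>\<^bsub>M\<^esub> = \<zero>\<^bsub>M\<^esub>"
proof -
  have "a \<odot>\<^bsub>M\<^esub> \<zero>\<^bsub>M\<^esub> = a \<odot>\<^bsub>M\<^esub> \<zero>\<^bsub>M\<^esub> \<oplus>\<^bsub>M\<^esub> a \<odot>\<^bsub>M\<^esub> \<zero>\<^bsub>M\<^esub>"
    using smult_r_distr[OF assms, of "\<zero>\<^bsub>M\<^esub>" "\<zero>\<^bsub>M\<^esub>"] by simp
  then show ?thesis
    using assms by (metis M.add.r_cancel_one' M.zero_closed smult_closed)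
qed

lemma (in left_module) smult_l_null [simp]:
  assumes "x \<in> carrier M" shows "\<zero>\<^bsub>R\<^esub> \<odot>\<^bsub>M\<^esub> x = \<zero>\<^bsub>M\<^esub>"
proof -
  have "\<zero>\<^bsub>R\<^esub> \<odot>\<^bsub>M\<^esub> x = \<zero>\<^bsub>R\<^esub> \<odot>\<^bsub>M\<^esub> x \<oplus>\<^bsub>M\<^esub> \<zero>\<^bsub>R\<^esub> \<odot>\<^bsub>M\<^esub> x"
    using smult_l_distr[of "\<zero>\<^bsub>R\<^esub>" "\<zero>\<^bsub>R\<^esub>" x] assms by simp
  then show ?thesis
    using assms by (metis M.add.r_cancel_one' R.zero_closed smult_closed)
qed

lemma (in left_module) smult_minus_one:
  assumes "x \<in> carrier M" shows "(\<ominus>\<^bsub>R\<^esub> \<one>\<^bsub>R\<^esub>) \<odot>\<^bsub>M\<^esub> x = \<ominus>\<^bsub>M\<^esub> x"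
proof -
  have "(\<ominus>\<^bsub>R\<^esub> \<one>\<^bsub>R\<^esub>) \<odot>\<^bsub>M\<^esub> x \<oplus>\<^bsub>M\<^esub> x = \<zero>\<^bsub>M\<^esub>"
    using smult_l_distr[of "\<ominus>\<^bsub>R\<^esub> \<one>\<^bsub>R\<^esub>" "\<one>\<^bsub>R\<^esub>" x] assms by (simp add: R.l_neg)
  then show ?thesis
    using assms by (metis M.minus_equality R.add.inv_closed R.one_closed smult_closed)
qed

lemma (in left_module) finsum_smult:
  assumes "finite A" "a \<in> carrier R" "f \<in> A \<rightarrow> carrier M"
  shows "a \<odot>\<^bsub>M\<^esub> (\<Oplus>\<^bsub>M\<^esub>i\<in>A. f i) = (\<Oplus>\<^bsub>M\<^esub>i\<in>A. a \<odot>\<^bsub>M\<^esub> f i)"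
  using assms by (induction A rule: finite_induct) (auto simp: Pi_def smult_r_distr)

text \<open>Closure under negatives is automatic, as -x = (-1) x.\<close>

lemma (in left_module) submodule_left_moduleI:
  assumes "H \<subseteq> carrier M" "\<zero>\<^bsub>M\<^esub> \<in> H"
    and "\<And>x y. x \<in> H \<Longrightarrow> y \<in> H \<Longrightarrow> x \<oplus>\<^bsub>M\<^esub> y \<in> H"
    and "\<And>a x. a \<in> carrier R \<Longrightarrow> x \<in> H \<Longrightarrow> a \<odot>\<^bsub>M\<^esub> x \<in> H"
  shows "submodule H R M"
proof (intro submodule.intro submodule_axioms.intro subgroup.intro)
  fix x assume "x \<in> H"
  then have "(\<ominus>\<^bsub>R\<^esub> \<one>\<^bsub>R\<^esub>) \<odot>\<^bsub>M\<^esub> x \<in> H" using assms by simp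
  then show "inv\<^bsub>add_monoid M\<^esub> x \<in> H"
    using smult_minus_one[of x] \<open>x \<in> H\<close> assms(1) by (auto simp: a_inv_def)
qed (use assms in auto)

lemma submodule_closed:
  assumes "submodule H R M"
  shows "x \<in> H \<Longrightarrow> x \<in> carrier M" "\<zero>\<^bsub>M\<^esub> \<in> H" "x \<in> H \<Longrightarrow> y \<in> H \<Longrightarrow> x \<oplus>\<^bsub>M\<^esub> y \<in> H"
    "a \<in> carrier R \<Longrightarrow> x \<in> H \<Longrightarrow> a \<odot>\<^bsub>M\<^esub> x \<in> H"
proof -
  note s = submodule.axioms(1)[OF assms]
  show "x \<in> H \<Longrightarrow> x \<in> carrier M" using subgroup.subset[OF s] by auto
  show "\<zero>\<^bsub>M\<^esub> \<in> H" using subgroup.one_closed[OF s] by simp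
  show "x \<in> H \<Longrightarrow> y \<in> H \<Longrightarrow> x \<oplus>\<^bsub>M\<^esub> y \<in> H" using subgroup.m_closed[OF s] by simp
  show "a \<in> carrier R \<Longrightarrow> x \<in> H \<Longrightarrow> a \<odot>\<^bsub>M\<^esub> x \<in> H" using submodule.smult_closed[OF assms] .
qed

lemma (in left_module) submodule_minus:
  assumes "submodule H R M" "x \<in> H" shows "\<ominus>\<^bsub>M\<^esub> x \<in> H"
  using submodule_closed[OF assms(1)] assms(2) smult_minus_one[of x]
  by (metis R.add.inv_closed R.one_closed)

lemma (in left_module) left_module_submodule:
  assumes H: "submodule H R M"
  shows "left_module R (M\<lparr>carrier := H\<rparr>)"
proof (intro left_module.intro left_module_axioms.intro R.ring_axioms)
  note c = submodule_closed[OF H]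
  show "abelian_group (M\<lparr>carrier := H\<rparr>)"
  proof (rule abelian_groupI)
    fix x assume x: "x \<in> carrier (M\<lparr>carrier := H\<rparr>)"
    then show "\<exists>y\<in>carrier (M\<lparr>carrier := H\<rparr>). y \<oplus>\<^bsub>M\<lparr>carrier := H\<rparr>\<^esub> x = \<zero>\<^bsub>M\<lparr>carrier := H\<rparr>\<^esub>"
      using c submodule_minus[OF H, of x] by (intro bexI[of _ "\<ominus>\<^bsub>M\<^esub> x"]) (auto simp: M.l_neg)
  qed (use c in \<open>auto simp: M.add.m_ac\<close>)
qed (use submodule_closed[OF H] in \<open>auto simp: smult_l_distr smult_r_distr smult_assoc1\<close>)

lemma (in left_module) submodule_carrier: "submodule (carrier M) R M"
  by (rule submodule_left_moduleI) auto

lemma (in left_module) submodule_zero: "submodule {\<zero>\<^bsub>M\<^esub>} R M"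
  by (rule submodule_left_moduleI) auto

section \<open>Homomorphisms, composition and isomorphism\<close>

lemma mod_homI:
  assumes "\<And>x. x \<in> carrier M \<Longrightarrow> f x \<in> carrier N" "f \<in> extensional (carrier M)"
    and "\<And>x y. x \<in> carrier M \<Longrightarrow> y \<in> carrier M \<Longrightarrow> f (x \<oplus>\<^bsub>M\<^esub> y) = f x \<oplus>\<^bsub>N\<^esub> f y"
    and "\<And>a x. a \<in> carrier R \<Longrightarrow> x \<in> carrier M \<Longrightarrow> f (a \<odot>\<^bsub>M\<^esub> x) = a \<odot>\<^bsub>N\<^esub> f x"
  shows "f \<in> mod_hom R M N"
  using assms by (auto simp: mod_hom_def PiE_def)

lemma mod_homD:
  assumes "f \<in> mod_hom R M N"
  shows "x \<in> carrier M \<Longrightarrow> f x \<in> carrier N" "f \<in> extensional (carrier M)"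
    and "x \<in> carrier M \<Longrightarrow> y \<in> carrier M \<Longrightarrow> f (x \<oplus>\<^bsub>M\<^esub> y) = f x \<oplus>\<^bsub>N\<^esub> f y"
    and "a \<in> carrier R \<Longrightarrow> x \<in> carrier M \<Longrightarrow> f (a \<odot>\<^bsub>M\<^esub> x) = a \<odot>\<^bsub>N\<^esub> f x"
  using assms by (auto simp: mod_hom_def PiE_def)

text \<open>Allows maps to be written down as total functions. Since \<open>M\<close> is closed
  under its operations, restriction does not change the values that additivity and linearity
  compare.\<close>

lemma mod_homI_restrict:
  assumes "left_module R M" "\<And>x. x \<in> carrier M \<Longrightarrow> f x \<in> carrier N"
    and "\<And>x y. x \<in> carrier M \<Longrightarrow> y \<in> carrier M \<Longrightarrow> f (x \<oplus>\<^bsub>M\<^esub> y) = f x \<oplus>\<^bsub>N\<^esub> f y"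
    and "\<And>a x. a \<in> carrier R \<Longrightarrow> x \<in> carrier M \<Longrightarrow> f (a \<odot>\<^bsub>M\<^esub> x) = a \<odot>\<^bsub>N\<^esub> f x"
  shows "restrict f (carrier M) \<in> mod_hom R M N"
proof -
  interpret M: left_module R M by fact
  show ?thesis by (rule mod_homI) (use assms in auto)
qed

lemma mod_hom_zero:
  assumes "left_module R M" "left_module R N" "f \<in> mod_hom R M N"
  shows "f \<zero>\<^bsub>M\<^esub> = \<zero>\<^bsub>N\<^esub>"
proof -
  interpret M: left_module R M by fact
  interpret N: left_module R N by fact
  have "f \<zero>\<^bsub>M\<^esub> = f (\<zero>\<^bsub>R\<^esub> \<odot>\<^bsub>M\<^esub> \<zero>\<^bsub>M\<^esub>)" by simp
  also have "\<dots> = \<zero>\<^bsub>R\<^esub> \<odot>\<^bsub>N\<^esub> f \<zero>\<^bsub>M\<^esub>" using mod_homD(4)[OF assms(3)] by blast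
  finally show ?thesis using mod_homD(1)[OF assms(3)] by simp
qed

lemma mod_hom_finsum:
  assumes "left_module R M" "left_module R N" "f \<in> mod_hom R M N"
    and "finite A" "h \<in> A \<rightarrow> carrier M"
  shows "f (\<Oplus>\<^bsub>M\<^esub>i\<in>A. h i) = (\<Oplus>\<^bsub>N\<^esub>i\<in>A. f (h i))"
proof -
  interpret M: left_module R M by fact
  interpret N: left_module R N by fact
  show ?thesis
    using assms(4,5)
    by (induction A rule: finite_induct)
      (auto simp: Pi_def mod_hom_zero[OF assms(1-3)] mod_homD[OF assms(3)])
qed

lemma mod_hom_compose:
  assumes "left_module R M" "f \<in> mod_hom R M N" "g \<in> mod_hom R N K"
  shows "compose (carrier M) g f \<in> mod_hom R M K"
  unfolding compose_def
  by (rule mod_homI_restrict[OF assms(1)])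
    (auto simp: mod_homD[OF assms(2)] mod_homD[OF assms(3)])

lemma mod_hom_inv_into:
  assumes "left_module R M" "f \<in> mod_hom R M N" "bij_betw f (carrier M) (carrier N)"
  shows "restrict (inv_into (carrier M) f) (carrier N) \<in> mod_hom R N M"
proof -
  interpret M: left_module R M by fact
  have inj: "inj_on f (carrier M)" and im: "f ` carrier M = carrier N"
    using assms(3) by (auto simp: bij_betw_def)
  have i: "inv_into (carrier M) f (f x) = x" if "x \<in> carrier M" for x
    using inj that by simp
  have add: "f x \<oplus>\<^bsub>N\<^esub> f y = f (x \<oplus>\<^bsub>M\<^esub> y)" if "x \<in> carrier M" "y \<in> carrier M" for x y
    using mod_homD(3)[OF assms(2)] that by simp
  have smult: "a \<odot>\<^bsub>N\<^esub> f x = f (a \<odot>\<^bsub>M\<^esub> x)" if "a \<in> carrier R" "x \<in> carrier M" for a x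
    using mod_homD(4)[OF assms(2)] that by simp
  have *: "restrict (inv_into (carrier M) f) (carrier N) (f x) = x" if "x \<in> carrier M" for x
    using i[OF that] mod_homD(1)[OF assms(2) that] by simp
  have ex: "\<exists>y\<in>carrier M. x = f y" if "x \<in> carrier N" for x
    using that im by auto
  show ?thesis
  proof (rule mod_homI)
    fix x assume "x \<in> carrier N"
    then obtain x' where x': "x' \<in> carrier M" "x = f x'" using ex by blast
    show "restrict (inv_into (carrier M) f) (carrier N) x \<in> carrier M"
      unfolding x'(2) *[OF x'(1)] by fact
    show "restrict (inv_into (carrier M) f) (carrier N) (a \<odot>\<^bsub>N\<^esub> x) =
        a \<odot>\<^bsub>M\<^esub> restrict (inv_into (carrier M) f) (carrier N) x" if "a \<in> carrier R" for a
      unfolding x'(2) *[OF x'(1)] smult[OF that x'(1)] using that x'(1) by (intro *) simp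
    fix y assume "y \<in> carrier N"
    then obtain y' where y': "y' \<in> carrier M" "y = f y'" using ex by blast
    show "restrict (inv_into (carrier M) f) (carrier N) (x \<oplus>\<^bsub>N\<^esub> y) =
        restrict (inv_into (carrier M) f) (carrier N) x \<oplus>\<^bsub>M\<^esub>
        restrict (inv_into (carrier M) f) (carrier N) y"
      unfolding x'(2) y'(2) *[OF x'(1)] *[OF y'(1)] add[OF x'(1) y'(1)]
      using x'(1) y'(1) by (intro *) simp
  qed simp
qed

lemma mod_iso_refl:
  assumes "left_module R M" shows "mod_iso R M M"
  unfolding mod_iso_def
  by (rule bexI[OF _ mod_homI_restrict[OF assms, of "\<lambda>x. x"]]) (auto simp: bij_betw_def inj_on_def)

lemma mod_iso_sym:
  assumes "left_module R M" "mod_iso R M N" shows "mod_iso R N M"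
proof -
  obtain f where f: "f \<in> mod_hom R M N" "bij_betw f (carrier M) (carrier N)"
    using assms(2) by (auto simp: mod_iso_def)
  have "bij_betw (restrict (inv_into (carrier M) f) (carrier N)) (carrier N) (carrier M)"
    using bij_betw_inv_into[OF f(2)] by (simp cong: bij_betw_cong)
  then show ?thesis
    unfolding mod_iso_def by (rule bexI[OF _ mod_hom_inv_into[OF assms(1) f]])
qed

lemma mod_iso_trans:
  assumes "left_module R M" "mod_iso R M N" "mod_iso R N K" shows "mod_iso R M K"
proof -
  obtain f g where f: "f \<in> mod_hom R M N" "bij_betw f (carrier M) (carrier N)"
    and g: "g \<in> mod_hom R N K" "bij_betw g (carrier N) (carrier K)"
    using assms(2,3) by (auto simp: mod_iso_def)
  have "bij_betw (compose (carrier M) g f) (carrier M) (carrier K)"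
    using bij_betw_trans[OF f(2) g(2)] by (simp add: compose_def o_def cong: bij_betw_cong)
  then show ?thesis
    unfolding mod_iso_def by (rule bexI[OF _ mod_hom_compose[OF assms(1) f(1) g(1)]])
qed

lemma mod_isoE:
  assumes "left_module R M" "mod_iso R M N"
  obtains f g where "f \<in> mod_hom R M N" "bij_betw f (carrier M) (carrier N)" "g \<in> mod_hom R N M"
    "\<And>x. x \<in> carrier M \<Longrightarrow> g (f x) = x" "\<And>y. y \<in> carrier N \<Longrightarrow> f (g y) = y"
proof -
  obtain f where f: "f \<in> mod_hom R M N" "bij_betw f (carrier M) (carrier N)"
    using assms(2) by (auto simp: mod_iso_def)
  show thesis
    by (rule that[OF f mod_hom_inv_into[OF assms(1) f]])
      (use f(2) mod_homD(1)[OF f(1)] in \<open>simp_all add: bij_betw_def f_inv_into_f\<close>)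
qed

lemma mod_hom_carrier_update:
  assumes "f \<in> mod_hom R M (N\<lparr>carrier := A\<rparr>)" "A \<subseteq> carrier N"
  shows "f \<in> mod_hom R M N"
  by (rule mod_homI) (use mod_homD[OF assms(1)] assms(2) in auto)

section \<open>Direct summands as retracts\<close>

lemma internal_sum2_projection:
  assumes "left_module R M" "internal_sum2 R M A B"
  obtains p where "p \<in> mod_hom R M (M\<lparr>carrier := A\<rparr>)"
    "\<And>a. a \<in> A \<Longrightarrow> p a = a" "\<And>b. b \<in> B \<Longrightarrow> p b = \<zero>\<^bsub>M\<^esub>"
proof -
  interpret M: left_module R M by fact
  have A: "submodule A R M" and B: "submodule B R M" and AB: "A \<inter> B = {\<zero>\<^bsub>M\<^esub>}"
    and sum: "A <+>\<^bsub>M\<^esub> B = carrier M"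
    using assms(2) by (auto simp: internal_sum2_def)
  note cA = submodule_closed[OF A] and cB = submodule_closed[OF B]
  \<comment> \<open>The component in \<open>A\<close> is unique: the difference of two candidates is
    also a difference of elements of \<open>B\<close>, so it lies in the intersection.\<close>
  define p where "p x = (THE a. a \<in> A \<and> (\<exists>b\<in>B. x = a \<oplus>\<^bsub>M\<^esub> b))" for x
  have p: "p (a \<oplus>\<^bsub>M\<^esub> b) = a" if "a \<in> A" "b \<in> B" for a b
    unfolding p_def
  proof (rule the_equality)
    show "a \<in> A \<and> (\<exists>b'\<in>B. a \<oplus>\<^bsub>M\<^esub> b = a \<oplus>\<^bsub>M\<^esub> b')" using that by blast
    fix a' assume "a' \<in> A \<and> (\<exists>b'\<in>B. a \<oplus>\<^bsub>M\<^esub> b = a' \<oplus>\<^bsub>M\<^esub> b')"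
    then obtain b' where a': "a' \<in> A" and b': "b' \<in> B" and eq: "a \<oplus>\<^bsub>M\<^esub> b = a' \<oplus>\<^bsub>M\<^esub> b'" by blast
    have car: "a \<in> carrier M" "a' \<in> carrier M" "b \<in> carrier M" "b' \<in> carrier M"
      using that a' b' cA(1) cB(1) by auto
    have "a \<oplus>\<^bsub>M\<^esub> \<ominus>\<^bsub>M\<^esub> a' = b' \<oplus>\<^bsub>M\<^esub> \<ominus>\<^bsub>M\<^esub> b"
    proof -
      have "a = (a' \<oplus>\<^bsub>M\<^esub> b') \<oplus>\<^bsub>M\<^esub> \<ominus>\<^bsub>M\<^esub> b" using car eq M.M.add.inv_solve_right'[of "a' \<oplus>\<^bsub>M\<^esub> b'" b a]
        by (simp add: M.M.a_assoc M.M.r_neg flip: eq)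
      then have "a \<oplus>\<^bsub>M\<^esub> \<ominus>\<^bsub>M\<^esub> a' = ((a' \<oplus>\<^bsub>M\<^esub> b') \<oplus>\<^bsub>M\<^esub> \<ominus>\<^bsub>M\<^esub> b) \<oplus>\<^bsub>M\<^esub> \<ominus>\<^bsub>M\<^esub> a'" by simp
      also have "\<dots> = (a' \<oplus>\<^bsub>M\<^esub> \<ominus>\<^bsub>M\<^esub> a') \<oplus>\<^bsub>M\<^esub> (b' \<oplus>\<^bsub>M\<^esub> \<ominus>\<^bsub>M\<^esub> b)" using car
        by (simp add: M.M.add.m_ac)
      finally show ?thesis using car by (simp add: M.M.r_neg)
    qed
    moreover have "a \<oplus>\<^bsub>M\<^esub> \<ominus>\<^bsub>M\<^esub> a' \<in> A" "b' \<oplus>\<^bsub>M\<^esub> \<ominus>\<^bsub>M\<^esub> b \<in> B"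
      using cA(3) cB(3) that a' b' M.submodule_minus[OF A] M.submodule_minus[OF B] by auto
    ultimately have "a \<oplus>\<^bsub>M\<^esub> \<ominus>\<^bsub>M\<^esub> a' = \<zero>\<^bsub>M\<^esub>" using AB by auto
    then show "a' = a" using car by (metis M.M.minus_equality M.M.minus_minus M.M.add.inv_closed)
  qed
  have ex: "\<exists>a\<in>A. \<exists>b\<in>B. x = a \<oplus>\<^bsub>M\<^esub> b" if "x \<in> carrier M" for x
    using that sum unfolding set_add_def' by blast
  show thesis
  proof (rule that[OF mod_homI_restrict[OF assms(1), of p]])
    show "p x \<in> carrier (M\<lparr>carrier := A\<rparr>)" if "x \<in> carrier M" for x
      using ex[OF that] p by auto
    show "p (x \<oplus>\<^bsub>M\<^esub> y) = p x \<oplus>\<^bsub>M\<lparr>carrier := A\<rparr>\<^esub> p y" if "x \<in> carrier M" "y \<in> carrier M" for x y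
    proof -
      obtain a b a' b' where e: "a \<in> A" "b \<in> B" "x = a \<oplus>\<^bsub>M\<^esub> b" "a' \<in> A" "b' \<in> B" "y = a' \<oplus>\<^bsub>M\<^esub> b'"
        using ex[OF \<open>x \<in> carrier M\<close>] ex[OF \<open>y \<in> carrier M\<close>] by blast
      have "x \<oplus>\<^bsub>M\<^esub> y = (a \<oplus>\<^bsub>M\<^esub> a') \<oplus>\<^bsub>M\<^esub> (b \<oplus>\<^bsub>M\<^esub> b')"
        using e cA(1) cB(1) by (simp add: M.M.add.m_ac)
      then show ?thesis using e cA(3) cB(3) p by simp
    qed
    show "p (c \<odot>\<^bsub>M\<^esub> x) = c \<odot>\<^bsub>M\<lparr>carrier := A\<rparr>\<^esub> p x" if "c \<in> carrier R" "x \<in> carrier M" for c x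
    proof -
      obtain a b where e: "a \<in> A" "b \<in> B" "x = a \<oplus>\<^bsub>M\<^esub> b" using ex[OF \<open>x \<in> carrier M\<close>] by blast
      then have "c \<odot>\<^bsub>M\<^esub> x = c \<odot>\<^bsub>M\<^esub> a \<oplus>\<^bsub>M\<^esub> c \<odot>\<^bsub>M\<^esub> b"
        using cA(1) cB(1) that by (simp add: M.smult_r_distr)
      then show ?thesis using e cA(4) cB(4) p that by simp
    qed
    show "restrict p (carrier M) a = a" if "a \<in> A" for a
      using p[OF that cB(2)] cA(1) that by simp
    show "restrict p (carrier M) b = \<zero>\<^bsub>M\<^esub>" if "b \<in> B" for b
      using p[OF cA(2) that] cB(1) that by simp
  qed
qed

lemma submodule_image:
  assumes "left_module R M" "left_module R N" "f \<in> mod_hom R M N" "submodule H R M"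
  shows "submodule (f ` H) R N"
proof -
  interpret N: left_module R N by fact
  note f = mod_homD[OF assms(3)] and c = submodule_closed[OF assms(4)]
  show ?thesis
  proof (rule N.submodule_left_moduleI)
    show "f ` H \<subseteq> carrier N" using f c by auto
    show "\<zero>\<^bsub>N\<^esub> \<in> f ` H" using mod_hom_zero[OF assms(1-3)] c(2) by (metis imageI)
    show "x \<oplus>\<^bsub>N\<^esub> y \<in> f ` H" if "x \<in> f ` H" "y \<in> f ` H" for x y
      using that f(3)[symmetric] c by (auto intro!: imageI)
    show "a \<odot>\<^bsub>N\<^esub> x \<in> f ` H" if "a \<in> carrier R" "x \<in> f ` H" for a x
      using that f(4)[symmetric] c by (auto intro!: imageI)
  qed
qed

lemma submodule_vimage:
  assumes "left_module R M" "left_module R N" "f \<in> mod_hom R M N" "submodule H R N"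
  shows "submodule {x \<in> carrier M. f x \<in> H} R M"
proof -
  interpret M: left_module R M by fact
  note f = mod_homD[OF assms(3)] and c = submodule_closed[OF assms(4)]
  show ?thesis
    by (rule M.submodule_left_moduleI) (use f c mod_hom_zero[OF assms(1-3)] in auto)
qed

text \<open>From right to left, \<open>A\<close> is the image of \<open>f\<close> and
  \<open>B\<close> is the kernel of \<open>g\<close>, because x = f (g x) + (x - f (g x)). This form
  replaces submodules by maps, which can be composed with isomorphisms and evaluated on
  coordinates.\<close>

lemma is_summand_iff_retract:
  assumes M: "left_module R M" and N: "left_module R N"
  shows "is_summand R N M \<longleftrightarrow>
    (\<exists>f\<in>mod_hom R N M. \<exists>g\<in>mod_hom R M N. \<forall>x\<in>carrier N. g (f x) = x)"
proof
  interpret M: left_module R M by fact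
  interpret N: left_module R N by fact
  assume "is_summand R N M"
  then obtain A B f where AB: "internal_sum2 R M A B" and f: "f \<in> mod_hom R N (M\<lparr>carrier := A\<rparr>)"
    "bij_betw f (carrier N) (carrier (M\<lparr>carrier := A\<rparr>))"
    by (auto simp: is_summand_def mod_iso_def)
  obtain p where p: "p \<in> mod_hom R M (M\<lparr>carrier := A\<rparr>)" "\<And>a. a \<in> A \<Longrightarrow> p a = a"
    using internal_sum2_projection[OF M AB] by metis
  define g where "g = restrict (inv_into (carrier N) f) (carrier (M\<lparr>carrier := A\<rparr>))"
  have g: "g \<in> mod_hom R (M\<lparr>carrier := A\<rparr>) N"
    unfolding g_def by (rule mod_hom_inv_into[OF N f])
  have "submodule A R M" using AB by (simp add: internal_sum2_def)
  then have "A \<subseteq> carrier M" using submodule_closed(1) by auto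
  moreover have "compose (carrier M) g p (f x) = x" if "x \<in> carrier N" for x
  proof -
    have "f x \<in> A" using mod_homD(1)[OF f(1) that] by simp
    then have "f x \<in> carrier M" "p (f x) = f x" using \<open>A \<subseteq> carrier M\<close> p(2) by auto
    then show ?thesis using \<open>f x \<in> A\<close> that f(2) by (simp add: compose_def g_def bij_betw_def)
  qed
  ultimately show "\<exists>f\<in>mod_hom R N M. \<exists>g\<in>mod_hom R M N. \<forall>x\<in>carrier N. g (f x) = x"
    using mod_hom_carrier_update[OF f(1)] mod_hom_compose[OF M p(1) g] by blast
next
  interpret M: left_module R M by fact
  interpret N: left_module R N by fact
  assume "\<exists>f\<in>mod_hom R N M. \<exists>g\<in>mod_hom R M N. \<forall>x\<in>carrier N. g (f x) = x"
  then obtain f g where f: "f \<in> mod_hom R N M" and g: "g \<in> mod_hom R M N"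
    and gf: "\<And>x. x \<in> carrier N \<Longrightarrow> g (f x) = x" by blast
  define A B where "A = f ` carrier N" and "B = {x \<in> carrier M. g x \<in> {\<zero>\<^bsub>N\<^esub>}}"
  have A: "submodule A R M" unfolding A_def by (rule submodule_image[OF N M f N.submodule_carrier])
  have B: "submodule B R M" unfolding B_def by (rule submodule_vimage[OF M N g N.submodule_zero])
  have "A \<inter> B = {\<zero>\<^bsub>M\<^esub>}"
  proof -
    have "\<zero>\<^bsub>M\<^esub> \<in> A \<inter> B" using submodule_closed(2)[OF A] submodule_closed(2)[OF B] by simp
    moreover have "x = \<zero>\<^bsub>M\<^esub>" if "x \<in> A \<inter> B" for x
      using that gf mod_hom_zero[OF N M f] by (auto simp: A_def B_def)
    ultimately show ?thesis by blast
  qed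
  moreover have "A <+>\<^bsub>M\<^esub> B = carrier M"
  proof
    show "A <+>\<^bsub>M\<^esub> B \<subseteq> carrier M" using submodule_closed(1)[OF A] submodule_closed(1)[OF B]
      by (auto simp: set_add_def')
    show "carrier M \<subseteq> A <+>\<^bsub>M\<^esub> B"
    proof
      fix x assume x: "x \<in> carrier M"
      have fgx: "f (g x) \<in> A" using mod_homD(1)[OF g x] by (simp add: A_def)
      then have c: "f (g x) \<in> carrier M" using submodule_closed(1)[OF A] by simp
      have "g (x \<oplus>\<^bsub>M\<^esub> \<ominus>\<^bsub>M\<^esub> f (g x)) = \<zero>\<^bsub>N\<^esub>"
      proof -
        have "g (\<ominus>\<^bsub>M\<^esub> f (g x)) = \<ominus>\<^bsub>N\<^esub> g x"
          unfolding M.smult_minus_one[OF c, symmetric] using mod_homD(1)[OF g x]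
          by (subst mod_homD(4)[OF g]) (auto simp: c gf N.smult_minus_one)
        then show ?thesis using x c mod_homD(1)[OF g x] by (simp add: mod_homD(3)[OF g] N.M.r_neg)
      qed
      then have "x \<oplus>\<^bsub>M\<^esub> \<ominus>\<^bsub>M\<^esub> f (g x) \<in> B" using x c by (simp add: B_def)
      moreover have "x = f (g x) \<oplus>\<^bsub>M\<^esub> (x \<oplus>\<^bsub>M\<^esub> \<ominus>\<^bsub>M\<^esub> f (g x))"
        using x c by (metis M.M.a_comm M.M.add.inv_closed M.M.a_assoc M.M.l_neg M.M.r_zero)
      ultimately show "x \<in> A <+>\<^bsub>M\<^esub> B" using fgx unfolding set_add_def' by blast
    qed
  qed
  moreover have "mod_iso R N (M\<lparr>carrier := A\<rparr>)"
    unfolding mod_iso_def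
  proof (rule bexI)
    show "bij_betw f (carrier N) (carrier (M\<lparr>carrier := A\<rparr>))"
      by (auto simp: A_def bij_betw_def intro: inj_on_inverseI[of _ g] gf)
    show "f \<in> mod_hom R N (M\<lparr>carrier := A\<rparr>)"
      by (rule mod_homI) (auto simp: A_def mod_homD[OF f])
  qed
  ultimately show "is_summand R N M"
    using A B unfolding is_summand_def internal_sum2_def by blast
qed

lemma is_summand_iso:
  assumes "left_module R N" "left_module R M" "left_module R M'" "mod_iso R M M'"
    and "is_summand R N M"
  shows "is_summand R N M'"
proof -
  interpret N: left_module R N by fact
  obtain h h' where h: "h \<in> mod_hom R M M'" and h': "h' \<in> mod_hom R M' M"
    and h'h: "\<And>x. x \<in> carrier M \<Longrightarrow> h' (h x) = x"
    by (rule mod_isoE[OF assms(2,4)]) blast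
  obtain f g where f: "f \<in> mod_hom R N M" and g: "g \<in> mod_hom R M N"
    and gf: "\<And>x. x \<in> carrier N \<Longrightarrow> g (f x) = x"
    using assms(5) by (auto simp: is_summand_iff_retract[OF assms(2,1)])
  have "compose (carrier M') g h' (compose (carrier N) h f x) = x" if "x \<in> carrier N" for x
    using that mod_homD(1)[OF f that] mod_homD(1)[OF h] h'h gf by (simp add: compose_def)
  then show ?thesis
    using mod_hom_compose[OF assms(1) f h] mod_hom_compose[OF assms(3) h' g]
    by (auto simp: is_summand_iff_retract[OF assms(3,1)])
qed

section \<open>Direct sums of interval modules\<close>

text \<open>From here on interval modules are labelled by cells of the diagram. The cell \<open>(r, c)\<close> stands for
  \<open>M\<^sub>i\<^sub>j\<close> with \<open>i = r + 1\<close> and \<open>j = n - c\<close>, which lives on the coordinates \<open>k\<close> with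
  \<open>r \<le> k < n - c\<close>.\<close>

abbreviation imod :: "nat \<Rightarrow> nat \<times> nat \<Rightarrow> ('k::field mat, 'k vec) module" where
  "imod n p \<equiv> interval_module n (Suc (fst p)) (n - snd p)"

definition supp :: "nat \<Rightarrow> nat \<times> nat \<Rightarrow> nat set" where
  "supp n p = {k. fst p \<le> k \<and> k + snd p < n}"

text \<open>The direct sum of the modules \<open>imod n (s t)\<close> over \<open>T\<close>, with
  \<open>x t k\<close> as coordinate \<open>k\<close> of the summand \<open>t\<close>. The index
  type is free, so that labels may repeat before multiplicity one is known. The test in the action
  discards what falls past the socle; coordinates before the top receive nothing from a lower
  triangular matrix.\<close>

definition std :: "nat \<Rightarrow> 't set \<Rightarrow> ('t \<Rightarrow> nat \<times> nat) \<Rightarrow> ('k::field mat, 't \<Rightarrow> nat \<Rightarrow> 'k) module" where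
  "std n T s = \<lparr>carrier = {x. \<forall>t k. \<not> (t \<in> T \<and> k \<in> supp n (s t)) \<longrightarrow> x t k = 0},
     monoid.mult = undefined, one = undefined,
     zero = (\<lambda>_ _. 0), add = (\<lambda>x y t k. x t k + y t k),
     smult = (\<lambda>A x t k. if t \<in> T \<and> k \<in> supp n (s t) then \<Sum>l<n. A $$ (k, l) * x t l else 0)\<rparr>"

lemma std_simps:
  "x \<in> carrier (std n T s) \<longleftrightarrow> (\<forall>t k. \<not> (t \<in> T \<and> k \<in> supp n (s t)) \<longrightarrow> x t k = 0)"
  "zero (std n T s) = (\<lambda>_ _. 0)"
  "add (std n T s) = (\<lambda>x y t k. x t k + y t k)"
  "smult (std n T s) =
    (\<lambda>A x t k. if t \<in> T \<and> k \<in> supp n (s t) then \<Sum>l<n. A $$ (k, l) * x t l else 0)"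
  by (simp_all add: std_def)

lemma std_out: "x \<in> carrier (std n T s) \<Longrightarrow> \<not> (t \<in> T \<and> k \<in> supp n (s t)) \<Longrightarrow> x t k = 0"
  by (simp add: std_simps)

lemma supp_less: "k \<in> supp n p \<Longrightarrow> k < n"
  by (simp add: supp_def)

lemma Lambda_mult_entry:
  assumes "A \<in> carrier (Lambda n)" "B \<in> carrier (Lambda n)" "k < n" "m < n"
  shows "(A * B) $$ (k, m) = (\<Sum>l<n. A $$ (k, l) * B $$ (l, m))"
  using assms by (auto simp: Lambda_simps scalar_prod_def atLeast0LessThan intro!: sum.cong)

text \<open>The point is associativity: truncating B x before applying A must not matter. A
  discarded coordinate \<open>l\<close> lies either past the socle, where lower triangularity makes
  \<open>A $$ (k, l)\<close> vanish, or before the top, where B x itself vanishes.\<close>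

lemma left_module_std: "left_module (Lambda n) (std n T s :: ('k::field mat, 't \<Rightarrow> nat \<Rightarrow> 'k) module)"
proof (intro left_module.intro left_module_axioms.intro ring_Lambda)
  let ?M = "std n T s :: ('k mat, 't \<Rightarrow> nat \<Rightarrow> 'k) module"
  show "abelian_group ?M"
  proof (rule abelian_groupI)
    fix x assume "x \<in> carrier ?M"
    then show "\<exists>y\<in>carrier ?M. y \<oplus>\<^bsub>?M\<^esub> x = \<zero>\<^bsub>?M\<^esub>"
      by (intro bexI[of _ "\<lambda>t k. - x t k"]) (auto simp: std_simps)
  qed (auto simp: std_simps algebra_simps)
  fix A B :: "'k mat" and x y
  assume A: "A \<in> carrier (Lambda n)" and x: "x \<in> carrier ?M"
  show "A \<odot>\<^bsub>?M\<^esub> x \<in> carrier ?M" by (simp add: std_simps)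
  show "A \<odot>\<^bsub>?M\<^esub> (x \<oplus>\<^bsub>?M\<^esub> y) = A \<odot>\<^bsub>?M\<^esub> x \<oplus>\<^bsub>?M\<^esub> A \<odot>\<^bsub>?M\<^esub> y"
    by (auto simp: std_simps fun_eq_iff sum.distrib algebra_simps)
  assume B: "B \<in> carrier (Lambda n)"
  have "A \<in> carrier_mat n n" "B \<in> carrier_mat n n" using A B by (auto simp: Lambda_simps)
  then have e: "(A + B) $$ (k, l) = A $$ (k, l) + B $$ (k, l)" if "k < n" "l < n" for k l
    using that by simp
  show "(A \<oplus>\<^bsub>Lambda n\<^esub> B) \<odot>\<^bsub>?M\<^esub> x = A \<odot>\<^bsub>?M\<^esub> x \<oplus>\<^bsub>?M\<^esub> B \<odot>\<^bsub>?M\<^esub> x"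
    by (auto simp: std_simps Lambda_simps fun_eq_iff sum.distrib[symmetric] algebra_simps e
        dest!: supp_less intro!: sum.cong)
  have "(\<Sum>m<n. (A * B) $$ (k, m) * x t m) =
      (\<Sum>l<n. A $$ (k, l) * (if t \<in> T \<and> l \<in> supp n (s t) then \<Sum>m<n. B $$ (l, m) * x t m else 0))"
    if tk: "t \<in> T" "k \<in> supp n (s t)" for t k
  proof -
    have kn: "k < n" using tk supp_less by blast
    have "(\<Sum>m<n. (A * B) $$ (k, m) * x t m) = (\<Sum>m<n. \<Sum>l<n. A $$ (k, l) * B $$ (l, m) * x t m)"
      using A B kn by (simp add: Lambda_mult_entry sum_distrib_right)
    also have "\<dots> = (\<Sum>l<n. A $$ (k, l) * (\<Sum>m<n. B $$ (l, m) * x t m))"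
      by (subst sum.swap) (simp add: sum_distrib_left mult.assoc)
    also have "\<dots> = (\<Sum>l<n. A $$ (k, l) *
        (if t \<in> T \<and> l \<in> supp n (s t) then \<Sum>m<n. B $$ (l, m) * x t m else 0))"
    proof (rule sum.cong[OF refl])
      fix l assume l: "l \<in> {..<n}"
      show "A $$ (k, l) * (\<Sum>m<n. B $$ (l, m) * x t m) = A $$ (k, l) *
          (if t \<in> T \<and> l \<in> supp n (s t) then \<Sum>m<n. B $$ (l, m) * x t m else 0)"
      proof (cases "l \<in> supp n (s t) \<or> k < l")
        case True
        then show ?thesis using tk(1) A l kn by (auto simp: Lambda_simps)
      next
        case False
        then have "l < fst (s t)" using tk(2) by (auto simp: supp_def)
        have "B $$ (l, m) * x t m = 0" if "m < n" for m
        proof (cases "l < m")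
          case True then show ?thesis using B l that by (auto simp: Lambda_simps)
        next
          case False then show ?thesis using std_out[OF x, of t m] \<open>l < fst (s t)\<close> by (auto simp: supp_def)
        qed
        then have "(\<Sum>m<n. B $$ (l, m) * x t m) = 0" by (intro sum.neutral) auto
        then show ?thesis by simp
      qed
    qed
    finally show ?thesis .
  qed
  then show "(A \<otimes>\<^bsub>Lambda n\<^esub> B) \<odot>\<^bsub>?M\<^esub> x = A \<odot>\<^bsub>?M\<^esub> (B \<odot>\<^bsub>?M\<^esub> x)"
    by (auto simp: std_simps Lambda_simps fun_eq_iff)
next
  let ?M = "std n T s :: ('k mat, 't \<Rightarrow> nat \<Rightarrow> 'k) module"
  fix x assume x: "x \<in> carrier ?M"
  have "(\<Sum>l<n. 1\<^sub>m n $$ (k, l) * x t l) = x t k" if "k < n" for t k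
  proof -
    have "(\<Sum>l<n. 1\<^sub>m n $$ (k, l) * x t l) = (\<Sum>l<n. if l = k then x t l else 0)"
      using that by (intro sum.cong) auto
    then show ?thesis using that by simp
  qed
  then have "(\<Sum>l<n. 1\<^sub>m n $$ (k, l) * x t l) = x t k" if "k \<in> supp n (s t)" for t k
    using supp_less[OF that] .
  then show "\<one>\<^bsub>Lambda n\<^esub> \<odot>\<^bsub>?M\<^esub> x = x"
    using std_out[OF x] by (auto simp: std_simps(4) Lambda_simps fun_eq_iff)
qed

lemma finsum_std:
  assumes "finite I" "h \<in> I \<rightarrow> carrier (std n T s)"
  shows "finsum (std n T s) h I = (\<lambda>t k. \<Sum>i\<in>I. h i t k)"
proof -
  interpret left_module "Lambda n" "std n T s" by (rule left_module_std)
  show ?thesis using assms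
    by (induction I rule: finite_induct) (auto simp: std_simps(2,3) fun_eq_iff Pi_def)
qed

text \<open>A multiple of a matrix unit. The scalar is built in because the field acts on a module
  only through matrices.\<close>

definition mu :: "nat \<Rightarrow> nat \<Rightarrow> nat \<Rightarrow> 'k \<Rightarrow> 'k::field mat" where
  "mu n k l a = mat n n (\<lambda>(i, j). if i = k \<and> j = l then a else 0)"

text \<open>The case \<open>a = 0\<close> allows a coordinate of a vector as scalar in positions
  where it is known to vanish.\<close>

lemma mu_Lambda: "l \<le> k \<or> a = 0 \<Longrightarrow> mu n k l a \<in> carrier (Lambda n)"
  by (auto simp: mu_def Lambda_simps)

lemma mu_smult_std:
  assumes "l < n"
  shows "mu n k l a \<odot>\<^bsub>std n T s\<^esub> x =
    (\<lambda>t i. if t \<in> T \<and> i = k \<and> k \<in> supp n (s t) then a * x t l else 0)"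
proof -
  have "(\<Sum>j<n. mu n k l a $$ (i, j) * x t j) = (if i = k then a * x t l else 0)" if "i < n" for t i
  proof -
    have "(\<Sum>j<n. mu n k l a $$ (i, j) * x t j) = (\<Sum>j<n. if j = l then if i = k then a * x t j else 0 else 0)"
      using that by (intro sum.cong) (auto simp: mu_def)
    then show ?thesis using assms by simp
  qed
  then have "(\<Sum>j<n. mu n k l a $$ (i, j) * x t j) = (if i = k then a * x t l else 0)"
    if "i \<in> supp n (s t)" for i t
    using supp_less[OF that] .
  then show ?thesis by (auto simp: std_simps(4) fun_eq_iff)
qed

definition eps :: "'t \<Rightarrow> nat \<Rightarrow> 't \<Rightarrow> nat \<Rightarrow> 'k::field" where
  "eps t k = (\<lambda>u i. if u = t \<and> i = k then 1 else 0)"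

lemma eps_carrier: "t \<in> T \<Longrightarrow> k \<in> supp n (s t) \<Longrightarrow> eps t k \<in> carrier (std n T s)"
  by (auto simp: eps_def std_simps)

text \<open>Up to a scalar there is at most one map between two interval modules. It exists when an end
  segment of the source is an initial segment of the target.\<close>

lemma mod_hom_std:
  fixes T :: "'t set" and T' :: "'u set" and f :: "('t \<Rightarrow> nat \<Rightarrow> 'k::field) \<Rightarrow> 'u \<Rightarrow> nat \<Rightarrow> 'k"
  assumes f: "f \<in> mod_hom (Lambda n) (std n T s) (std n T' s')"
    and fin: "finite T" and valid: "\<And>t. t \<in> T \<Longrightarrow> fst (s t) + snd (s t) < n"
  shows "\<exists>G. (\<forall>t\<in>T. \<forall>u\<in>T'. G t u \<noteq> 0 \<longrightarrow> fst (s' u) \<le> fst (s t) \<and> snd (s t) \<le> snd (s' u)) \<and>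
    (\<forall>x\<in>carrier (std n T s). \<forall>u\<in>T'. \<forall>k\<in>supp n (s' u). f x u k = (\<Sum>t\<in>T. G t u * x t k))"
proof -
  let ?M = "std n T s :: ('k mat, _) module" and ?N = "std n T' s' :: ('k mat, _) module"
  interpret M: left_module "Lambda n" ?M by (rule left_module_std)
  interpret N: left_module "Lambda n" ?N by (rule left_module_std)
  note h = mod_homD[OF f]
  \<comment> \<open>The summand \<open>t\<close> is generated by its top coordinate vector, so
    \<open>f\<close> is determined by the images of these vectors. Only the coordinate of the image
    at the same vertex matters; it is the scalar \<open>G t u\<close>.\<close>
  define b :: "'t \<Rightarrow> 't \<Rightarrow> nat \<Rightarrow> 'k" where "b t = eps t (fst (s t))" for t
  have b: "b t \<in> carrier ?M" if "t \<in> T" for t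
    unfolding b_def using valid[OF that] that by (intro eps_carrier) (auto simp: supp_def)
  define G where "G t u = f (b t) u (fst (s t))" for t u
  show ?thesis
  proof (rule exI[of _ G], rule conjI; intro ballI impI)
    fix t u assume t: "t \<in> T" and u: "u \<in> T'" and G: "G t u \<noteq> 0"
    have ru: "fst (s t) \<in> supp n (s' u)"
      using G std_out[OF h(1)[OF b[OF t]]] unfolding G_def by blast
    show "fst (s' u) \<le> fst (s t) \<and> snd (s t) \<le> snd (s' u)"
    proof (rule ccontr)
      assume "\<not> ?thesis"
      with ru have lt: "snd (s' u) < snd (s t)" by (auto simp: supp_def)
      \<comment> \<open>The last vertex of the target. If the source ends before it, the matrix unit
        from the top of the source to \<open>e\<close> kills \<open>b t\<close> but not its
        image.\<close>
      define e where "e = n - 1 - snd (s' u)"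
      have e: "fst (s t) \<le> e" "e \<in> supp n (s' u)" "e \<notin> supp n (s t)"
        using lt ru valid[OF t] by (auto simp: e_def supp_def)
      have rn: "fst (s t) < n" using valid[OF t] by simp
      have "mu n e (fst (s t)) 1 \<odot>\<^bsub>?M\<^esub> b t = \<zero>\<^bsub>?M\<^esub>"
        using e(3) unfolding mu_smult_std[OF rn] by (auto simp: std_simps b_def eps_def fun_eq_iff)
      then have "mu n e (fst (s t)) 1 \<odot>\<^bsub>?N\<^esub> f (b t) = \<zero>\<^bsub>?N\<^esub>"
        using h(4)[OF mu_Lambda b[OF t]] e(1) mod_hom_zero[OF left_module_std left_module_std f]
        by metis
      then have "(mu n e (fst (s t)) 1 \<odot>\<^bsub>?N\<^esub> f (b t)) u e = 0" by (simp add: std_simps)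
      then show False using G u e(2) unfolding mu_smult_std[OF rn] by (simp add: G_def)
    qed
  next
    fix x u k assume x: "x \<in> carrier ?M" and u: "u \<in> T'" and k: "k \<in> supp n (s' u)"
    have kn: "k < n" using k by (rule supp_less)
    have A: "mu n k (fst (s t)) (x t k) \<in> carrier (Lambda n)" for t
      using std_out[OF x, of t k] by (intro mu_Lambda) (auto simp: supp_def)
    have A': "mu n k (fst (s t)) (x t k) \<odot>\<^bsub>?M\<^esub> b t =
        (\<lambda>t' i. if t' = t \<and> i = k then x t k else 0)" if t: "t \<in> T" for t
      using std_out[OF x, of t k] valid[OF t] t
      by (subst mu_smult_std) (auto simp: b_def eps_def fun_eq_iff)
    \<comment> \<open>The component of \<open>x\<close> at vertex \<open>k\<close> is assembled from
      the generators. The matrix unit \<open>mu n k k 1\<close> removes the other vertices on both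
      sides of \<open>f\<close>.\<close>
    have "mu n k k 1 \<odot>\<^bsub>?M\<^esub> x = (\<Oplus>\<^bsub>?M\<^esub>t\<in>T. mu n k (fst (s t)) (x t k) \<odot>\<^bsub>?M\<^esub> b t)"
      unfolding mu_smult_std[OF kn]
      using b fin A std_out[OF x]
      by (subst finsum_std) (auto simp: A' fun_eq_iff sum.delta' intro!: sum.neutral)
    then have "f (mu n k k 1 \<odot>\<^bsub>?M\<^esub> x) = (\<Oplus>\<^bsub>?N\<^esub>t\<in>T. f (mu n k (fst (s t)) (x t k) \<odot>\<^bsub>?M\<^esub> b t))"
      using mod_hom_finsum[OF left_module_std left_module_std f fin] b A by auto
    also have "\<dots> = (\<Oplus>\<^bsub>?N\<^esub>t\<in>T. mu n k (fst (s t)) (x t k) \<odot>\<^bsub>?N\<^esub> f (b t))"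
      using b A h by (intro N.finsum_cong') auto
    also have "\<dots> = (\<lambda>u i. \<Sum>t\<in>T. (mu n k (fst (s t)) (x t k) \<odot>\<^bsub>?N\<^esub> f (b t)) u i)"
      using b A h fin by (intro finsum_std) auto
    finally have "f (mu n k k 1 \<odot>\<^bsub>?M\<^esub> x) u k = (\<Sum>t\<in>T. (mu n k (fst (s t)) (x t k) \<odot>\<^bsub>?N\<^esub> f (b t)) u k)"
      by simp
    also have "\<dots> = (\<Sum>t\<in>T. G t u * x t k)"
    proof (rule sum.cong[OF refl])
      fix t assume "t \<in> T"
      then have "fst (s t) < n" using valid by fastforce
      then show "(mu n k (fst (s t)) (x t k) \<odot>\<^bsub>?N\<^esub> f (b t)) u k = G t u * x t k"
        using u k by (subst mu_smult_std) (auto simp: G_def)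
    qed
    finally have "f (mu n k k 1 \<odot>\<^bsub>?M\<^esub> x) u k = (\<Sum>t\<in>T. G t u * x t k)" .
    moreover have "f (mu n k k 1 \<odot>\<^bsub>?M\<^esub> x) u k = (mu n k k 1 \<odot>\<^bsub>?N\<^esub> f x) u k"
      using h(4)[OF mu_Lambda x] by simp
    ultimately show "f x u k = (\<Sum>t\<in>T. G t u * x t k)"
      using u k unfolding mu_smult_std[OF kn] by simp
  qed
qed

text \<open>Going from \<open>imod n (s' t)\<close> to \<open>std n T s\<close> and on to \<open>imod n (s' v)\<close>, only the summands
  labelled by both \<open>s' t\<close> and \<open>s' v\<close> contribute. Here \<open>\<Sum>u. G t u * H u v\<close> is the scalar of the
  composition.\<close>

lemma std_retract_scalars:
  fixes T :: "'t set" and T' :: "'u set" and f :: "('u \<Rightarrow> nat \<Rightarrow> 'k::field) \<Rightarrow> 't \<Rightarrow> nat \<Rightarrow> 'k"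
  assumes f: "f \<in> mod_hom (Lambda n) (std n T' s') (std n T s)"
    and g: "g \<in> mod_hom (Lambda n) (std n T s) (std n T' s')"
    and gf: "\<And>x. x \<in> carrier (std n T' s') \<Longrightarrow> g (f x) = x"
    and fin: "finite T" "finite T'" and valid: "\<And>t. t \<in> T \<Longrightarrow> fst (s t) + snd (s t) < n"
    and valid': "\<And>t. t \<in> T' \<Longrightarrow> fst (s' t) + snd (s' t) < n"
  shows "\<exists>(G :: 'u \<Rightarrow> 't \<Rightarrow> 'k) H. \<forall>t\<in>T'. \<forall>v\<in>T'. s' t = s' v \<longrightarrow>
    (\<Sum>u | u \<in> T \<and> s u = s' t. G t u * H u v) = (if t = v then 1 else 0)"
proof -
  obtain G where "\<forall>t\<in>T'. \<forall>u\<in>T. G t u \<noteq> 0 \<longrightarrow> fst (s u) \<le> fst (s' t) \<and> snd (s' t) \<le> snd (s u)"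
    "\<forall>x\<in>carrier (std n T' s'). \<forall>u\<in>T. \<forall>k\<in>supp n (s u). f x u k = (\<Sum>t\<in>T'. G t u * x t k)"
    by (rule exE[OF mod_hom_std[OF f fin(2) valid']]) auto
  note G = this[rule_format]
  obtain H where "\<forall>t\<in>T. \<forall>u\<in>T'. H t u \<noteq> 0 \<longrightarrow> fst (s' u) \<le> fst (s t) \<and> snd (s t) \<le> snd (s' u)"
    "\<forall>x\<in>carrier (std n T s). \<forall>u\<in>T'. \<forall>k\<in>supp n (s' u). g x u k = (\<Sum>t\<in>T. H t u * x t k)"
    by (rule exE[OF mod_hom_std[OF g fin(1) valid]]) auto
  note H = this[rule_format]
  show ?thesis
  proof (intro exI ballI impI)
    fix t v assume t: "t \<in> T'" and v: "v \<in> T'" and eq: "s' t = s' v"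
    define k where "k = fst (s' t)"
    have k: "k \<in> supp n (s' t)" "k \<in> supp n (s' v)" using valid'[OF t] eq by (auto simp: k_def supp_def)
    have e: "eps t k \<in> carrier (std n T' s')" using t k by (intro eps_carrier)
    have "(if t = v then 1 else 0) = g (f (eps t k)) v k" using gf[OF e] by (auto simp: eps_def)
    also have "\<dots> = (\<Sum>u\<in>T. H u v * f (eps t k) u k)"
      using H(2)[OF _ v k(2)] mod_homD(1)[OF f e] by blast
    also have "\<dots> = (\<Sum>u\<in>T. if s u = s' t then G t u * H u v else 0)"
    proof (rule sum.cong[OF refl])
      fix u assume u: "u \<in> T"
      have fu: "f (eps t k) u k = (if k \<in> supp n (s u) then G t u else 0)"
      proof (cases "k \<in> supp n (s u)")
        case True
        have "f (eps t k) u k = (\<Sum>t'\<in>T'. G t' u * eps t k t' k)" using G(2)[OF e u True] .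
        also have "\<dots> = (\<Sum>t'\<in>T'. if t' = t then G t u else 0)"
          by (intro sum.cong) (auto simp: eps_def)
        also have "\<dots> = G t u" using t fin by simp
        finally show ?thesis using True by simp
      next
        case False
        then show ?thesis using std_out[OF mod_homD(1)[OF f e], of u k] by simp
      qed
      show "H u v * f (eps t k) u k = (if s u = s' t then G t u * H u v else 0)"
      proof (cases "s u = s' t")
        case True
        then show ?thesis using fu k by simp
      next
        case False
        \<comment> \<open>If both scalars were nonzero, the inequalities between the labels would
          hold in both directions, as the composition ends at the label where it began.\<close>
        then have "G t u = 0 \<or> H u v = 0"
          using G(1)[OF t u] H(1)[OF u v] eq by (metis order.antisym prod.expand)
        then show ?thesis using fu False by auto
      qed
    qed
    also have "\<dots> = (\<Sum>u | u \<in> T \<and> s u = s' t. G t u * H u v)"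
      by (simp only: sum.inter_filter[OF fin(1)])
    finally show "(\<Sum>u | u \<in> T \<and> s u = s' t. G t u * H u v) = (if t = v then 1 else 0)" by (rule sym)
  qed
qed

text \<open>A retraction makes the sum in \<open>std_retract_scalars\<close> equal to 1, so it has a
  term, and this term is a summand labelled \<open>p\<close>. The converse uses the coordinate
  inclusion and projection.\<close>

lemma is_summand_std:
  assumes fin: "finite T" and valid: "\<And>t. t \<in> T \<Longrightarrow> fst (s t) + snd (s t) < n"
    and p: "fst p + snd p < n"
  shows "is_summand (Lambda n) (std n {()} (\<lambda>_. p) :: ('k::field mat, _) module) (std n T s) \<longleftrightarrow> p \<in> s ` T"
proof
  let ?N = "std n {()} (\<lambda>_. p) :: ('k mat, _) module" and ?M = "std n T s :: ('k mat, _) module"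
  assume "is_summand (Lambda n) ?N ?M"
  then obtain f g where f: "f \<in> mod_hom (Lambda n) ?N ?M" and g: "g \<in> mod_hom (Lambda n) ?M ?N"
    and gf: "\<And>x. x \<in> carrier ?N \<Longrightarrow> g (f x) = x"
    unfolding is_summand_iff_retract[OF left_module_std left_module_std] by blast
  obtain G H where "\<And>t v. t \<in> {()} \<Longrightarrow> v \<in> {()} \<Longrightarrow> p = p \<Longrightarrow>
      (\<Sum>u | u \<in> T \<and> s u = p. (G t u :: 'k) * H u v) = (if t = v then 1 else 0)"
    using std_retract_scalars[OF f g gf fin finite.emptyI[THEN finite.insertI] valid] p by auto
  then have "(\<Sum>u | u \<in> T \<and> s u = p. G () u * H u ()) = 1" by simp
  then show "p \<in> s ` T" by (metis (mono_tags, lifting) empty_Collect_eq imageI sum.empty zero_neq_one)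
next
  let ?N = "std n {()} (\<lambda>_. p) :: ('k mat, _) module" and ?M = "std n T s :: ('k mat, _) module"
  assume "p \<in> s ` T"
  then obtain t where t: "t \<in> T" "p = s t" by blast
  define f :: "(unit \<Rightarrow> nat \<Rightarrow> 'k) \<Rightarrow> _" where "f = (\<lambda>x u k. if u = t then x () k else 0)"
  define g where "g = (\<lambda>(x :: _ \<Rightarrow> nat \<Rightarrow> 'k) (u :: unit) k. x t k)"
  have "restrict f (carrier ?N) \<in> mod_hom (Lambda n) ?N ?M"
    by (rule mod_homI_restrict[OF left_module_std]) (use t in \<open>auto simp: f_def std_simps fun_eq_iff\<close>)
  moreover have "restrict g (carrier ?M) \<in> mod_hom (Lambda n) ?M ?N"
    by (rule mod_homI_restrict[OF left_module_std]) (use t in \<open>auto simp: g_def std_simps fun_eq_iff\<close>)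
  moreover have "f x \<in> carrier ?M \<and> g (f x) = x" if "x \<in> carrier ?N" for x
    using that t by (auto simp: f_def g_def std_simps fun_eq_iff)
  ultimately show "is_summand (Lambda n) ?N ?M"
    unfolding is_summand_iff_retract[OF left_module_std left_module_std]
    by (intro bexI[of _ "restrict f (carrier ?N)"] bexI[of _ "restrict g (carrier ?M)"]) auto
qed

text \<open>Two summands with one label would let the 2 by 2 identity matrix factor through the
  single summand of \<open>T\<close> with that label, hence have rank one. This is the part of
  Krull-Schmidt uniqueness by which two decompositions are compared.\<close>

lemma std_labels_distinct:
  assumes iso: "mod_iso (Lambda n) (std n T' s' :: ('k::field mat, _) module) (std n T s)"
    and fin: "finite T" "finite T'" and valid: "\<And>t. t \<in> T \<Longrightarrow> fst (s t) + snd (s t) < n"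
    and valid': "\<And>t. t \<in> T' \<Longrightarrow> fst (s' t) + snd (s' t) < n"
    and inj: "inj_on s T"
  shows "inj_on s' T'"
proof (rule inj_onI, rule ccontr)
  fix t v assume tv: "t \<in> T'" "v \<in> T'" "s' t = s' v" "t \<noteq> v"
  let ?N = "std n T' s' :: ('k mat, _) module" and ?M = "std n T s :: ('k mat, _) module"
  obtain f g where f: "f \<in> mod_hom (Lambda n) ?N ?M" and g: "g \<in> mod_hom (Lambda n) ?M ?N"
    and gf: "\<And>x. x \<in> carrier ?N \<Longrightarrow> g (f x) = x"
    by (rule mod_isoE[OF left_module_std iso]) blast
  obtain G H where GH: "\<And>t v. t \<in> T' \<Longrightarrow> v \<in> T' \<Longrightarrow> s' t = s' v \<Longrightarrow>
      (\<Sum>u | u \<in> T \<and> s u = s' t. (G t u :: 'k) * H u v) = (if t = v then 1 else 0)"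
    using std_retract_scalars[OF f g gf fin valid valid'] by auto
  have "{u. u \<in> T \<and> s u = s' t} \<noteq> {}"
  proof
    assume "{u. u \<in> T \<and> s u = s' t} = {}"
    with GH[OF tv(1) tv(1)] show False by simp
  qed
  then obtain u where "u \<in> T" "s u = s' t" by blast
  then have "{u. u \<in> T \<and> s u = s' t} = {u}" using inj by (auto simp: inj_on_def)
  then have "G t u * H u t = 1" "G v u * H u v = 1" "G t u * H u v = 0"
    using GH[OF tv(1) tv(1)] GH[OF tv(2) tv(2)] GH[OF tv(1) tv(2)] tv by auto
  then show False by auto
qed

section \<open>Faithfully balanced modules\<close>

text \<open>Membership in the double centraliser without extensionality, so that candidates can be
  given as total functions.\<close>

definition bicommuting :: "('a, 'c) ring_scheme \<Rightarrow> ('a, 'v) module \<Rightarrow> ('v \<Rightarrow> 'v) \<Rightarrow> bool" where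
  "bicommuting R M \<phi> \<longleftrightarrow> (\<forall>x\<in>carrier M. \<phi> x \<in> carrier M) \<and>
    (\<forall>x\<in>carrier M. \<forall>y\<in>carrier M. \<phi> (x \<oplus>\<^bsub>M\<^esub> y) = \<phi> x \<oplus>\<^bsub>M\<^esub> \<phi> y) \<and>
    (\<forall>\<alpha>\<in>mod_hom R M M. \<forall>x\<in>carrier M. \<phi> (\<alpha> x) = \<alpha> (\<phi> x))"

lemma faithfully_balanced_iff:
  assumes "left_module R M"
  shows "faithfully_balanced R M \<longleftrightarrow>
    (\<forall>a\<in>carrier R. \<forall>b\<in>carrier R. (\<forall>x\<in>carrier M. a \<odot>\<^bsub>M\<^esub> x = b \<odot>\<^bsub>M\<^esub> x) \<longrightarrow> a = b) \<and>
    (\<forall>\<phi>. bicommuting R M \<phi> \<longrightarrow> (\<exists>a\<in>carrier R. \<forall>x\<in>carrier M. \<phi> x = a \<odot>\<^bsub>M\<^esub> x))"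
    (is "_ \<longleftrightarrow> ?I \<and> ?S")
proof -
  interpret left_module R M by fact
  let ?D = "carrier (End_ring (End_ring R M) (eval_module M))"
  let ?n = "\<lambda>a. \<lambda>x\<in>carrier M. a \<odot>\<^bsub>M\<^esub> x"
  have D: "?D = {\<phi>. bicommuting R M \<phi> \<and> \<phi> \<in> extensional (carrier M)}"
    by (auto simp: End_ring_def mod_hom_def eval_module_def bicommuting_def PiE_def)
  have n: "?n a \<in> ?D" if "a \<in> carrier R" for a
    unfolding D bicommuting_def using that by (auto simp: smult_r_distr mod_homD)
  have "inj_on ?n (carrier R) \<longleftrightarrow> ?I"
  proof -
    have "?n a = ?n b \<longleftrightarrow> (\<forall>x\<in>carrier M. a \<odot>\<^bsub>M\<^esub> x = b \<odot>\<^bsub>M\<^esub> x)" for a b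
      by (metis (no_types, lifting) restrict_apply' restrict_ext)
    then show ?thesis by (simp add: inj_on_def)
  qed
  moreover have "?n ` carrier R = ?D \<longleftrightarrow> ?S"
  proof
    assume im: "?n ` carrier R = ?D"
    show ?S
    proof (intro allI impI)
      fix \<phi> assume \<phi>: "bicommuting R M \<phi>"
      then have "restrict \<phi> (carrier M) \<in> ?D"
        unfolding D bicommuting_def by (auto simp: mod_homD)
      then obtain a where "a \<in> carrier R" "restrict \<phi> (carrier M) = ?n a" using im by blast
      then show "\<exists>a\<in>carrier R. \<forall>x\<in>carrier M. \<phi> x = a \<odot>\<^bsub>M\<^esub> x"
        by (metis (no_types, lifting) restrict_apply')
    qed
  next
    assume ?S
    have "\<phi> \<in> ?n ` carrier R" if "\<phi> \<in> ?D" for \<phi>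
    proof -
      from that have "bicommuting R M \<phi>" and e: "\<phi> \<in> extensional (carrier M)" by (simp_all add: D)
      with \<open>?S\<close> obtain a where "a \<in> carrier R" "\<forall>x\<in>carrier M. \<phi> x = a \<odot>\<^bsub>M\<^esub> x" by blast
      with e have "\<phi> = ?n a" by (auto simp: extensional_def fun_eq_iff)
      then show ?thesis using \<open>a \<in> carrier R\<close> by blast
    qed
    then show "?n ` carrier R = ?D" using n by blast
  qed
  ultimately show ?thesis unfolding faithfully_balanced_def bij_betw_def by blast
qed

lemma faithfully_balanced_iso:
  assumes M: "left_module R M" and N: "left_module R N" and iso: "mod_iso R M N"
    and fb: "faithfully_balanced R M"
  shows "faithfully_balanced R N"
proof -
  interpret M: left_module R M by fact
  interpret N: left_module R N by fact
  obtain f g where f: "f \<in> mod_hom R M N" and g: "g \<in> mod_hom R N M"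
    and gf: "\<And>x. x \<in> carrier M \<Longrightarrow> g (f x) = x" and fg: "\<And>y. y \<in> carrier N \<Longrightarrow> f (g y) = y"
    by (rule mod_isoE[OF M iso]) blast
  note fD = mod_homD[OF f] and gD = mod_homD[OF g]
  show ?thesis unfolding faithfully_balanced_iff[OF N]
  proof (intro conjI ballI allI impI)
    fix a b assume a: "a \<in> carrier R" and b: "b \<in> carrier R"
      and eq: "\<forall>y\<in>carrier N. a \<odot>\<^bsub>N\<^esub> y = b \<odot>\<^bsub>N\<^esub> y"
    have "a \<odot>\<^bsub>M\<^esub> x = b \<odot>\<^bsub>M\<^esub> x" if x: "x \<in> carrier M" for x
    proof -
      have "f (a \<odot>\<^bsub>M\<^esub> x) = f (b \<odot>\<^bsub>M\<^esub> x)" using eq fD(1,4) a b x by simp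
      then show ?thesis using gf a b x by (metis M.smult_closed)
    qed
    then show "a = b" using fb a b unfolding faithfully_balanced_iff[OF M] by blast
  next
    fix \<phi> assume "bicommuting R N \<phi>"
    then have \<phi>: "\<And>y. y \<in> carrier N \<Longrightarrow> \<phi> y \<in> carrier N"
      "\<And>y z. y \<in> carrier N \<Longrightarrow> z \<in> carrier N \<Longrightarrow> \<phi> (y \<oplus>\<^bsub>N\<^esub> z) = \<phi> y \<oplus>\<^bsub>N\<^esub> \<phi> z"
      "\<And>\<alpha> y. \<alpha> \<in> mod_hom R N N \<Longrightarrow> y \<in> carrier N \<Longrightarrow> \<phi> (\<alpha> y) = \<alpha> (\<phi> y)"
      by (simp_all add: bicommuting_def)
    \<comment> \<open>Conjugation brings \<phi> to \<open>M\<close>. That it commutes with an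
      endomorphism \<alpha> of \<open>M\<close> is tested on \<open>N\<close> with the conjugate of
      \<alpha>.\<close>
    have "bicommuting R M (\<lambda>x. g (\<phi> (f x)))"
      unfolding bicommuting_def
    proof (intro conjI ballI)
      fix \<alpha> x assume \<alpha>: "\<alpha> \<in> mod_hom R M M" and x: "x \<in> carrier M"
      define \<beta> where "\<beta> = compose (carrier N) (compose (carrier M) f \<alpha>) g"
      have "\<beta> \<in> mod_hom R N N"
        unfolding \<beta>_def by (rule mod_hom_compose[OF N g mod_hom_compose[OF M \<alpha> f]])
      then have "\<phi> (\<beta> (f x)) = \<beta> (\<phi> (f x))" using \<phi>(3) fD(1) x by blast
      moreover have "\<beta> (f x) = f (\<alpha> x)" using x fD(1) gf by (simp add: \<beta>_def compose_def)
      moreover have "\<beta> (\<phi> (f x)) = f (\<alpha> (g (\<phi> (f x))))"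
        using x fD(1) gD(1) \<phi>(1) by (simp add: \<beta>_def compose_def)
      ultimately show "g (\<phi> (f (\<alpha> x))) = \<alpha> (g (\<phi> (f x)))"
        using x fD(1) gD(1) \<phi>(1) gf mod_homD(1)[OF \<alpha>] by simp
    qed (use \<phi> fD gD in auto)
    then obtain a where a: "a \<in> carrier R" "\<And>x. x \<in> carrier M \<Longrightarrow> g (\<phi> (f x)) = a \<odot>\<^bsub>M\<^esub> x"
      using fb unfolding faithfully_balanced_iff[OF M] by blast
    have "\<phi> y = a \<odot>\<^bsub>N\<^esub> y" if y: "y \<in> carrier N" for y
    proof -
      have "\<phi> y = f (g (\<phi> (f (g y))))" using fg y \<phi>(1) by simp
      also have "\<dots> = f (a \<odot>\<^bsub>M\<^esub> g y)" using a(2)[OF gD(1)[OF y]] by simp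
      also have "\<dots> = a \<odot>\<^bsub>N\<^esub> y" using a(1) y gD(1) fD(4) fg by simp
      finally show ?thesis .
    qed
    then show "\<exists>a\<in>carrier R. \<forall>y\<in>carrier N. \<phi> y = a \<odot>\<^bsub>N\<^esub> y" using a(1) by blast
  qed
qed

section \<open>Double centralisers of sums of distinct interval modules\<close>

definition fb_filling :: "nat \<Rightarrow> (nat \<times> nat) set \<Rightarrow> bool" where
  "fb_filling n P \<longleftrightarrow> (0, 0) \<in> P \<and>
    (\<forall>(r, c)\<in>P. (r, c) \<noteq> (0, 0) \<longrightarrow> (\<exists>r'<r. (r', c) \<in> P) \<or> (\<exists>c'<c. (r, c') \<in> P)) \<and>
    (\<forall>b. 0 < b \<and> b < n \<longrightarrow> (\<exists>c. (b, c) \<in> P) \<or> (\<exists>r. (r, n - b) \<in> P))"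

lemma fb_fillingD:
  assumes "fb_filling n P"
  shows "(0, 0) \<in> P"
    and "(r, c) \<in> P \<Longrightarrow> (r, c) \<noteq> (0, 0) \<Longrightarrow> (\<exists>r'<r. (r', c) \<in> P) \<or> (\<exists>c'<c. (r, c') \<in> P)"
    and "0 < b \<Longrightarrow> b < n \<Longrightarrow> (\<exists>c. (b, c) \<in> P) \<or> (\<exists>r. (r, n - b) \<in> P)"
proof -
  from assms have "(0, 0) \<in> P"
    and 2: "\<forall>(r, c)\<in>P. (r, c) \<noteq> (0, 0) \<longrightarrow> (\<exists>r'<r. (r', c) \<in> P) \<or> (\<exists>c'<c. (r, c') \<in> P)"
    and 3: "\<forall>b. 0 < b \<and> b < n \<longrightarrow> (\<exists>c. (b, c) \<in> P) \<or> (\<exists>r. (r, n - b) \<in> P)"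
    unfolding fb_filling_def by - (elim conjE, assumption)+
  show "(0, 0) \<in> P" by fact
  show "(r, c) \<in> P \<Longrightarrow> (r, c) \<noteq> (0, 0) \<Longrightarrow> (\<exists>r'<r. (r', c) \<in> P) \<or> (\<exists>c'<c. (r, c') \<in> P)"
    using bspec[OF 2, of "(r, c)"] by (simp only: prod.case simp_thms)
  show "0 < b \<Longrightarrow> b < n \<Longrightarrow> (\<exists>c. (b, c) \<in> P) \<or> (\<exists>r. (r, n - b) \<in> P)" using 3 by simp
qed

lemma finite_staircase: "finite (staircase n)"
  by (rule finite_subset[of _ "{..<n} \<times> {..<n}"]) (auto simp: staircase_eq)

lemma mod_endo_std:
  fixes \<alpha> :: "(nat \<times> nat \<Rightarrow> nat \<Rightarrow> 'k::field) \<Rightarrow> _"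
  assumes "P \<subseteq> staircase n" "\<alpha> \<in> mod_hom (Lambda n) (std n P (\<lambda>p. p)) (std n P (\<lambda>p. p))"
  obtains G where
    "\<forall>t\<in>P. \<forall>u\<in>P. G t u \<noteq> 0 \<longrightarrow> fst u \<le> fst t \<and> snd t \<le> snd u"
    "\<forall>x\<in>carrier (std n P (\<lambda>p. p)). \<forall>u\<in>P. \<forall>k\<in>supp n u. \<alpha> x u k = (\<Sum>t\<in>P. G t u * x t k)"
proof -
  have "finite P" using finite_subset[OF assms(1) finite_staircase] .
  moreover have "fst t + snd t < n" if "t \<in> P" for t using that assms(1) by (auto simp: staircase_eq)
  ultimately show thesis
    by (rule exE[OF mod_hom_std[OF assms(2)]]) (auto intro: that)
qed

lemma sum_eps:
  "l < n \<Longrightarrow> (\<Sum>j<n. a j * eps t l u j) = (if u = t then a l else (0 :: 'k::field))"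
proof -
  assume "l < n"
  have "(\<Sum>j<n. a j * eps t l u j) = (\<Sum>j<n. if j = l then if u = t then a l else 0 else 0)"
    by (intro sum.cong) (auto simp: eps_def)
  then show ?thesis using \<open>l < n\<close> by simp
qed

text \<open>Each condition is necessary, because a violation yields a function in the double centraliser
  that is not given by a matrix. If \<open>t\<close> has no pointed cell above or to its left, it maps the top of
  the summand at \<open>t\<close> to its socle and kills the other summands. If row \<open>b\<close> and column \<open>n - b\<close> are
  both empty, it is the matrix unit in row \<open>b - 1\<close> and column \<open>b\<close>, which is not lower triangular.\<close>

lemma fb_filling_necessary:
  assumes P: "P \<subseteq> staircase n" and n: "0 < n"
    and fb: "faithfully_balanced (Lambda n) (std n P (\<lambda>p. p) :: ('k::field mat, _) module)"
  shows "fb_filling n P"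
proof -
  let ?M = "std n P (\<lambda>p. p) :: ('k mat, _) module"
  have inj: "A = B" if "A \<in> carrier (Lambda n)" "B \<in> carrier (Lambda n)"
    "\<And>x. x \<in> carrier ?M \<Longrightarrow> A \<odot>\<^bsub>?M\<^esub> x = B \<odot>\<^bsub>?M\<^esub> x" for A B
    using fb that unfolding faithfully_balanced_iff[OF left_module_std] by blast
  have sur: "\<exists>A\<in>carrier (Lambda n). \<forall>x\<in>carrier ?M. \<phi> x = A \<odot>\<^bsub>?M\<^esub> x"
    if "bicommuting (Lambda n) ?M \<phi>" for \<phi>
    using fb that unfolding faithfully_balanced_iff[OF left_module_std] by blast
  have root: "(0, 0) \<in> P"
  proof (rule ccontr)
    assume no: "(0, 0) \<notin> P"
    \<comment> \<open>A summand on which this matrix unit acts nontrivially contains the vertices 0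
      and \<open>n - 1\<close>, so it is the origin. Without the origin the matrix unit would act
      like the zero matrix.\<close>
    have "mu n (n - 1) 0 1 \<odot>\<^bsub>?M\<^esub> x = mu n (n - 1) 0 0 \<odot>\<^bsub>?M\<^esub> x" if x: "x \<in> carrier ?M" for x
    proof -
      have "x t 0 = 0" if "t \<in> P" "n - 1 \<in> supp n t" for t
      proof (rule std_out[OF x], rule notI)
        assume "t \<in> P \<and> 0 \<in> supp n t"
        then have "t = (0, 0)" using that(2) by (cases t) (auto simp: supp_def)
        then show False using no that(1) by simp
      qed
      then show ?thesis unfolding mu_smult_std[OF n] by (auto simp: fun_eq_iff)
    qed
    then have "mu n (n - 1) 0 (1 :: 'k) = mu n (n - 1) 0 0" by (intro inj mu_Lambda) auto
    then have "mu n (n - 1) 0 (1 :: 'k) $$ (n - 1, 0) = mu n (n - 1) 0 0 $$ (n - 1, 0)" by simp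
    then show False using n by (simp add: mu_def)
  qed
  have "(\<exists>r'<r. (r', c) \<in> P) \<or> (\<exists>c'<c. (r, c') \<in> P)" if t: "(r, c) \<in> P" "(r, c) \<noteq> (0, 0)" for r c
  proof (rule ccontr)
    assume no: "\<not> ?thesis"
    have rc: "r + c < n" using t P by (auto simp: staircase_eq)
    \<comment> \<open>Coordinate \<open>r\<close> of the summand \<open>(r, c)\<close> spans its top
      and coordinate \<open>e\<close> its socle.\<close>
    define e where "e = n - 1 - c"
    have e: "r \<le> e" "e < n" "e + c < n" "r < n" "n \<le> Suc (e + c)" using rc by (auto simp: e_def)
    define \<phi> where "\<phi> = (\<lambda>(x :: nat \<times> nat \<Rightarrow> nat \<Rightarrow> 'k) u k. if u = (r, c) \<and> k = e then x (r, c) r else 0)"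
    have \<phi>c: "\<phi> x \<in> carrier ?M" for x using t e by (auto simp: \<phi>_def std_simps supp_def)
    have "bicommuting (Lambda n) ?M \<phi>"
      unfolding bicommuting_def
    proof (intro conjI ballI ext)
      fix \<alpha> x u k assume \<alpha>: "\<alpha> \<in> mod_hom (Lambda n) ?M ?M" and x: "x \<in> carrier ?M"
      obtain G where "\<forall>t\<in>P. \<forall>u\<in>P. G t u \<noteq> 0 \<longrightarrow> fst u \<le> fst t \<and> snd t \<le> snd u"
        "\<forall>x\<in>carrier ?M. \<forall>u\<in>P. \<forall>k\<in>supp n u. \<alpha> x u k = (\<Sum>t\<in>P. G t u * x t k)"
        using mod_endo_std[OF P \<alpha>] .
      note G = this[rule_format]
      have fin: "finite P" using finite_subset[OF P finite_staircase] .
      have r: "r \<in> supp n (r, c)" using rc by (simp add: supp_def)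
      \<comment> \<open>A contribution to the top coordinate from another summand \<open>s\<close>
        requires that \<open>s\<close> contains \<open>r\<close> and maps to \<open>(r, c)\<close>.
        Then \<open>s\<close> lies in row \<open>r\<close> to the left, where no cell is
        pointed.\<close>
      have "\<alpha> x (r, c) r = (\<Sum>t\<in>P. if t = (r, c) then G (r, c) (r, c) * x (r, c) r else 0)"
        unfolding G(2)[OF x t(1) r]
      proof (rule sum.cong[OF refl])
        fix s assume s: "s \<in> P"
        show "G s (r, c) * x s r = (if s = (r, c) then G (r, c) (r, c) * x (r, c) r else 0)"
        proof (rule ccontr)
          assume neq: "\<not> ?thesis"
          then have "s \<noteq> (r, c)" "G s (r, c) \<noteq> 0" "x s r \<noteq> 0" by (auto split: if_splits)
          then have "r \<in> supp n s" using std_out[OF x, of s r] by auto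
          then have "fst s = r" "snd s \<le> c" using G(1)[OF s t(1) \<open>G s (r, c) \<noteq> 0\<close>] by (auto simp: supp_def)
          then show False using no s \<open>s \<noteq> (r, c)\<close> by (cases s) (auto simp: order.order_iff_strict)
        qed
      qed
      then have 1: "\<alpha> x (r, c) r = G (r, c) (r, c) * x (r, c) r" using fin t(1) by simp
      have "\<alpha> (\<phi> x) u k = (if u = (r, c) \<and> k = e then G (r, c) (r, c) * x (r, c) r else 0)"
      proof (cases "u \<in> P \<and> k \<in> supp n u")
        case False
        have "e \<in> supp n (r, c)" using e by (simp add: supp_def)
        then show ?thesis using std_out[OF mod_homD(1)[OF \<alpha> \<phi>c] False] t(1) False by auto
      next
        case True
        then have "\<alpha> (\<phi> x) u k = (\<Sum>s\<in>P. G s u * \<phi> x s k)" using G(2)[OF \<phi>c] by blast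
        also have "\<dots> = (\<Sum>s\<in>P. if s = (r, c) then if k = e then G (r, c) u * x (r, c) r else 0 else 0)"
          by (intro sum.cong) (auto simp: \<phi>_def)
        also have "\<dots> = (if k = e then G (r, c) u * x (r, c) r else 0)" using fin t(1) by simp
        \<comment> \<open>Dually, a summand \<open>u\<close> other than \<open>(r, c)\<close> that
          receives the socle of \<open>(r, c)\<close> under a nonzero map lies in column
          \<open>c\<close> above it, where no cell is pointed.\<close>
        also have "\<dots> = (if u = (r, c) \<and> k = e then G (r, c) (r, c) * x (r, c) r else 0)"
        proof (rule ccontr)
          assume "\<not> ?thesis"
          then have k: "k = e" and u: "u \<noteq> (r, c)" and "G (r, c) u \<noteq> 0" by (auto split: if_splits)
          with True have "fst u \<le> r" "c \<le> snd u" using G(1)[OF t(1), of u] by auto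
          moreover from True k e have "snd u \<le> c" by (auto simp: supp_def)
          ultimately show False using no True u by (cases u) (auto simp: order.order_iff_strict)
        qed
        finally show ?thesis .
      qed
      then show "\<phi> (\<alpha> x) u k = \<alpha> (\<phi> x) u k" using 1 by (simp add: \<phi>_def)
    qed (use \<phi>c in \<open>auto simp: \<phi>_def std_simps\<close>)
    then obtain A where A: "\<And>x. x \<in> carrier ?M \<Longrightarrow> \<phi> x = A \<odot>\<^bsub>?M\<^esub> x" using sur by blast
    \<comment> \<open>One matrix entry is read off twice. At the origin \<phi> is zero, which makes
      the entry 0, while the summand \<open>(r, c)\<close> makes it 1.\<close>
    have "\<phi> (eps (0, 0) r) (0, 0) e = (A \<odot>\<^bsub>?M\<^esub> eps (0, 0) r) (0, 0) e"
      using e by (intro fun_cong[OF fun_cong[OF A]] eps_carrier root) (simp add: supp_def)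
    then have "A $$ (e, r) = 0" using e t(2) root by (simp add: \<phi>_def std_simps(4) supp_def sum_eps) (auto split: if_splits)
    moreover have "\<phi> (eps (r, c) r) (r, c) e = (A \<odot>\<^bsub>?M\<^esub> eps (r, c) r) (r, c) e"
      using rc t by (intro fun_cong[OF fun_cong[OF A]] eps_carrier) (simp_all add: supp_def)
    then have "A $$ (e, r) = 1" using e t by (simp add: \<phi>_def std_simps(4) supp_def sum_eps) (simp add: eps_def)
    ultimately show False by simp
  qed
  moreover have "(\<exists>c. (b, c) \<in> P) \<or> (\<exists>r. (r, n - b) \<in> P)" if b: "0 < b" "b < n" for b
  proof (rule ccontr)
    assume no: "\<not> ?thesis"
    \<comment> \<open>No support begins at vertex \<open>b\<close> or ends at \<open>b - 1\<close>,
      so no support separates these two vertices. This is why \<phi> preserves the carrier.\<close>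
    have iff: "b - 1 \<in> supp n u \<longleftrightarrow> b \<in> supp n u" if "u \<in> P" for u
    proof -
      obtain r c where u: "u = (r, c)" by force
      have "r \<noteq> b" "c \<noteq> n - b" using no that u by auto
      then show ?thesis using b unfolding u supp_def by auto
    qed
    define \<phi> where "\<phi> = (\<lambda>(x :: nat \<times> nat \<Rightarrow> nat \<Rightarrow> 'k) u k. if k = b - 1 then x u b else 0)"
    have \<phi>c: "\<phi> x \<in> carrier ?M" if "x \<in> carrier ?M" for x
      using iff std_out[OF that] by (auto simp: \<phi>_def std_simps(1))
    have "bicommuting (Lambda n) ?M \<phi>"
      unfolding bicommuting_def
    proof (intro conjI ballI ext)
      fix \<alpha> x u k assume \<alpha>: "\<alpha> \<in> mod_hom (Lambda n) ?M ?M" and x: "x \<in> carrier ?M"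
      obtain G where "\<forall>t\<in>P. \<forall>u\<in>P. G t u \<noteq> 0 \<longrightarrow> fst u \<le> fst t \<and> snd t \<le> snd u"
        "\<forall>x\<in>carrier ?M. \<forall>u\<in>P. \<forall>k\<in>supp n u. \<alpha> x u k = (\<Sum>t\<in>P. G t u * x t k)"
        using mod_endo_std[OF P \<alpha>] .
      note G = this[rule_format]
      show "\<phi> (\<alpha> x) u k = \<alpha> (\<phi> x) u k"
      proof (cases "u \<in> P \<and> k \<in> supp n u")
        case False
        then show ?thesis
          using std_out[OF \<phi>c[OF mod_homD(1)[OF \<alpha> x]]] std_out[OF mod_homD(1)[OF \<alpha> \<phi>c[OF x]]] by simp
      next
        case True
        then have *: "\<alpha> (\<phi> x) u k = (\<Sum>s\<in>P. G s u * \<phi> x s k)" using G(2)[OF \<phi>c[OF x]] by blast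
        show ?thesis
        proof (cases "k = b - 1")
          case True
          with \<open>u \<in> P \<and> k \<in> supp n u\<close> iff have "\<alpha> x u b = (\<Sum>s\<in>P. G s u * x s b)" using G(2)[OF x] by blast
          then show ?thesis using * True by (simp add: \<phi>_def)
        next
          case False
          then show ?thesis using * by (simp add: \<phi>_def)
        qed
      qed
    qed (use \<phi>c in \<open>auto simp: \<phi>_def std_simps\<close>)
    then obtain A where A: "A \<in> carrier (Lambda n)" "\<And>x. x \<in> carrier ?M \<Longrightarrow> \<phi> x = A \<odot>\<^bsub>?M\<^esub> x"
      using sur by blast
    have "\<phi> (eps (0, 0) b) (0, 0) (b - 1) = (A \<odot>\<^bsub>?M\<^esub> eps (0, 0) b) (0, 0) (b - 1)"
      using b by (intro fun_cong[OF fun_cong[OF A(2)]] eps_carrier root) (simp add: supp_def)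
    then have "A $$ (b - 1, b) = 1" using b root
      by (simp add: \<phi>_def std_simps(4) supp_def sum_eps less_imp_diff_less) (simp add: eps_def)
    moreover have "A $$ (b - 1, b) = 0" using A(1) b by (simp add: Lambda_simps)
    ultimately show False by simp
  qed
  ultimately show ?thesis using root by (auto simp: fb_filling_def)
qed

text \<open>The origin sees every entry of a matrix, which gives injectivity. For surjectivity, the
  endomorphisms that copy coordinates between summands turn \<phi> into one matrix per summand and
  force these matrices to be blocks of the one at the origin. Embeddings and quotients between
  summands make further blocks of that matrix vanish, and the third condition supplies enough of
  them for lower triangularity.\<close>

lemma fb_filling_sufficient:
  assumes P: "P \<subseteq> staircase n" and fb: "fb_filling n P"
  shows "faithfully_balanced (Lambda n) (std n P (\<lambda>p. p) :: ('k::field mat, _) module)"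
proof -
  let ?M = "std n P (\<lambda>p. p) :: ('k mat, _) module"
  note root = fb_fillingD(1)[OF fb]
  show ?thesis
    unfolding faithfully_balanced_iff[OF left_module_std]
  proof (intro conjI ballI allI impI)
    fix A B :: "'k mat" assume A: "A \<in> carrier (Lambda n)" and B: "B \<in> carrier (Lambda n)"
      and eq: "\<forall>x\<in>carrier ?M. A \<odot>\<^bsub>?M\<^esub> x = B \<odot>\<^bsub>?M\<^esub> x"
    show "A = B"
    proof (rule eq_matI)
      fix k l assume "k < dim_row B" "l < dim_col B"
      then have kl: "k < n" "l < n" using B by (auto simp: Lambda_simps)
      then have "eps (0, 0) l \<in> carrier ?M" using root by (intro eps_carrier) (auto simp: supp_def)
      then have "(A \<odot>\<^bsub>?M\<^esub> eps (0, 0) l) (0, 0) k = (B \<odot>\<^bsub>?M\<^esub> eps (0, 0) l) (0, 0) k" using eq by simp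
      then show "A $$ (k, l) = B $$ (k, l)"
        using kl root by (simp add: std_simps(4) supp_def sum_eps)
    qed (use A B in \<open>auto simp: Lambda_simps\<close>)
  next
    fix \<phi> assume "bicommuting (Lambda n) ?M \<phi>"
    then have \<phi>: "\<And>y. y \<in> carrier ?M \<Longrightarrow> \<phi> y \<in> carrier ?M"
      "\<And>y z. y \<in> carrier ?M \<Longrightarrow> z \<in> carrier ?M \<Longrightarrow> \<phi> (\<lambda>t k. y t k + z t k) = (\<lambda>t k. \<phi> y t k + \<phi> z t k)"
      "\<And>\<alpha> y. \<alpha> \<in> mod_hom (Lambda n) ?M ?M \<Longrightarrow> y \<in> carrier ?M \<Longrightarrow> \<phi> (\<alpha> y) = \<alpha> (\<phi> y)"
      by (simp_all add: bicommuting_def std_simps(3))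
    have zc: "(\<lambda>_ _. 0) \<in> carrier ?M" by (simp add: std_simps)
    have \<phi>0: "\<phi> (\<lambda>_ _. 0) = (\<lambda>_ _. 0)"
    proof (intro ext)
      fix t k
      have "\<phi> (\<lambda>_ _. 0) t k + \<phi> (\<lambda>_ _. 0) t k = \<phi> (\<lambda>_ _. 0) t k"
        using fun_cong[OF fun_cong[OF \<phi>(2)[OF zc zc]], of t k] by (simp only: add_0)
      then show "\<phi> (\<lambda>_ _. 0) t k = 0" by (metis add_cancel_right_right)
    qed
    \<comment> \<open>Copies coordinates from \<open>t\<close> to \<open>u\<close> and scales them.
      With \<open>t = u\<close> and \<open>a = 1\<close> this is the projection onto a summand;
      other values of \<open>a\<close> yield linearity of \<phi> over the field, where the
      definition gives only additivity.\<close>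
    define h where "h t u a = (\<lambda>(x :: nat \<times> nat \<Rightarrow> nat \<Rightarrow> 'k) v k. if v = u \<and> k \<in> supp n u then a * x t k else 0)"
      for t u :: "nat \<times> nat" and a
    have h\<phi>: "\<phi> (h t u a x) = h t u a (\<phi> x)"
      if tu: "t \<in> P" "u \<in> P" "fst u \<le> fst t" "snd t \<le> snd u" and x: "x \<in> carrier ?M" for t u a x
    proof -
      have "restrict (h t u a) (carrier ?M) \<in> mod_hom (Lambda n) ?M ?M"
      proof (rule mod_homI_restrict[OF left_module_std])
        fix A :: "'k mat" and x assume A: "A \<in> carrier (Lambda n)" and x: "x \<in> carrier ?M"
        have "a * (if k \<in> supp n t then \<Sum>l<n. A $$ (k, l) * x t l else 0) =
            (\<Sum>l<n. A $$ (k, l) * (if l \<in> supp n u then a * x t l else 0))" if k: "k \<in> supp n u" for k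
        proof -
          have "A $$ (k, l) * (if l \<in> supp n u then a * x t l else 0) =
              (if k \<in> supp n t then a * (A $$ (k, l) * x t l) else 0)" if l: "l < n" for l
          \<comment> \<open>A term survives only if \<open>l\<close> \<le> \<open>k\<close> and
            \<open>l\<close> is in the support of \<open>t\<close>. As \<open>u\<close> starts no
            later and ends no later than \<open>t\<close>, both supports then contain both
            \<open>l\<close> and \<open>k\<close>.\<close>
          proof (cases "l \<le> k \<and> l \<in> supp n t")
            case False
            then have "A $$ (k, l) = 0 \<or> x t l = 0"
              using A l supp_less[OF k] std_out[OF x, of t l] by (auto simp: Lambda_simps)
            then show ?thesis by auto
          next
            case True
            then have "k \<in> supp n t" "l \<in> supp n u" using tu k by (auto simp: supp_def)
            then show ?thesis by simp
          qed
          then show ?thesis by (auto simp: sum_distrib_left intro!: sum.cong)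
        qed
        note eq = this
        show "h t u a (A \<odot>\<^bsub>?M\<^esub> x) = A \<odot>\<^bsub>?M\<^esub> h t u a x"
        proof (intro ext)
          fix v k
          show "h t u a (A \<odot>\<^bsub>?M\<^esub> x) v k = (A \<odot>\<^bsub>?M\<^esub> h t u a x) v k"
          proof (cases "v = u")
            case True
            then show ?thesis using tu eq[of k] by (auto simp: h_def std_simps(4))
          qed (auto simp: h_def std_simps(4))
        qed
      qed (use tu in \<open>auto simp: h_def std_simps fun_eq_iff algebra_simps\<close>)
      from \<phi>(3)[OF this x] show ?thesis using x \<phi>(1)[OF x] by simp
    qed
    define \<Phi> where "\<Phi> t k l = \<phi> (eps t l) t k" for t k l
    have \<phi>sum: "\<phi> (\<lambda>t k. \<Sum>i\<in>I. z i t k) = (\<lambda>t k. \<Sum>i\<in>I. \<phi> (z i) t k)"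
      if "finite I" "\<And>i. i \<in> I \<Longrightarrow> z i \<in> carrier ?M" for I and z :: "nat \<Rightarrow> _"
      using that
    proof (induction I rule: finite_induct)
      case empty then show ?case using \<phi>0 by simp
    next
      case (insert i I)
      have "(\<lambda>t k. \<Sum>i\<in>I. z i t k) \<in> carrier ?M"
        using insert.prems std_out by (auto simp: std_simps(1) intro!: sum.neutral)
      then show ?case using insert by (simp add: \<phi>(2))
    qed
    have \<phi>eq: "\<phi> x t k = (\<Sum>l\<in>supp n t. \<Phi> t k l * x t l)"
      if x: "x \<in> carrier ?M" and t: "t \<in> P" and k: "k \<in> supp n t" for x t k
    proof -
      have fin: "finite (supp n t)" by (rule finite_subset[of _ "{..<n}"]) (auto simp: supp_def)
      have e: "eps t l \<in> carrier ?M" if "l \<in> supp n t" for l using t that by (intro eps_carrier) auto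
      have hc: "h t t (x t l) (eps t l) \<in> carrier ?M" for l
        using t by (auto simp: h_def std_simps)
      have "h t t 1 x = (\<lambda>v i. \<Sum>l\<in>supp n t. h t t (x t l) (eps t l) v i)"
      proof (intro ext)
        fix v i
        have "(\<Sum>l\<in>supp n t. h t t (x t l) (eps t l) v i) =
            (\<Sum>l\<in>supp n t. if l = i then if v = t then x t i else 0 else 0)"
          by (intro sum.cong) (auto simp: h_def eps_def)
        then show "h t t 1 x v i = (\<Sum>l\<in>supp n t. h t t (x t l) (eps t l) v i)"
          using fin by (simp add: h_def)
      qed
      then have "\<phi> (h t t 1 x) = (\<lambda>v i. \<Sum>l\<in>supp n t. \<phi> (h t t (x t l) (eps t l)) v i)"
        using \<phi>sum[OF fin hc] by simp
      then have "h t t 1 (\<phi> x) t k = (\<Sum>l\<in>supp n t. h t t (x t l) (\<phi> (eps t l)) t k)"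
        using h\<phi>[OF t t order.refl order.refl] x e by simp
      then show ?thesis using k by (simp add: h_def \<Phi>_def mult.commute)
    qed
    \<comment> \<open>Commutation with the copying map from \<open>t\<close> to \<open>u\<close>,
      evaluated at a coordinate vector. Besides agreement on common entries it yields zeros where
      one index lies in one support only.\<close>
    have rel: "(if l \<in> supp n u then \<Phi> u k l else 0) = (if k \<in> supp n t then \<Phi> t k l else 0)"
      if tu: "t \<in> P" "u \<in> P" "fst u \<le> fst t" "snd t \<le> snd u" and l: "l \<in> supp n t" and k: "k \<in> supp n u" for t u k l
    proof -
      have e: "eps t l \<in> carrier ?M" using tu l by (intro eps_carrier) auto
      have "h t u 1 (eps t l) = (if l \<in> supp n u then eps u l else (\<lambda>_ _. 0))"
        by (auto simp: h_def eps_def fun_eq_iff)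
      then have "\<phi> (h t u 1 (eps t l)) u k = (if l \<in> supp n u then \<Phi> u k l else 0)"
        by (simp add: \<Phi>_def \<phi>0)
      moreover have "h t u 1 (\<phi> (eps t l)) u k = (if k \<in> supp n t then \<Phi> t k l else 0)"
        using k std_out[OF \<phi>(1)[OF e], of t k] by (simp add: h_def \<Phi>_def)
      ultimately show ?thesis using h\<phi>[OF tu e, of 1] by simp
    qed
    \<comment> \<open>Under \<open>Z b\<close> the matrix at the origin preserves the span of the
      coordinates from \<open>b\<close> on, and it is lower triangular if this holds for all
      \<open>b\<close>. At \<open>b = 0\<close> and \<open>b = n\<close> the condition is empty,
      which starts the induction below.\<close>
    define Z where "Z b \<longleftrightarrow> (\<forall>k l. k < b \<longrightarrow> b \<le> l \<longrightarrow> l < n \<longrightarrow> \<Phi> (0, 0) k l = 0)" for b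
    have main: "(\<forall>k\<in>supp n (r, c). \<forall>l\<in>supp n (r, c). \<Phi> (r, c) k l = \<Phi> (0, 0) k l) \<and> Z r \<and> Z (n - c)"
      if "(r, c) \<in> P" for r c
      using that
    proof (induction "r + c" arbitrary: r c rule: less_induct)
      case (less r c)
      have rc: "r + c < n" using less.prems P by (auto simp: staircase_eq)
      from fb_fillingD(2)[OF fb less.prems]
      consider "r = 0" "c = 0" | r' where "r' < r" "(r', c) \<in> P" | c' where "c' < c" "(r, c') \<in> P"
        by auto
      then show ?case
      proof cases
        case 1 then show ?thesis by (simp add: Z_def)
      next
        case (2 r')
        have "r' + c < r + c" using 2(1) by simp
        note IH = less.hyps[OF this 2(2)]
        have R: "\<Phi> (r', c) k l = (if k \<in> supp n (r, c) then \<Phi> (r, c) k l else 0)"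
          if "l \<in> supp n (r, c)" "k \<in> supp n (r', c)" for k l
          using rel[OF less.prems 2(2) _ _ that] 2(1) that by (auto simp: supp_def)
        have sub: "k \<in> supp n (r', c)" if "k \<in> supp n (r, c)" for k using that 2(1) by (auto simp: supp_def)
        have "\<Phi> (0, 0) k l = 0" if "k < r" "r \<le> l" "l < n" for k l
        proof -
          \<comment> \<open>The block for \<open>r\<close> is covered by the known blocks for
            \<open>r'\<close> and \<open>n - c\<close> and by a rectangle inside the support of
            \<open>(r', c)\<close>. The rectangle vanishes because \<phi> preserves the submodule
            that is the image of \<open>(r, c)\<close>.\<close>
          consider "k < r'" | "n - c \<le> l" | "r' \<le> k" "l < n - c" by linarith
          then show ?thesis
          proof cases
            case 1 then show ?thesis using IH that 2(1) unfolding Z_def by auto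
          next
            case 2 then show ?thesis using IH that \<open>r' < r\<close> rc unfolding Z_def by auto
          next
            case 3
            then have "k \<in> supp n (r', c)" "l \<in> supp n (r, c)" "k \<notin> supp n (r, c)"
              using that rc by (auto simp: supp_def)
            moreover have "l \<in> supp n (r', c)" using sub calculation(2) .
            ultimately show ?thesis using R[of l k] IH by simp
          qed
        qed
        then show ?thesis using IH R sub by (simp add: Z_def)
      next
        case (3 c')
        have "r + c' < r + c" using 3(1) by simp
        note IH = less.hyps[OF this 3(2)]
        have R: "(if l \<in> supp n (r, c) then \<Phi> (r, c) k l else 0) = \<Phi> (r, c') k l"
          if "l \<in> supp n (r, c')" "k \<in> supp n (r, c)" for k l
          using rel[OF 3(2) less.prems _ _ that] 3(1) that by (auto simp: supp_def)
        have sub: "k \<in> supp n (r, c')" if "k \<in> supp n (r, c)" for k using that 3(1) by (auto simp: supp_def)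
        have "\<Phi> (0, 0) k l = 0" if "k < n - c" "n - c \<le> l" "l < n" for k l
        proof -
          \<comment> \<open>In the quotient case the kernel of the map from \<open>(r, c')\<close>
            to \<open>(r, c)\<close> is preserved, which fills in the rest of the block for
            \<open>n - c\<close>.\<close>
          consider "k < r" | "n - c' \<le> l" | "r \<le> k" "l < n - c'" by linarith
          then show ?thesis
          proof cases
            case 1 then show ?thesis using IH that 3(1) rc unfolding Z_def by auto
          next
            case 2 then show ?thesis using IH that 3(1) unfolding Z_def by auto
          next
            case 4: 3
            then have "k \<in> supp n (r, c)" "l \<in> supp n (r, c')" "l \<notin> supp n (r, c)"
              using that rc by (auto simp: supp_def)
            moreover have "k \<in> supp n (r, c')" using sub calculation(1) .
            ultimately show ?thesis using R[of l k] IH by simp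
          qed
        qed
        then show ?thesis using IH R[symmetric] sub by (simp add: Z_def)
      qed
    qed
    have Z: "Z b" if "0 < b" "b < n" for b
    proof -
      consider c where "(b, c) \<in> P" | r where "(r, n - b) \<in> P"
        using fb_fillingD(3)[OF fb \<open>0 < b\<close> \<open>b < n\<close>] by blast
      then show ?thesis
      proof cases
        case 1 then show ?thesis using main by blast
      next
        case 2
        then have "Z (n - (n - b))" using main by blast
        then show ?thesis using that by simp
      qed
    qed
    define A where "A = mat n n (\<lambda>(k, l). \<Phi> (0, 0) k l)"
    show "\<exists>A\<in>carrier (Lambda n). \<forall>x\<in>carrier ?M. \<phi> x = A \<odot>\<^bsub>?M\<^esub> x"
    proof (intro bexI[of _ A] ballI ext)
      show "A \<in> carrier (Lambda n)"
        using Z[unfolded Z_def, rule_format] by (simp add: A_def Lambda_simps)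
      fix x t k assume x: "x \<in> carrier ?M"
      show "\<phi> x t k = (A \<odot>\<^bsub>?M\<^esub> x) t k"
      proof (cases "t \<in> P \<and> k \<in> supp n t")
        case False
        then show ?thesis using std_out[OF \<phi>(1)[OF x] False] by (auto simp: std_simps(4))
      next
        case True
        have "\<phi> x t k = (\<Sum>l\<in>supp n t. \<Phi> t k l * x t l)" using \<phi>eq[OF x] True by blast
        also have "\<dots> = (\<Sum>l\<in>supp n t. A $$ (k, l) * x t l)"
        proof (rule sum.cong[OF refl])
          fix l assume l: "l \<in> supp n t"
          have "\<Phi> t k l = \<Phi> (0, 0) k l" using main[of "fst t" "snd t", unfolded prod.collapse] True l by blast
          then show "\<Phi> t k l * x t l = A $$ (k, l) * x t l"
            using supp_less[OF l] True supp_less[of k n t] by (simp add: A_def)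
        qed
        also have "\<dots> = (\<Sum>l<n. A $$ (k, l) * x t l)"
          using std_out[OF x] by (intro sum.mono_neutral_left) (auto dest: supp_less)
        finally show ?thesis using True by (simp add: std_simps(4))
      qed
    qed
  qed
qed

section \<open>Indecomposable modules\<close>

lemma set_addI: "x = a \<oplus>\<^bsub>G\<^esub> b \<Longrightarrow> a \<in> A \<Longrightarrow> b \<in> B \<Longrightarrow> x \<in> A <+>\<^bsub>G\<^esub> B"
  unfolding set_add_def' by blast

lemma set_addE:
  assumes "x \<in> A <+>\<^bsub>G\<^esub> B"
  obtains a b where "a \<in> A" "b \<in> B" "x = a \<oplus>\<^bsub>G\<^esub> b"
  using assms unfolding set_add_def' by blast

section \<open>Matrix units and complements in an arbitrary module\<close>

locale Lambda_module = left_module "Lambda n" M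
  for n :: nat and M :: "('k::field mat, 'v) module" (structure)
begin

lemma index_mu: "i < n \<Longrightarrow> j < n \<Longrightarrow> mu n k l a $$ (i, j) = (if i = k \<and> j = l then a else 0)"
  by (simp add: mu_def)

lemma mu_mult:
  assumes "l < n"
  shows "mu n k l a * mu n l m b = (mu n k m (a * b) :: 'k mat)"
proof (rule eq_matI)
  fix i j assume "i < dim_row (mu n k m (a * b) :: 'k mat)" "j < dim_col (mu n k m (a * b) :: 'k mat)"
  then have ij: "i < n" "j < n" by (simp_all add: mu_def)
  have "(mu n k l a * mu n l m b) $$ (i, j) =
      (\<Sum>t = 0..<n. (if i = k \<and> t = l then a else 0) * (if t = l \<and> j = m then b else 0))"
    using ij by (simp add: mu_def scalar_prod_def)
  also have "\<dots> = (\<Sum>t = 0..<n. if t = l then if i = k \<and> j = m then a * b else 0 else 0)"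
    by (intro sum.cong) auto
  finally show "(mu n k l a * mu n l m b) $$ (i, j) = mu n k m (a * b) $$ (i, j)"
    using ij assms by (simp add: mu_def)
qed (simp_all add: mu_def)

lemma mu_mu:
  assumes "x \<in> carrier M" "l < n" "l \<le> k" "m \<le> l"
  shows "mu n k l a \<odot> (mu n l m b \<odot> x) = mu n k m (a * b) \<odot> x"
  using smult_assoc1[OF mu_Lambda[of l k a] mu_Lambda[of m l b] assms(1)] assms
  by (simp add: Lambda_simps(2) mu_mult)

lemma mu_add:
  assumes "x \<in> carrier M" "l \<le> k"
  shows "mu n k l a \<odot> x \<oplus> mu n k l b \<odot> x = mu n k l (a + b) \<odot> x"
proof -
  have "mu n k l a + mu n k l b = (mu n k l (a + b) :: 'k mat)"
    by (rule eq_matI) (auto simp: mu_def)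
  then show ?thesis
    using smult_l_distr[OF mu_Lambda[of l k a] mu_Lambda[of l k b] assms(1)] assms
    by (simp add: Lambda_simps(5))
qed

lemma mu_zero: "mu n k l 0 = \<zero>\<^bsub>Lambda n\<^esub>"
  by (rule eq_matI) (auto simp: mu_def Lambda_simps)

text \<open>The diagonal matrix units add up to the identity; \<open>D m\<close> is the sum of the
  first \<open>m\<close> of them.\<close>

lemma mem_submodule_components:
  assumes S: "submodule S (Lambda n) M" and x: "x \<in> carrier M"
    and c: "\<And>k. k < n \<Longrightarrow> mu n k k 1 \<odot> x \<in> S"
  shows "x \<in> S"
proof -
  define D where "D m = (mat n n (\<lambda>(i, j). if i = j \<and> i < m then 1 else 0) :: 'k mat)" for m
  have D: "D m \<in> carrier (Lambda n)" for m by (auto simp: D_def Lambda_simps)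
  have "D m \<odot> x \<in> S" if "m \<le> n" for m
    using that
  proof (induction m)
    case 0
    have "D 0 = \<zero>\<^bsub>Lambda n\<^esub>" by (rule eq_matI) (auto simp: D_def Lambda_simps)
    then show ?case using x submodule_closed(2)[OF S] by simp
  next
    case (Suc m)
    have "D (Suc m) = D m \<oplus>\<^bsub>Lambda n\<^esub> mu n m m 1"
      by (rule eq_matI) (auto simp: D_def mu_def Lambda_simps)
    then have "D (Suc m) \<odot> x = D m \<odot> x \<oplus> mu n m m 1 \<odot> x"
      using smult_l_distr[OF D mu_Lambda x] by simp
    then show ?case using Suc c submodule_closed(3)[OF S] by simp
  qed
  from this[of n] have "D n \<odot> x \<in> S" by simp
  moreover have "D n = \<one>\<^bsub>Lambda n\<^esub>" by (rule eq_matI) (auto simp: D_def Lambda_simps)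
  ultimately show ?thesis using x by simp
qed

lemma submodule_sum:
  assumes A: "submodule A (Lambda n) M" and B: "submodule B (Lambda n) M"
  shows "submodule (A <+>\<^bsub>M\<^esub> B) (Lambda n) M"
proof -
  note cA = submodule_closed[OF A] and cB = submodule_closed[OF B]
  show ?thesis
  proof (rule submodule_left_moduleI)
    show "A <+>\<^bsub>M\<^esub> B \<subseteq> carrier M" using cA cB by (auto simp: set_add_def')
    have "\<zero> = \<zero> \<oplus> \<zero>" by simp
    then show "\<zero> \<in> A <+>\<^bsub>M\<^esub> B" using cA(2) cB(2) by (rule set_addI)
  next
    fix x y assume "x \<in> A <+>\<^bsub>M\<^esub> B" "y \<in> A <+>\<^bsub>M\<^esub> B"
    then obtain a b a' b' where *: "a \<in> A" "b \<in> B" "x = a \<oplus> b" "a' \<in> A" "b' \<in> B" "y = a' \<oplus> b'"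
      by (elim set_addE) blast
    then have "x \<oplus> y = (a \<oplus> a') \<oplus> (b \<oplus> b')"
      using cA(1) cB(1) by (simp add: M.add.m_ac)
    then show "x \<oplus> y \<in> A <+>\<^bsub>M\<^esub> B" by (rule set_addI) (use * cA(3) cB(3) in auto)
  next
    fix c :: "'k mat" and x assume c: "c \<in> carrier (Lambda n)" and "x \<in> A <+>\<^bsub>M\<^esub> B"
    then obtain a b where *: "a \<in> A" "b \<in> B" "x = a \<oplus> b"
      by (elim set_addE)
    then have "c \<odot> x = c \<odot> a \<oplus> c \<odot> b"
      using cA(1) cB(1) c by (simp add: smult_r_distr)
    then show "c \<odot> x \<in> A <+>\<^bsub>M\<^esub> B" by (rule set_addI) (use * c cA(4) cB(4) in auto)
  qed
qed

lemma submodule_cyclic: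
  assumes x: "x \<in> carrier M"
  shows "submodule ((\<lambda>N. N \<odot> x) ` carrier (Lambda n)) (Lambda n) M"
proof (rule submodule_left_moduleI)
  have "\<zero> = \<zero>\<^bsub>Lambda n\<^esub> \<odot> x" using x by simp
  then show "\<zero> \<in> (\<lambda>N. N \<odot> x) ` carrier (Lambda n)" by (rule image_eqI) simp
qed (use x in \<open>auto simp: smult_l_distr[symmetric] smult_assoc1[symmetric] simp del: smult_l_null\<close>)

text \<open>The union of a chain of submodules that avoid \<open>z\<close> avoids \<open>z\<close>,
  so Zorn's lemma applies. The dimension of the module is not known to be finite here.\<close>

lemma maximal_submodule_avoiding:
  assumes "z \<in> carrier M" "z \<noteq> \<zero>"
  obtains B where "submodule B (Lambda n) M" "z \<notin> B"
    "\<And>H. submodule H (Lambda n) M \<Longrightarrow> B \<subseteq> H \<Longrightarrow> z \<notin> H \<Longrightarrow> H = B"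
proof -
  define S where "S = {H. submodule H (Lambda n) M \<and> z \<notin> H}"
  have "\<exists>B\<in>S. \<forall>H\<in>S. B \<subseteq> H \<longrightarrow> H = B"
  proof (rule subset_Zorn_nonempty)
    show "S \<noteq> {}" using submodule_zero assms(2) by (auto simp: S_def)
    fix C assume C: "C \<noteq> {}" "subset.chain S C"
    then have CS: "submodule H (Lambda n) M" "z \<notin> H" if "H \<in> C" for H
      using that by (auto simp: S_def subset.chain_def)
    have dir: "\<exists>H\<in>C. a \<in> H \<and> b \<in> H" if "a \<in> \<Union>C" "b \<in> \<Union>C" for a b
      using that C(2) unfolding subset.chain_def by blast
    have "submodule (\<Union>C) (Lambda n) M"
    proof (rule submodule_left_moduleI)
      show "\<Union>C \<subseteq> carrier M" using submodule_closed(1)[OF CS(1)] by blast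
      show "\<zero> \<in> \<Union>C" using submodule_closed(2)[OF CS(1)] C(1) by blast
      show "a \<oplus> b \<in> \<Union>C" if "a \<in> \<Union>C" "b \<in> \<Union>C" for a b
        using dir[OF that] submodule_closed(3)[OF CS(1)] by blast
      show "c \<odot> a \<in> \<Union>C" if "c \<in> carrier (Lambda n)" "a \<in> \<Union>C" for c a
        using that submodule_closed(4)[OF CS(1)] by blast
    qed
    then show "\<Union>C \<in> S" using CS(2) by (auto simp: S_def)
  qed
  then show thesis using that by (auto simp: S_def)
qed

text \<open>If \<open>e\<^sub>k M = 0\<close> for \<open>k < r\<close>, then \<open>x \<in> e\<^sub>r M\<close> generates a direct summand. A complement
  is any submodule that is maximal among those that do not contain the socle of the submodule
  generated by \<open>x\<close>.\<close>

theorem indecomposable_iso_interval: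
  assumes indec: "indecomposable (Lambda n) M"
  obtains p where "fst p + snd p < n" "mod_iso (Lambda n) (std n {()} (\<lambda>_. p)) M"
proof -
  have nz: "carrier M \<noteq> {\<zero>}" using indec by (simp add: indecomposable_def)
  have "\<exists>r. r < n \<and> (\<exists>x\<in>carrier M. mu n r r 1 \<odot> x \<noteq> \<zero>)"
  proof (rule ccontr)
    assume "\<not> ?thesis"
    then have "x \<in> {\<zero>}" if "x \<in> carrier M" for x
      using mem_submodule_components[OF submodule_zero that] that by blast
    then show False using nz by blast
  qed
  then obtain r where r: "r < n" "\<exists>x\<in>carrier M. mu n r r 1 \<odot> x \<noteq> \<zero>"
    and rmin: "\<And>k. k < r \<Longrightarrow> \<not> (k < n \<and> (\<exists>x\<in>carrier M. mu n k k 1 \<odot> x \<noteq> \<zero>))"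
    using exists_least_iff[of "\<lambda>r. r < n \<and> (\<exists>x\<in>carrier M. mu n r r 1 \<odot> x \<noteq> \<zero>)"] by blast
  from r(2) obtain x0 where x0: "x0 \<in> carrier M" "mu n r r 1 \<odot> x0 \<noteq> \<zero>" by blast
  define x where "x = mu n r r 1 \<odot> x0"
  have x: "x \<in> carrier M" "x \<noteq> \<zero>" using x0 mu_Lambda[of r r] by (auto simp: x_def)
  have xr: "mu n r r 1 \<odot> x = x" unfolding x_def using mu_mu[OF x0(1) r(1), of r r 1 1] by simp
  \<comment> \<open>The last vertex that \<open>x\<close> reaches without vanishing, so that
    \<open>xe\<close> spans the socle of the submodule generated by \<open>x\<close>.\<close>
  define e where "e = Max {k. r \<le> k \<and> k < n \<and> mu n k r 1 \<odot> x \<noteq> \<zero>}"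
  have fin: "finite {k. r \<le> k \<and> k < n \<and> mu n k r 1 \<odot> x \<noteq> \<zero>}" by simp
  have "r \<in> {k. r \<le> k \<and> k < n \<and> mu n k r 1 \<odot> x \<noteq> \<zero>}" using r xr x by simp
  then have "e \<in> {k. r \<le> k \<and> k < n \<and> mu n k r 1 \<odot> x \<noteq> \<zero>}"
    unfolding e_def using fin by (intro Max_in) blast+
  then have e: "r \<le> e" "e < n" "mu n e r 1 \<odot> x \<noteq> \<zero>" by auto
  have emax: "mu n k r 1 \<odot> x = \<zero>" if "e < k" "k < n" for k
    using Max_ge[OF fin, of k] that e(1) unfolding e_def[symmetric] by auto
  define p where "p = (r, n - 1 - e)"
  have p: "k \<in> supp n p \<longleftrightarrow> r \<le> k \<and> k \<le> e" for k using e by (auto simp: p_def supp_def)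
  have pn: "fst p + snd p < n" using e by (simp add: p_def)
  let ?N = "std n {()} (\<lambda>_. p) :: ('k mat, unit \<Rightarrow> nat \<Rightarrow> 'k) module"
  define xe where "xe = mu n e r 1 \<odot> x"
  have xe: "xe \<in> carrier M" "xe \<noteq> \<zero>" using e x mu_Lambda[of r e] by (auto simp: xe_def)

  \<comment> \<open>Applied to \<open>x\<close>, this matrix gives the combination of the vectors
    \<open>mu n k r 1 \<odot> x\<close> with coefficients \<open>y () k\<close>.\<close>
  define C where "C y = (mat n n (\<lambda>(i, j). if j = r then y () i else 0) :: 'k mat)"
    for y :: "unit \<Rightarrow> nat \<Rightarrow> 'k"
  have C: "C y \<in> carrier (Lambda n)" if "y \<in> carrier ?N" for y
    using std_out[OF that] p by (auto simp: C_def Lambda_simps)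
  define \<psi> where "\<psi> = (\<lambda>y\<in>carrier ?N. C y \<odot> x)"
  have \<psi>: "\<psi> \<in> mod_hom (Lambda n) ?N M"
    unfolding \<psi>_def
  proof (rule mod_homI_restrict[OF left_module_std])
    show "C y \<odot> x \<in> carrier M" if "y \<in> carrier ?N" for y using C[OF that] x by blast
    fix y assume y: "y \<in> carrier ?N"
    show "C (y \<oplus>\<^bsub>?N\<^esub> z) \<odot> x = C y \<odot> x \<oplus> C z \<odot> x" if z: "z \<in> carrier ?N" for z
    proof -
      have "C (y \<oplus>\<^bsub>?N\<^esub> z) = C y \<oplus>\<^bsub>Lambda n\<^esub> C z"
        by (rule eq_matI) (auto simp: C_def std_simps Lambda_simps)
      then show ?thesis using smult_l_distr[OF C[OF y] C[OF z] x(1)] by simp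
    qed
    fix A :: "'k mat" assume A: "A \<in> carrier (Lambda n)"
    then have A': "A \<in> carrier_mat n n" by (simp add: Lambda_simps)
    have yA: "A \<odot>\<^bsub>?N\<^esub> y \<in> carrier ?N"
      using left_module.smult_closed[OF left_module_std A y] .
    \<comment> \<open>The product of \<open>A\<close> and \<open>C y\<close> also has entries in
      rows after \<open>e\<close>, which the truncated action in \<open>?N\<close> discards. They
      factor through the matrix unit from \<open>r\<close> to \<open>Suc e\<close>, which kills
      \<open>x\<close> or, if \<open>Suc e = n\<close>, is the zero matrix.\<close>
    define D where "D = (mat n n (\<lambda>(i, j). if Suc e \<le> i \<and> j = Suc e then \<Sum>l<n. A $$ (i, l) * y () l else 0) :: 'k mat)"
    have D: "D \<in> carrier (Lambda n)" by (auto simp: D_def Lambda_simps)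
    have eq: "A \<otimes>\<^bsub>Lambda n\<^esub> C y = C (A \<odot>\<^bsub>?N\<^esub> y) \<oplus>\<^bsub>Lambda n\<^esub> D \<otimes>\<^bsub>Lambda n\<^esub> mu n (Suc e) r 1"
    proof (rule eq_matI)
      fix i j assume "i < dim_row (C (A \<odot>\<^bsub>?N\<^esub> y) \<oplus>\<^bsub>Lambda n\<^esub> D \<otimes>\<^bsub>Lambda n\<^esub> mu n (Suc e) r 1)"
        "j < dim_col (C (A \<odot>\<^bsub>?N\<^esub> y) \<oplus>\<^bsub>Lambda n\<^esub> D \<otimes>\<^bsub>Lambda n\<^esub> mu n (Suc e) r 1)"
      then have ij: "i < n" "j < n" by (auto simp: Lambda_simps D_def mu_def)
      have "(A * C y) $$ (i, j) = (\<Sum>l<n. A $$ (i, l) * C y $$ (l, j))"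
        by (rule Lambda_mult_entry[OF A C[OF y] ij])
      also have "\<dots> = (if j = r then \<Sum>l<n. A $$ (i, l) * y () l else 0)"
        using ij by (auto simp: C_def)
      finally have 1: "(A * C y) $$ (i, j) = (if j = r then \<Sum>l<n. A $$ (i, l) * y () l else 0)" .
      have "(D * mu n (Suc e) r 1) $$ (i, j) = (\<Sum>l<n. D $$ (i, l) * mu n (Suc e) r 1 $$ (l, j))"
        using e by (intro Lambda_mult_entry[OF D mu_Lambda ij]) simp
      also have "\<dots> = (\<Sum>l<n. if l = Suc e then if Suc e \<le> i \<and> j = r then \<Sum>l<n. A $$ (i, l) * y () l else 0 else 0)"
        using ij by (intro sum.cong) (auto simp: D_def mu_def)
      also have "\<dots> = (if Suc e \<le> i \<and> j = r then \<Sum>l<n. A $$ (i, l) * y () l else 0)"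
        using ij by auto
      finally have 2: "(D * mu n (Suc e) r 1) $$ (i, j) =
          (if Suc e \<le> i \<and> j = r then \<Sum>l<n. A $$ (i, l) * y () l else 0)" .
      have "(\<Sum>l<n. A $$ (i, l) * y () l) = 0" if "i < r"
      proof (rule sum.neutral, rule ballI)
        fix l assume "l \<in> {..<n}"
        then show "A $$ (i, l) * y () l = 0"
          using that A ij std_out[OF y, of "()" l] p by (cases "i < l") (auto simp: Lambda_simps)
      qed
      then have 3: "C (A \<odot>\<^bsub>?N\<^esub> y) $$ (i, j) =
          (if i \<le> e \<and> j = r then \<Sum>l<n. A $$ (i, l) * y () l else 0)"
        using ij by (auto simp: C_def std_simps(4) p)
      have dims: "D * mu n (Suc e) r 1 \<in> carrier_mat n n" by (auto simp: D_def mu_def)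
      show "(A \<otimes>\<^bsub>Lambda n\<^esub> C y) $$ (i, j) =
          (C (A \<odot>\<^bsub>?N\<^esub> y) \<oplus>\<^bsub>Lambda n\<^esub> D \<otimes>\<^bsub>Lambda n\<^esub> mu n (Suc e) r 1) $$ (i, j)"
        unfolding Lambda_simps(2,5)
        by (subst index_add_mat(1)) (use 1 2 3 ij dims in \<open>auto simp del: index_mult_mat\<close>)
    qed (use A' in \<open>auto simp: Lambda_simps C_def D_def mu_def\<close>)
    have "mu n (Suc e) r 1 \<odot> x = \<zero>"
    proof (cases "Suc e < n")
      case True then show ?thesis using emax by simp
    next
      case False
      then have "mu n (Suc e) r (1 :: 'k) = \<zero>\<^bsub>Lambda n\<^esub>" by (intro eq_matI) (auto simp: mu_def Lambda_simps)
      then show ?thesis using x by simp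
    qed
    then have "(D \<otimes>\<^bsub>Lambda n\<^esub> mu n (Suc e) r 1) \<odot> x = \<zero>"
      using smult_assoc1[OF D mu_Lambda x(1)] e D by simp
    moreover have "(A \<otimes>\<^bsub>Lambda n\<^esub> C y) \<odot> x =
        C (A \<odot>\<^bsub>?N\<^esub> y) \<odot> x \<oplus> (D \<otimes>\<^bsub>Lambda n\<^esub> mu n (Suc e) r 1) \<odot> x"
      unfolding eq using e by (intro smult_l_distr C yA x R.m_closed D mu_Lambda) simp
    ultimately have "(A \<otimes>\<^bsub>Lambda n\<^esub> C y) \<odot> x = C (A \<odot>\<^bsub>?N\<^esub> y) \<odot> x"
      using C[OF yA] x by simp
    then show "C (A \<odot>\<^bsub>?N\<^esub> y) \<odot> x = A \<odot> (C y \<odot> x)"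
      using smult_assoc1[OF A C[OF y] x(1)] by simp
  qed
  \<comment> \<open>Any nonzero coordinate can be moved to vertex \<open>e\<close> and normalised,
    so a nonzero element of the image of \<psi> generates a submodule containing \<open>xe\<close>.
    This gives both the injectivity of \<psi> and the trivial intersection with
    \<open>B\<close>.\<close>
  have socle: "xe = mu n e k (1 / y () k) \<odot> \<psi> y"
    if y: "y \<in> carrier ?N" "y () k \<noteq> 0" for y k
  proof -
    have k: "r \<le> k" "k \<le> e" using std_out[OF y(1), of "()" k] y(2) p by auto
    have "mu n e k (1 / y () k) * C y = mu n e r 1"
    proof (rule eq_matI)
      fix i j assume "i < dim_row (mu n e r 1 :: 'k mat)" "j < dim_col (mu n e r 1 :: 'k mat)"
      then have ij: "i < n" "j < n" by (simp_all add: mu_def)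
      have "(mu n e k (1 / y () k) * C y) $$ (i, j) = (\<Sum>l<n. mu n e k (1 / y () k) $$ (i, l) * C y $$ (l, j))"
        using k by (intro Lambda_mult_entry mu_Lambda C y ij) simp
      also have "\<dots> = (\<Sum>l<n. if l = k then if i = e \<and> j = r then 1 else 0 else 0)"
        using ij y(2) by (intro sum.cong) (auto simp: mu_def C_def)
      finally show "(mu n e k (1 / y () k) * C y) $$ (i, j) = mu n e r 1 $$ (i, j)"
        using ij k e by (simp add: mu_def)
    qed (simp_all add: mu_def C_def)
    moreover have "(mu n e k (1 / y () k) \<otimes>\<^bsub>Lambda n\<^esub> C y) \<odot> x = mu n e k (1 / y () k) \<odot> (C y \<odot> x)"
      using k by (intro smult_assoc1 mu_Lambda C y x) simp
    ultimately show ?thesis using y by (simp add: xe_def \<psi>_def Lambda_simps(2))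
  qed

  define A where "A = \<psi> ` carrier ?N"
  have A: "submodule A (Lambda n) M"
    unfolding A_def by (rule submodule_image[OF left_module_std left_module_axioms \<psi>
      left_module.submodule_carrier[OF left_module_std]])
  have muA: "mu n k r a \<odot> x \<in> A" if "r \<le> k" "k \<le> e" for k a
  proof -
    define y where "y = (\<lambda>(u :: unit) i. if i = k then a else 0)"
    have y: "y \<in> carrier ?N" using that by (auto simp: y_def std_simps p)
    have "C y = mu n k r a" by (rule eq_matI) (auto simp: C_def y_def mu_def)
    then show ?thesis using y by (auto simp: A_def \<psi>_def intro!: image_eqI[of _ _ y])
  qed

  obtain B where B: "submodule B (Lambda n) M" "xe \<notin> B"
    and Bmax: "\<And>H. submodule H (Lambda n) M \<Longrightarrow> B \<subseteq> H \<Longrightarrow> xe \<notin> H \<Longrightarrow> H = B"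
    using maximal_submodule_avoiding[OF xe] by blast
  note cA = submodule_closed[OF A] and cB = submodule_closed[OF B(1)]

  \<comment> \<open>By maximality, adding \<open>z\<close> to \<open>B\<close> captures
    \<open>xe\<close>. Cutting the resulting equation down to vertex \<open>e\<close> leaves one
    matrix entry \<open>a\<close> of the coefficient of \<open>z\<close>. For \<open>k > e\<close>
    this entry would be zero and \<open>xe\<close> would lie in \<open>B\<close>.\<close>
  have outside: "k \<le> e \<and> (\<exists>b\<in>B. \<exists>a. xe = b \<oplus> mu n e k a \<odot> z)"
    if z: "z \<in> carrier M" "mu n k k 1 \<odot> z = z" "z \<notin> B" and k: "k < n" for z k
  proof -
    define Z where "Z = (\<lambda>N. N \<odot> z) ` carrier (Lambda n)"
    have Z: "submodule Z (Lambda n) M" unfolding Z_def by (rule submodule_cyclic[OF z(1)])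
    have zZ: "z \<in> Z" unfolding Z_def using z(2) mu_Lambda[of k k] by (metis image_eqI order.refl)
    have "B \<subseteq> B <+>\<^bsub>M\<^esub> Z"
    proof
      fix b assume b: "b \<in> B"
      then have "b = b \<oplus> \<zero>" using cB(1) by simp
      then show "b \<in> B <+>\<^bsub>M\<^esub> Z" using b submodule_closed(2)[OF Z] by (rule set_addI)
    qed
    moreover have "z \<in> B <+>\<^bsub>M\<^esub> Z"
    proof -
      have "z = \<zero> \<oplus> z" using z(1) by simp
      then show ?thesis using cB(2) zZ by (rule set_addI)
    qed
    ultimately have "xe \<in> B <+>\<^bsub>M\<^esub> Z"
      using Bmax[OF submodule_sum[OF B(1) Z]] z(3) by blast
    then obtain b N where b: "b \<in> B" and N: "N \<in> carrier (Lambda n)" and xeq: "xe = b \<oplus> N \<odot> z"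
      unfolding Z_def by (elim set_addE) blast
    have E: "mu n e e (1 :: 'k) \<in> carrier (Lambda n)" "mu n k k (1 :: 'k) \<in> carrier (Lambda n)"
      by (auto intro: mu_Lambda)
    have "xe = mu n e e 1 \<odot> xe" unfolding xe_def using e x mu_mu[of x e e r 1 1] by simp
    also have "\<dots> = mu n e e 1 \<odot> b \<oplus> mu n e e 1 \<odot> (N \<odot> z)"
      unfolding xeq using E b cB(1) N z by (intro smult_r_distr) auto
    also have "mu n e e 1 \<odot> (N \<odot> z) = mu n e e 1 \<odot> (N \<odot> (mu n k k 1 \<odot> z))"
      using z(2) by simp
    also have "\<dots> = (mu n e e 1 \<otimes>\<^bsub>Lambda n\<^esub> (N \<otimes>\<^bsub>Lambda n\<^esub> mu n k k 1)) \<odot> z"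
      using E N z(1) by (simp add: smult_assoc1)
    also have "mu n e e 1 \<otimes>\<^bsub>Lambda n\<^esub> (N \<otimes>\<^bsub>Lambda n\<^esub> mu n k k 1) = mu n e k (N $$ (e, k))"
    proof (rule eq_matI)
      fix i j assume "i < dim_row (mu n e k (N $$ (e, k)) :: 'k mat)" "j < dim_col (mu n e k (N $$ (e, k)) :: 'k mat)"
      then have ij: "i < n" "j < n" by (simp_all add: mu_def)
      have NE: "(N * mu n k k 1) $$ (l, j) = (if j = k then N $$ (l, k) else 0)" if "l < n" for l
      proof -
        have "(N * mu n k k 1) $$ (l, j) = (\<Sum>m<n. N $$ (l, m) * mu n k k 1 $$ (m, j))"
          by (rule Lambda_mult_entry[OF N E(2) that ij(2)])
        also have "\<dots> = (\<Sum>m<n. if m = k then if j = k then N $$ (l, k) else 0 else 0)"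
          using ij by (intro sum.cong) (auto simp: mu_def)
        finally show ?thesis using k by simp
      qed
      have "(mu n e e 1 * (N * mu n k k 1)) $$ (i, j) = (\<Sum>l<n. mu n e e 1 $$ (i, l) * (N * mu n k k 1) $$ (l, j))"
        using R.m_closed[OF N E(2)] by (intro Lambda_mult_entry E ij) (simp add: Lambda_simps(2))
      also have "\<dots> = (\<Sum>l<n. if l = e then if i = e \<and> j = k then N $$ (e, k) else 0 else 0)"
        using ij by (intro sum.cong) (auto simp: index_mu NE simp del: index_mult_mat)
      finally show "(mu n e e 1 \<otimes>\<^bsub>Lambda n\<^esub> (N \<otimes>\<^bsub>Lambda n\<^esub> mu n k k 1)) $$ (i, j) = mu n e k (N $$ (e, k)) $$ (i, j)"
        using ij e by (simp add: mu_def Lambda_simps(2))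
    qed (use N in \<open>simp_all add: mu_def Lambda_simps\<close>)
    finally have fin: "xe = mu n e e 1 \<odot> b \<oplus> mu n e k (N $$ (e, k)) \<odot> z" .
    have bB: "mu n e e 1 \<odot> b \<in> B" using cB(4)[OF E(1) b] .
    have "k \<le> e"
    proof (rule ccontr)
      assume "\<not> k \<le> e"
      then have "N $$ (e, k) = 0" using N k e by (simp add: Lambda_simps)
      then have "xe = mu n e e 1 \<odot> b" using fin z(1) bB cB(1) by (simp add: mu_zero)
      then show False using bB B(2) by simp
    qed
    then show ?thesis using fin bB by blast
  qed

  have "A \<inter> B = {\<zero>}"
  proof -
    have "z = \<zero>" if z: "z \<in> A" "z \<in> B" for z
    proof -
      obtain y where y: "y \<in> carrier ?N" "z = \<psi> y" using z(1) by (auto simp: A_def)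
      have "y () k = 0" for k
      proof (rule ccontr)
        assume nz: "y () k \<noteq> 0"
        then have "k \<le> e" using std_out[OF y(1), of "()" k] p by auto
        then have "xe \<in> B" unfolding socle[OF y(1) nz] using z(2) y(2) by (auto intro!: cB(4) mu_Lambda)
        then show False using B(2) by simp
      qed
      then have "y = \<zero>\<^bsub>?N\<^esub>" by (auto simp: std_simps fun_eq_iff)
      then show ?thesis using y(2) mod_hom_zero[OF left_module_std left_module_axioms \<psi>] by simp
    qed
    then show ?thesis using cA(2) cB(2) by blast
  qed
  moreover have "A <+>\<^bsub>M\<^esub> B = carrier M"
  proof
    show "A <+>\<^bsub>M\<^esub> B \<subseteq> carrier M" using submodule_closed(1)[OF submodule_sum[OF A B(1)]] by blast
    show "carrier M \<subseteq> A <+>\<^bsub>M\<^esub> B"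
    proof
      fix w assume w: "w \<in> carrier M"
      show "w \<in> A <+>\<^bsub>M\<^esub> B"
      proof (rule mem_submodule_components[OF submodule_sum[OF A B(1)] w])
        fix k assume k: "k < n"
        define z where "z = mu n k k 1 \<odot> w"
        have z: "z \<in> carrier M" "mu n k k 1 \<odot> z = z"
          using w mu_Lambda[of k k] mu_mu[OF w k, of k k 1 1] by (auto simp: z_def)
        have BAB: "z \<in> A <+>\<^bsub>M\<^esub> B" if "z \<in> B"
        proof -
          have "z = \<zero> \<oplus> z" using z(1) by simp
          then show ?thesis using cA(2) that by (rule set_addI)
        qed
        show "mu n k k 1 \<odot> w \<in> A <+>\<^bsub>M\<^esub> B"
          unfolding z_def[symmetric]
        proof (cases "z \<in> B")
          case False
          then obtain b a where ke: "k \<le> e" and b: "b \<in> B" and xea: "xe = b \<oplus> mu n e k a \<odot> z"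
            using outside[OF z] k by blast
          have "z \<noteq> \<zero>" using False cB(2) by auto
          \<comment> \<open>The minimality of \<open>r\<close> enters here: \<open>z\<close> is a
            nonzero vector at vertex \<open>k\<close>, so \<open>k\<close> is not before
            \<open>r\<close> and \<open>x\<close> can be transported to \<open>k\<close>.\<close>
          then have rk: "r \<le> k" using rmin[of k] k z by (metis leI)
          have a: "a \<noteq> 0"
          proof
            assume "a = 0"
            then have "xe = b" using xea z(1) b cB(1) by (simp add: mu_zero)
            then show False using b B(2) by simp
          qed
          \<comment> \<open>The correction of \<open>z\<close> by an element of \<open>A\<close>,
            chosen so that \<open>mu n e k a \<odot> z'\<close> lies in \<open>B\<close>. If
            \<open>z'\<close> itself were not in \<open>B\<close>, then \<open>outside\<close> would
            express \<open>xe\<close> by elements of \<open>B\<close>.\<close>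
          define z' where "z' = z \<oplus> mu n k r (- 1 / a) \<odot> x"
          have mx: "mu n k r c \<odot> x \<in> carrier M" "mu n e r c \<odot> x \<in> carrier M"
            "mu n e k c \<odot> z \<in> carrier M" for c
            using rk ke e x z by (auto intro!: smult_closed mu_Lambda)
          have z'c: "z' \<in> carrier M" using z mx by (simp add: z'_def)
          have z'k: "mu n k k 1 \<odot> z' = z'"
            unfolding z'_def using z mx rk k x
            by (subst smult_r_distr) (auto simp: mu_mu intro!: mu_Lambda)
          have "mu n e k a \<odot> z' = mu n e k a \<odot> z \<oplus> mu n e r (- 1) \<odot> x"
            unfolding z'_def using z mx rk ke k x a
            by (subst smult_r_distr) (auto simp: mu_mu intro!: mu_Lambda)
          also have "mu n e r (- 1) \<odot> x = mu n e e (- 1) \<odot> xe"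
            unfolding xe_def using e x by (subst mu_mu) auto
          also have "\<dots> = mu n e e (- 1) \<odot> b \<oplus> mu n e e (- 1) \<odot> (mu n e k a \<odot> z)"
            unfolding xea using b cB(1) mx by (intro smult_r_distr mu_Lambda) auto
          also have "mu n e e (- 1) \<odot> (mu n e k a \<odot> z) = mu n e k (- a) \<odot> z"
            using z e ke by (subst mu_mu) auto
          also have "mu n e k a \<odot> z \<oplus> (mu n e e (- 1) \<odot> b \<oplus> mu n e k (- a) \<odot> z) =
              mu n e e (- 1) \<odot> b \<oplus> (mu n e k a \<odot> z \<oplus> mu n e k (- a) \<odot> z)"
            using mx b cB(1) mu_Lambda[of e e "- 1 :: 'k" n] by (intro M.a_lcomm) auto
          also have "\<dots> = mu n e e (- 1) \<odot> b"
            using z ke b cB(1) mu_Lambda[of e e "- 1 :: 'k" n] by (simp add: mu_add mu_zero)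
          finally have "mu n e k a \<odot> z' = mu n e e (- 1) \<odot> b" .
          then have aB: "mu n e k a \<odot> z' \<in> B" using b by (auto intro!: cB(4) mu_Lambda)
          have z'B: "z' \<in> B"
          proof (rule ccontr)
            assume "z' \<notin> B"
            then obtain b' a' where b': "b' \<in> B" "xe = b' \<oplus> mu n e k a' \<odot> z'"
              using outside[OF z'c z'k] k by blast
            have "mu n e k a' \<odot> z' = mu n e e (a' / a) \<odot> (mu n e k a \<odot> z')"
              using z'c e ke a by (subst mu_mu) auto
            then have "mu n e k a' \<odot> z' \<in> B" using aB by (auto intro!: cB(4) mu_Lambda)
            then show False using b' cB(3) B(2) by simp
          qed
          have "z = mu n k r (1 / a) \<odot> x \<oplus> z'"
          proof -
            have "mu n k r (1 / a) \<odot> x \<oplus> z' =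
                z \<oplus> (mu n k r (1 / a) \<odot> x \<oplus> mu n k r (- 1 / a) \<odot> x)"
              unfolding z'_def using mx z by (intro M.a_lcomm) auto
            also have "\<dots> = z" using x rk z a by (simp add: mu_add mu_zero)
            finally show ?thesis by simp
          qed
          then show "z \<in> A <+>\<^bsub>M\<^esub> B" using muA[OF rk ke] z'B by (rule set_addI)
        qed (rule BAB)
      qed
    qed
  qed
  ultimately have "internal_sum2 (Lambda n) M A B" using A B by (simp add: internal_sum2_def)
  then have "A = {\<zero>} \<or> B = {\<zero>}" using indec unfolding indecomposable_def by blast
  moreover have "x \<in> A" using muA[of r 1] e xr by simp
  ultimately have "B = {\<zero>}" using x by auto
  with \<open>A <+>\<^bsub>M\<^esub> B = carrier M\<close> have AM: "A = carrier M" using cA(1) by (auto simp: set_add_def')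
  have inj: "inj_on \<psi> (carrier ?N)"
  proof (rule inj_onI)
    fix y z assume y: "y \<in> carrier ?N" and z: "z \<in> carrier ?N" and eq: "\<psi> y = \<psi> z"
    define d where "d = (\<lambda>u k. y u k - z u k)"
    have d: "d \<in> carrier ?N" using y z by (auto simp: d_def std_simps)
    have "y = d \<oplus>\<^bsub>?N\<^esub> z" by (auto simp: d_def std_simps)
    then have "\<psi> y = \<psi> d \<oplus> \<psi> z" using mod_homD(3)[OF \<psi> d z] by simp
    then have \<psi>d: "\<psi> d = \<zero>"
      using eq M.add.r_cancel_one'[of "\<psi> z" "\<psi> d"] mod_homD(1)[OF \<psi> d] mod_homD(1)[OF \<psi> z] by simp
    have "d () k = 0" for k
    proof (rule ccontr)
      assume nz: "d () k \<noteq> 0"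
      then have "k \<le> e" using std_out[OF d, of "()" k] p by auto
      then show False using socle[OF d nz] \<psi>d xe(2) smult_r_null[OF mu_Lambda[of k e "1 / d () k" n]] by simp
    qed
    then show "y = z" by (auto simp: d_def fun_eq_iff)
  qed
  then have "mod_iso (Lambda n) ?N M"
    unfolding mod_iso_def bij_betw_def using AM \<psi> by (auto simp: A_def)
  then show thesis by (rule that[OF pn])
qed

end

section \<open>Decompositions into interval modules\<close>

lemma mod_iso_imod_std:
  "mod_iso (Lambda n) (imod n p :: ('k::field mat, _) module) (std n {()} (\<lambda>_. p))"
proof -
  let ?I = "imod n p :: ('k mat, _) module" and ?S = "std n {()} (\<lambda>_. p) :: ('k mat, _) module"
  define f :: "'k vec \<Rightarrow> unit \<Rightarrow> nat \<Rightarrow> 'k" where "f v = (\<lambda>_ k. if k \<in> supp n p then v $ k else 0)" for v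
  have sup: "k \<in> supp n p \<longleftrightarrow> Suc (fst p) \<le> Suc k \<and> Suc k \<le> n - snd p" for k
    by (auto simp: supp_def)
  have car: "v \<in> carrier ?I \<longleftrightarrow> v \<in> carrier_vec n \<and> (\<forall>k<n. k \<notin> supp n p \<longrightarrow> v $ k = 0)" for v
    by (auto simp: interval_module_simps sup)
  have hom: "restrict f (carrier ?I) \<in> mod_hom (Lambda n) ?I ?S"
  proof (rule mod_homI_restrict[OF left_module_interval_module])
    show "f v \<in> carrier ?S" for v by (auto simp: f_def std_simps)
    show "f (v \<oplus>\<^bsub>?I\<^esub> w) = f v \<oplus>\<^bsub>?S\<^esub> f w" if "v \<in> carrier ?I" "w \<in> carrier ?I" for v w
    proof (intro ext)
      fix u k
      show "f (v \<oplus>\<^bsub>?I\<^esub> w) u k = (f v \<oplus>\<^bsub>?S\<^esub> f w) u k"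
        using that supp_less[of k n p] unfolding car by (auto simp: f_def std_simps interval_module_simps)
    qed
    fix A :: "'k mat" and v assume A: "A \<in> carrier (Lambda n)" and v: "v \<in> carrier ?I"
    have "(A *\<^sub>v v) $ k = (\<Sum>l<n. A $$ (k, l) * f v () l)" if "k < n" for k
      using A v that unfolding car
      by (auto simp: scalar_prod_def f_def Lambda_simps atLeast0LessThan intro!: sum.cong)
    then have "(A *\<^sub>v v) $ k = (\<Sum>l<n. A $$ (k, l) * f v () l)" if "k \<in> supp n p" for k
      using supp_less[OF that] by blast
    then show "f (A \<odot>\<^bsub>?I\<^esub> v) = A \<odot>\<^bsub>?S\<^esub> f v"
      using supp_less[of _ n p] unfolding interval_module_simps sup[symmetric]
      by (auto simp: f_def[of "vec _ _"] std_simps fun_eq_iff simp del: index_mult_mat_vec)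
  qed
  have "bij_betw f (carrier ?I) (carrier ?S)"
    unfolding bij_betw_def
  proof
    show "inj_on f (carrier ?I)"
    proof (rule inj_onI)
      fix v w assume v: "v \<in> carrier ?I" and w: "w \<in> carrier ?I" and eq: "f v = f w"
      show "v = w"
      proof (rule eq_vecI)
        fix k assume "k < dim_vec w"
        then show "v $ k = w $ k"
          using v w fun_cong[OF fun_cong[OF eq], of "()" k] unfolding car
          by (cases "k \<in> supp n p") (auto simp: f_def)
      qed (use v w in \<open>auto simp: car\<close>)
    qed
    show "f ` carrier ?I = carrier ?S"
    proof
      show "f ` carrier ?I \<subseteq> carrier ?S" by (auto simp: f_def std_simps)
      show "carrier ?S \<subseteq> f ` carrier ?I"
      proof
        fix x assume x: "x \<in> carrier ?S"
        have "x = f (vec n (x ()))"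
          using std_out[OF x] by (auto simp: f_def fun_eq_iff dest: supp_less)
        moreover have "vec n (x ()) \<in> carrier ?I"
          using std_out[OF x] by (auto simp: car)
        ultimately show "x \<in> f ` carrier ?I" by blast
      qed
    qed
  qed
  then show ?thesis unfolding mod_iso_def
    by (intro bexI[OF _ hom]) (simp cong: bij_betw_cong)
qed

text \<open>Distinct labels can serve as indices themselves, so that the module depends only on the
  set of pointed cells.\<close>

lemma mod_iso_std_reindex:
  assumes "inj_on s T"
  shows "mod_iso (Lambda n) (std n (s ` T) (\<lambda>p. p) :: ('k::field mat, _) module) (std n T s)"
proof -
  let ?N = "std n (s ` T) (\<lambda>p. p) :: ('k mat, _) module" and ?M = "std n T s :: ('k mat, _) module"
  define f where "f = (\<lambda>(y :: nat \<times> nat \<Rightarrow> nat \<Rightarrow> 'k) t k. if t \<in> T then y (s t) k else 0)"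
  define g where "g = (\<lambda>(x :: _ \<Rightarrow> nat \<Rightarrow> 'k) p k. if p \<in> s ` T then x (inv_into T s p) k else 0)"
  have fc: "f y \<in> carrier ?M" if "y \<in> carrier ?N" for y
    using std_out[OF that] by (auto simp: f_def std_simps(1))
  have hom: "restrict f (carrier ?N) \<in> mod_hom (Lambda n) ?N ?M"
  proof (rule mod_homI_restrict[OF left_module_std])
    show "f y \<in> carrier ?M" if "y \<in> carrier ?N" for y by (rule fc[OF that])
  qed (auto simp: f_def std_simps fun_eq_iff)
  have "bij_betw f (carrier ?N) (carrier ?M)"
  proof (rule bij_betw_byWitness[where f' = g])
    show "\<forall>y\<in>carrier ?N. g (f y) = y"
    proof (intro ballI ext)
      fix y p k assume "y \<in> carrier ?N"
      then show "g (f y) p k = y p k" using assms std_out[of y n "s ` T" "\<lambda>p. p" p k] by (auto simp: f_def g_def)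
    qed
    show "\<forall>x\<in>carrier ?M. f (g x) = x"
    proof (intro ballI ext)
      fix x t k assume "x \<in> carrier ?M"
      then show "f (g x) t k = x t k" using assms std_out[of x n T s t k] by (auto simp: f_def g_def)
    qed
    show "g ` carrier ?M \<subseteq> carrier ?N"
    proof (rule image_subsetI)
      fix x assume x: "x \<in> carrier ?M"
      show "g x \<in> carrier ?N" unfolding std_simps(1)
      proof (intro allI impI)
        fix p k assume "\<not> (p \<in> s ` T \<and> k \<in> supp n p)"
        then show "g x p k = 0" using assms std_out[OF x, of "inv_into T s p" k]
          by (auto simp: g_def f_inv_into_f)
      qed
    qed
  qed (use fc in blast)
  then show ?thesis unfolding mod_iso_def
    by (intro bexI[OF _ hom]) (simp cong: bij_betw_cong)
qed

lemma is_summand_mod_iso: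
  assumes "left_module R N" "mod_iso R N N'" "is_summand R N' M"
  shows "is_summand R N M"
  using assms mod_iso_trans[OF assms(1,2)] unfolding is_summand_def by blast

lemma mod_iso_imp_is_summand:
  assumes M: "left_module R M" and N: "left_module R N" and iso: "mod_iso R N M"
  shows "is_summand R N M"
proof -
  obtain f g where "f \<in> mod_hom R N M" "g \<in> mod_hom R M N" "\<And>x. x \<in> carrier N \<Longrightarrow> g (f x) = x"
    by (rule mod_isoE[OF N iso]) blast
  then show ?thesis unfolding is_summand_iff_retract[OF M N] by blast
qed

text \<open>Being a summand is invariant under isomorphism and is decided for \<open>std\<close> by
  \<open>is_summand_std\<close>. Hence all decompositions of a module have the same set of labels,
  which is its set of pointed cells.\<close>

lemma labels_eq_summands:
  assumes M: "left_module (Lambda n) M" and iso: "mod_iso (Lambda n) (std n T s :: ('k::field mat, _) module) M"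
    and fin: "finite T" and valid: "\<And>t. t \<in> T \<Longrightarrow> fst (s t) + snd (s t) < n"
  shows "s ` T = {p \<in> staircase n. is_summand (Lambda n) (imod n p) M}"
proof -
  have "is_summand (Lambda n) (imod n p) M \<longleftrightarrow> p \<in> s ` T" if p: "fst p + snd p < n" for p
  proof -
    have S: "left_module (Lambda n) (std n {()} (\<lambda>_. p) :: ('k mat, _) module)"
      and I: "left_module (Lambda n) (imod n p :: ('k mat, _) module)"
      by (rule left_module_std, rule left_module_interval_module)
    have iso': "mod_iso (Lambda n) (imod n p :: ('k mat, _) module) (std n {()} (\<lambda>_. p))"
      by (rule mod_iso_imod_std)
    have "is_summand (Lambda n) (imod n p) M \<longleftrightarrow> is_summand (Lambda n) (std n {()} (\<lambda>_. p)) M"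
      using is_summand_mod_iso[OF I iso'] is_summand_mod_iso[OF S mod_iso_sym[OF I iso']] by blast
    also have "\<dots> \<longleftrightarrow> is_summand (Lambda n) (std n {()} (\<lambda>_. p)) (std n T s :: ('k mat, _) module)"
      using is_summand_iso[OF S left_module_std M iso]
        is_summand_iso[OF S M left_module_std mod_iso_sym[OF left_module_std iso]] by blast
    finally show ?thesis using is_summand_std[of T s n p, OF fin valid p] by simp
  qed
  moreover have "fst p + snd p < n" if "p \<in> s ` T" for p using that valid by auto
  ultimately show ?thesis by (auto simp: staircase_eq)
qed

text \<open>Every endomorphism of an interval module is a scalar. The projection onto
  \<open>A\<close> along \<open>B\<close> becomes an idempotent scalar, and its value 0 or 1 makes
  \<open>A\<close> or \<open>B\<close> trivial.\<close>

lemma indecomposable_of_iso_std: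
  assumes M: "left_module (Lambda n) M" and iso: "mod_iso (Lambda n) (std n {()} (\<lambda>_. p) :: ('k::field mat, _) module) M"
    and p: "fst p + snd p < n"
  shows "indecomposable (Lambda n) M"
  unfolding indecomposable_def
proof (intro conjI allI impI)
  let ?S = "std n {()} (\<lambda>_. p) :: ('k mat, _) module"
  interpret M: left_module "Lambda n" M by fact
  obtain f g where f: "f \<in> mod_hom (Lambda n) ?S M" and g: "g \<in> mod_hom (Lambda n) M ?S"
    and gf: "\<And>x. x \<in> carrier ?S \<Longrightarrow> g (f x) = x" and fg: "\<And>y. y \<in> carrier M \<Longrightarrow> f (g y) = y"
    by (rule mod_isoE[OF left_module_std iso]) blast
  define b :: "unit \<Rightarrow> nat \<Rightarrow> 'k" where "b = eps () (fst p)"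
  have r: "fst p \<in> supp n p" using p by (auto simp: supp_def)
  have b: "b \<in> carrier ?S" unfolding b_def using r by (intro eps_carrier) auto
  have b1: "b () (fst p) = 1" by (simp add: b_def eps_def)
  show "carrier M \<noteq> {\<zero>\<^bsub>M\<^esub>}"
  proof
    assume "carrier M = {\<zero>\<^bsub>M\<^esub>}"
    then have "f b = f \<zero>\<^bsub>?S\<^esub>"
      using mod_homD(1)[OF f b] mod_hom_zero[OF left_module_std M f] by auto
    then have "b = \<zero>\<^bsub>?S\<^esub>"
      using gf[OF b] gf[OF abelian_monoid.zero_closed[OF abelian_group.axioms(1)[OF left_module.axioms(2)[OF left_module_std]]]]
      by metis
    then show False using b1 by (simp add: std_simps)
  qed
  fix A B assume AB: "internal_sum2 (Lambda n) M A B"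
  then have A: "submodule A (Lambda n) M" and B: "submodule B (Lambda n) M" by (simp_all add: internal_sum2_def)
  obtain \<pi> where \<pi>: "\<pi> \<in> mod_hom (Lambda n) M (M\<lparr>carrier := A\<rparr>)"
    "\<And>a. a \<in> A \<Longrightarrow> \<pi> a = a" "\<And>c. c \<in> B \<Longrightarrow> \<pi> c = \<zero>\<^bsub>M\<^esub>"
    using internal_sum2_projection[OF M AB] by metis
  have "A \<subseteq> carrier M" using submodule_closed(1)[OF A] by blast
  note \<pi>M = mod_hom_carrier_update[OF \<pi>(1) this]
  define \<alpha> where "\<alpha> = compose (carrier ?S) (compose (carrier M) g \<pi>) f"
  have \<alpha>: "\<alpha> \<in> mod_hom (Lambda n) ?S ?S"
    unfolding \<alpha>_def by (rule mod_hom_compose[OF left_module_std f mod_hom_compose[OF M \<pi>M g]])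
  have \<alpha>eq: "\<alpha> x = g (\<pi> (f x))" if "x \<in> carrier ?S" for x
    using that mod_homD(1)[OF f] by (simp add: \<alpha>_def compose_def)
  obtain G where G: "\<forall>x\<in>carrier ?S. \<forall>u\<in>{()}. \<forall>k\<in>supp n p. \<alpha> x u k = (\<Sum>t\<in>{()}. G t u * x t k)"
    by (rule exE[OF mod_hom_std[OF \<alpha>]]) (use p in auto)
  have scal: "\<alpha> x = (\<lambda>u k. G () () * x u k)" if x: "x \<in> carrier ?S" for x
  proof (intro ext)
    fix u k
    show "\<alpha> x u k = G () () * x u k"
      using G x std_out[OF x, of u k] std_out[OF mod_homD(1)[OF \<alpha> x], of u k]
      by (cases "k \<in> supp n p") auto
  qed
  have \<pi>f: "\<pi> (f x) \<in> A" if "x \<in> carrier ?S" for x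
    using mod_homD(1)[OF \<pi>(1) mod_homD(1)[OF f that]] by simp
  have "\<alpha> (\<alpha> b) = \<alpha> b"
    using \<alpha>eq b mod_homD(1)[OF \<alpha> b] \<pi>f[OF b] \<pi>(2) fg \<open>A \<subseteq> carrier M\<close> by (simp add: subset_iff)
  then have "G () () * (G () () * b () (fst p)) = G () () * b () (fst p)"
    using scal[OF b] scal[OF mod_homD(1)[OF \<alpha> b]] by (metis (no_types))
  then have "G () () = 0 \<or> G () () = 1" using b1 by simp
  then show "A = {\<zero>\<^bsub>M\<^esub>} \<or> B = {\<zero>\<^bsub>M\<^esub>}"
  proof
    assume 0: "G () () = 0"
    have "a = \<zero>\<^bsub>M\<^esub>" if a: "a \<in> A" for a
    proof -
      have aM: "a \<in> carrier M" using a \<open>A \<subseteq> carrier M\<close> by blast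
      note ga = mod_homD(1)[OF g aM]
      have "g a = \<alpha> (g a)" using \<alpha>eq[OF ga] fg[OF aM] \<pi>(2)[OF a] by simp
      also have "\<dots> = \<zero>\<^bsub>?S\<^esub>" using scal[OF ga] 0 by (simp add: std_simps)
      finally have "f (g a) = f \<zero>\<^bsub>?S\<^esub>" by simp
      then show ?thesis using fg[OF aM] mod_hom_zero[OF left_module_std M f] by simp
    qed
    then show ?thesis using submodule_closed(2)[OF A] by blast
  next
    assume 1: "G () () = 1"
    have "c = \<zero>\<^bsub>M\<^esub>" if c: "c \<in> B" for c
    proof -
      have cM: "c \<in> carrier M" using c submodule_closed(1)[OF B] by blast
      note gc = mod_homD(1)[OF g cM]
      have "g c = \<alpha> (g c)" using scal[OF gc] 1 by simp
      also have "\<dots> = g \<zero>\<^bsub>M\<^esub>" using \<alpha>eq[OF gc] fg[OF cM] \<pi>(3)[OF c] by simp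
      finally show ?thesis using fg[OF cM] fg[OF M.M.zero_closed] by metis
    qed
    then show ?thesis using submodule_closed(2)[OF B] by blast
  qed
qed

text \<open>The bijection in \<open>indec_decomp\<close> is composed with identifications
  \<open>\<psi> i\<close> of the summands with interval modules. Linearity is checked on
  \<open>f\<close>; bijectivity goes through \<open>h\<close>, which records the components as an
  extensional family.\<close>

lemma std_iso_of_indec_decomp:
  fixes M :: "('k::field mat, 'v) module"
  assumes M: "left_module (Lambda n) M" and dec: "indec_decomp (Lambda n) M m N"
  obtains s where "\<And>i. i < m \<Longrightarrow> fst (s i) + snd (s i) < n"
    "\<And>i. i < m \<Longrightarrow> mod_iso (Lambda n) (std n {()} (\<lambda>_. s i)) (M\<lparr>carrier := N i\<rparr>)"
    "mod_iso (Lambda n) (std n {..<m} s) M"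
proof -
  interpret M: left_module "Lambda n" M by fact
  have N: "submodule (N i) (Lambda n) M" "indecomposable (Lambda n) (M\<lparr>carrier := N i\<rparr>)" if "i < m" for i
    using dec that by (auto simp: indec_decomp_def)
  have bij: "bij_betw (\<lambda>x. \<Oplus>\<^bsub>M\<^esub>i\<in>{..<m}. x i) (\<Pi>\<^sub>E i\<in>{..<m}. N i) (carrier M)"
    using dec by (simp add: indec_decomp_def)
  have "\<exists>p. fst p + snd p < n \<and> mod_iso (Lambda n) (std n {()} (\<lambda>_. p) :: ('k mat, _) module) (M\<lparr>carrier := N i\<rparr>)"
    if "i < m" for i
  proof -
    interpret L: Lambda_module n "M\<lparr>carrier := N i\<rparr>"
      unfolding Lambda_module_def by (rule M.left_module_submodule[OF N(1)[OF that]])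
    show ?thesis using L.indecomposable_iso_interval[OF N(2)[OF that]] by metis
  qed
  then obtain s where s: "\<And>i. i < m \<Longrightarrow> fst (s i) + snd (s i) < n"
    "\<And>i. i < m \<Longrightarrow> mod_iso (Lambda n) (std n {()} (\<lambda>_. s i) :: ('k mat, _) module) (M\<lparr>carrier := N i\<rparr>)"
    by metis
  then obtain \<psi> where \<psi>: "\<And>i. i < m \<Longrightarrow> \<psi> i \<in> mod_hom (Lambda n) (std n {()} (\<lambda>_. s i) :: ('k mat, _) module) (M\<lparr>carrier := N i\<rparr>)"
    "\<And>i. i < m \<Longrightarrow> bij_betw (\<psi> i) (carrier (std n {()} (\<lambda>_. s i) :: ('k mat, _) module)) (N i)"
    unfolding mod_iso_def by (simp add: Bex_def) metis
  let ?S = "std n {..<m} s :: ('k mat, _) module"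
  let ?C = "\<lambda>i. std n {()} (\<lambda>_. s i) :: ('k mat, unit \<Rightarrow> nat \<Rightarrow> 'k) module"
  have c: "(\<lambda>_. y i) \<in> carrier (?C i)" if "y \<in> carrier ?S" for y i
    using that by (auto simp: std_simps)
  define h where "h y = (\<lambda>i\<in>{..<m}. \<psi> i (\<lambda>_. y i))" for y :: "nat \<Rightarrow> nat \<Rightarrow> 'k"
  have hN: "\<psi> i (\<lambda>_. y i) \<in> N i" if "y \<in> carrier ?S" "i < m" for y i
    using mod_homD(1)[OF \<psi>(1)[OF that(2)] c[OF that(1)]] by simp
  have hM: "\<psi> i (\<lambda>_. y i) \<in> carrier M" if "y \<in> carrier ?S" "i < m" for y i
    using submodule_closed(1)[OF N(1)[OF that(2)] hN[OF that]] .
  define f where "f y = (\<Oplus>\<^bsub>M\<^esub>i\<in>{..<m}. \<psi> i (\<lambda>_. y i))" for y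
  have fh: "f y = (\<Oplus>\<^bsub>M\<^esub>i\<in>{..<m}. h y i)" if "y \<in> carrier ?S" for y
    unfolding f_def h_def using hM[OF that] by (intro M.finsum_cong') auto
  have hom: "restrict f (carrier ?S) \<in> mod_hom (Lambda n) ?S M"
  proof (rule mod_homI_restrict[OF left_module_std])
    show "f y \<in> carrier M" if "y \<in> carrier ?S" for y
      unfolding f_def using hM[OF that] by (intro M.finsum_closed) auto
    show "f (y \<oplus>\<^bsub>?S\<^esub> z) = f y \<oplus>\<^bsub>M\<^esub> f z" if y: "y \<in> carrier ?S" and z: "z \<in> carrier ?S" for y z
    proof -
      have "\<psi> i (\<lambda>_. (y \<oplus>\<^bsub>?S\<^esub> z) i) = \<psi> i (\<lambda>_. y i) \<oplus>\<^bsub>M\<^esub> \<psi> i (\<lambda>_. z i)" if "i < m" for i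
        using mod_homD(3)[OF \<psi>(1)[OF that] c[OF y, of i] c[OF z, of i]] by (simp add: std_simps)
      then have "f (y \<oplus>\<^bsub>?S\<^esub> z) = (\<Oplus>\<^bsub>M\<^esub>i\<in>{..<m}. \<psi> i (\<lambda>_. y i) \<oplus>\<^bsub>M\<^esub> \<psi> i (\<lambda>_. z i))"
        unfolding f_def using hM[OF y] hM[OF z] by (intro M.finsum_cong') auto
      also have "\<dots> = f y \<oplus>\<^bsub>M\<^esub> f z"
        unfolding f_def using hM[OF y] hM[OF z] by (intro M.finsum_addf) auto
      finally show ?thesis .
    qed
    show "f (a \<odot>\<^bsub>?S\<^esub> y) = a \<odot>\<^bsub>M\<^esub> f y" if a: "a \<in> carrier (Lambda n)" and y: "y \<in> carrier ?S" for a y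
    proof -
      have "\<psi> i (\<lambda>_. (a \<odot>\<^bsub>?S\<^esub> y) i) = a \<odot>\<^bsub>M\<^esub> \<psi> i (\<lambda>_. y i)" if "i < m" for i
      proof -
        have "(\<lambda>_. (a \<odot>\<^bsub>?S\<^esub> y) i) = a \<odot>\<^bsub>?C i\<^esub> (\<lambda>_. y i)"
          using that by (auto simp: std_simps fun_eq_iff)
        then show ?thesis using mod_homD(4)[OF \<psi>(1)[OF that] a c[OF y, of i]] by simp
      qed
      then have "f (a \<odot>\<^bsub>?S\<^esub> y) = (\<Oplus>\<^bsub>M\<^esub>i\<in>{..<m}. a \<odot>\<^bsub>M\<^esub> \<psi> i (\<lambda>_. y i))"
        unfolding f_def using hM[OF y] a by (intro M.finsum_cong') auto
      also have "\<dots> = a \<odot>\<^bsub>M\<^esub> f y"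
        unfolding f_def using hM[OF y] a by (intro M.finsum_smult[symmetric]) auto
      finally show ?thesis .
    qed
  qed
  have "bij_betw h (carrier ?S) (\<Pi>\<^sub>E i\<in>{..<m}. N i)"
    unfolding bij_betw_def
  proof
    show "inj_on h (carrier ?S)"
    proof (rule inj_onI)
      fix y z assume y: "y \<in> carrier ?S" and z: "z \<in> carrier ?S" and eq: "h y = h z"
      have "y i = z i" for i
      proof (cases "i < m")
        case True
        then have "\<psi> i (\<lambda>_. y i) = \<psi> i (\<lambda>_. z i)" using fun_cong[OF eq, of i] by (simp add: h_def)
        then have "(\<lambda>_ :: unit. y i) = (\<lambda>_. z i)"
          using \<psi>(2)[OF True] c[OF y, of i] c[OF z, of i] unfolding bij_betw_def inj_on_def by blast
        then show ?thesis by (rule fun_cong)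
      next
        case False
        then show ?thesis using std_out[OF y, of i] std_out[OF z, of i] by (auto simp: fun_eq_iff)
      qed
      then show "y = z" by (rule ext)
    qed
    show "h ` carrier ?S = (\<Pi>\<^sub>E i\<in>{..<m}. N i)"
    proof
      show "h ` carrier ?S \<subseteq> (\<Pi>\<^sub>E i\<in>{..<m}. N i)" using hN by (intro image_subsetI) (simp add: h_def restrict_PiE_iff)
      show "(\<Pi>\<^sub>E i\<in>{..<m}. N i) \<subseteq> h ` carrier ?S"
      proof
        fix x assume x: "x \<in> (\<Pi>\<^sub>E i\<in>{..<m}. N i)"
        have "\<exists>z\<in>carrier (?C i). \<psi> i z = x i" if "i < m" for i
          using \<psi>(2)[OF that] PiE_mem[OF x, of i] that unfolding bij_betw_def by force
        then obtain z where z: "\<And>i. i < m \<Longrightarrow> z i \<in> carrier (?C i)" "\<And>i. i < m \<Longrightarrow> \<psi> i (z i) = x i" by metis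
        define y where "y = (\<lambda>i k. if i < m then z i () k else 0)"
        have "y \<in> carrier ?S" using std_out[OF z(1)] by (auto simp: y_def std_simps(1))
        moreover have "h y i = x i" for i
        proof (cases "i < m")
          case True
          then have "(\<lambda>_. y i) = z i" by (auto simp: y_def)
          then show ?thesis using True z(2) by (simp add: h_def)
        next
          case False
          then show ?thesis using PiE_arb[OF x, of i] by (simp add: h_def)
        qed
        ultimately show "x \<in> h ` carrier ?S" by (metis ext image_eqI)
      qed
    qed
  qed
  from bij_betw_trans[OF this bij] have "bij_betw (\<lambda>y. \<Oplus>\<^bsub>M\<^esub>i\<in>{..<m}. h y i) (carrier ?S) (carrier M)"
    by (simp add: o_def)
  then have "bij_betw (restrict f (carrier ?S)) (carrier ?S) (carrier M)"
    using fh by (simp cong: bij_betw_cong)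
  then have "mod_iso (Lambda n) ?S M" unfolding mod_iso_def using hom by blast
  with s show thesis by (rule that)
qed

text \<open>\<open>N i\<close> is the image of the coordinate block \<open>i\<close>. Bijectivity of
  the sum map is checked after applying \<open>g\<close>, because block \<open>t\<close> of the
  image of a sum comes from its term \<open>x t\<close> alone.\<close>

lemma indec_decomp_of_std_iso:
  fixes M :: "('k::field mat, 'v) module"
  assumes M: "left_module (Lambda n) M" and iso: "mod_iso (Lambda n) (std n {..<m} s) M"
    and valid: "\<And>i. i < m \<Longrightarrow> fst (s i) + snd (s i) < n"
  obtains N where "indec_decomp (Lambda n) M m N"
    "\<And>i. i < m \<Longrightarrow> mod_iso (Lambda n) (std n {()} (\<lambda>_. s i)) (M\<lparr>carrier := N i\<rparr>)"
proof -
  interpret M: left_module "Lambda n" M by fact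
  let ?S = "std n {..<m} s :: ('k mat, _) module"
  let ?C = "\<lambda>i. std n {()} (\<lambda>_. s i) :: ('k mat, unit \<Rightarrow> nat \<Rightarrow> 'k) module"
  obtain f g where f: "f \<in> mod_hom (Lambda n) ?S M" and g: "g \<in> mod_hom (Lambda n) M ?S"
    and gf: "\<And>x. x \<in> carrier ?S \<Longrightarrow> g (f x) = x" and fg: "\<And>y. y \<in> carrier M \<Longrightarrow> f (g y) = y"
    by (rule mod_isoE[OF left_module_std iso]) blast
  define j where "j i = (\<lambda>(x :: unit \<Rightarrow> nat \<Rightarrow> 'k) t k. if t = i then x () k else 0)" for i :: nat
  have j: "restrict (j i) (carrier (?C i)) \<in> mod_hom (Lambda n) (?C i) ?S" if "i < m" for i
    by (rule mod_homI_restrict[OF left_module_std]) (use that in \<open>auto simp: j_def std_simps fun_eq_iff\<close>)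
  have jc: "j i x \<in> carrier ?S" if "i < m" "x \<in> carrier (?C i)" for i x
    using mod_homD(1)[OF j[OF that(1)] that(2)] that(2) by simp
  define N where "N i = compose (carrier (?C i)) f (restrict (j i) (carrier (?C i))) ` carrier (?C i)" for i
  have N: "N i = f ` j i ` carrier (?C i)" for i
    by (auto simp: N_def compose_def image_image)
  have k: "compose (carrier (?C i)) f (restrict (j i) (carrier (?C i))) \<in> mod_hom (Lambda n) (?C i) M" if "i < m" for i
    by (rule mod_hom_compose[OF left_module_std j[OF that] f])
  have sub: "submodule (N i) (Lambda n) M" if "i < m" for i
    unfolding N_def
    by (rule submodule_image[OF left_module_std M k[OF that] left_module.submodule_carrier[OF left_module_std]])
  have Niso: "mod_iso (Lambda n) (?C i) (M\<lparr>carrier := N i\<rparr>)" if i: "i < m" for i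
    unfolding mod_iso_def
  proof (rule bexI)
    let ?k = "compose (carrier (?C i)) f (restrict (j i) (carrier (?C i)))"
    show "?k \<in> mod_hom (Lambda n) (?C i) (M\<lparr>carrier := N i\<rparr>)"
      by (rule mod_homI) (use mod_homD[OF k[OF i]] in \<open>auto simp: N_def\<close>)
    have "inj_on ?k (carrier (?C i))"
    proof (rule inj_onI)
      fix x y assume x: "x \<in> carrier (?C i)" and y: "y \<in> carrier (?C i)" and "?k x = ?k y"
      then have "f (j i x) = f (j i y)" by (simp add: compose_def)
      then have "g (f (j i x)) = g (f (j i y))" by (rule arg_cong)
      then have "j i x = j i y" unfolding gf[OF jc[OF i x]] gf[OF jc[OF i y]] .
      then have "j i x i k = j i y i k" for k by (simp only:)
      then show "x = y" by (auto simp: j_def fun_eq_iff)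
    qed
    then show "bij_betw ?k (carrier (?C i)) (carrier (M\<lparr>carrier := N i\<rparr>))"
      by (simp add: bij_betw_def N_def)
  qed
  have NM: "x \<in> carrier M" if "i < m" "x \<in> N i" for i x
    using submodule_closed(1)[OF sub[OF that(1)] that(2)] .
  have gN: "g x t k = 0" if "i < m" "x \<in> N i" "t \<noteq> i" for i x t k
  proof -
    obtain y where "y \<in> carrier (?C i)" "x = f (j i y)" using \<open>x \<in> N i\<close> unfolding N by blast
    then have "g x = j i y" using gf jc \<open>i < m\<close> by simp
    then show ?thesis using \<open>t \<noteq> i\<close> by (simp add: j_def)
  qed
  have gsum: "g (\<Oplus>\<^bsub>M\<^esub>i\<in>{..<m}. x i) t k = g (x t) t k"
    if x: "x \<in> (\<Pi>\<^sub>E i\<in>{..<m}. N i)" and t: "t < m" for x t k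
  proof -
    have xN: "x i \<in> N i" if "i < m" for i using PiE_mem[OF x] that by simp
    then have xM: "x \<in> {..<m} \<rightarrow> carrier M" using NM by blast
    have "g (\<Oplus>\<^bsub>M\<^esub>i\<in>{..<m}. x i) = (\<Oplus>\<^bsub>?S\<^esub>i\<in>{..<m}. g (x i))"
      using mod_hom_finsum[OF M left_module_std g _ xM] by simp
    also have "\<dots> = (\<lambda>t k. \<Sum>i<m. g (x i) t k)"
      using xM mod_homD(1)[OF g] by (intro finsum_std) auto
    finally have "g (\<Oplus>\<^bsub>M\<^esub>i\<in>{..<m}. x i) t k = (\<Sum>i<m. g (x i) t k)" by simp
    also have "\<dots> = (\<Sum>i<m. if i = t then g (x t) t k else 0)"
      using gN xN by (intro sum.cong) auto
    finally show ?thesis using t by simp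
  qed
  have "bij_betw (\<lambda>x. \<Oplus>\<^bsub>M\<^esub>i\<in>{..<m}. x i) (\<Pi>\<^sub>E i\<in>{..<m}. N i) (carrier M)"
    unfolding bij_betw_def
  proof
    show "inj_on (\<lambda>x. \<Oplus>\<^bsub>M\<^esub>i\<in>{..<m}. x i) (\<Pi>\<^sub>E i\<in>{..<m}. N i)"
    proof (rule inj_onI)
      fix x y assume x: "x \<in> (\<Pi>\<^sub>E i\<in>{..<m}. N i)" and y: "y \<in> (\<Pi>\<^sub>E i\<in>{..<m}. N i)"
        and eq: "(\<Oplus>\<^bsub>M\<^esub>i\<in>{..<m}. x i) = (\<Oplus>\<^bsub>M\<^esub>i\<in>{..<m}. y i)"
      show "x = y"
      proof (rule PiE_ext[OF x y])
        fix i assume "i \<in> {..<m}"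
        then have i: "i < m" by simp
        have xi: "x i \<in> N i" and yi: "y i \<in> N i" using PiE_mem[OF x] PiE_mem[OF y] i by auto
        have "g (x i) t k = g (y i) t k" for t k
        proof (cases "t = i")
          case True
          then show ?thesis using gsum[OF x i, of k] gsum[OF y i, of k] eq by simp
        next
          case False
          then show ?thesis using gN[OF i xi] gN[OF i yi] by simp
        qed
        then have "g (x i) = g (y i)" by (intro ext)
        then have "f (g (x i)) = f (g (y i))" by (rule arg_cong)
        then show "x i = y i" unfolding fg[OF NM[OF i xi]] fg[OF NM[OF i yi]] .
      qed
    qed
    show "(\<lambda>x. \<Oplus>\<^bsub>M\<^esub>i\<in>{..<m}. x i) ` (\<Pi>\<^sub>E i\<in>{..<m}. N i) = carrier M"
    proof
      show "(\<lambda>x. \<Oplus>\<^bsub>M\<^esub>i\<in>{..<m}. x i) ` (\<Pi>\<^sub>E i\<in>{..<m}. N i) \<subseteq> carrier M"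
      proof (rule image_subsetI)
        fix x assume "x \<in> (\<Pi>\<^sub>E i\<in>{..<m}. N i)"
        then have "x i \<in> carrier M" if "i < m" for i using NM[OF that] PiE_mem[of x "{..<m}" N i] that by simp
        then show "(\<Oplus>\<^bsub>M\<^esub>i\<in>{..<m}. x i) \<in> carrier M" by (intro M.finsum_closed) auto
      qed
      show "carrier M \<subseteq> (\<lambda>x. \<Oplus>\<^bsub>M\<^esub>i\<in>{..<m}. x i) ` (\<Pi>\<^sub>E i\<in>{..<m}. N i)"
      proof
        fix z assume z: "z \<in> carrier M"
        note gz = mod_homD(1)[OF g z]
        have c: "(\<lambda>_. g z i) \<in> carrier (?C i)" for i using gz by (auto simp: std_simps)
        define x where "x = (\<lambda>i\<in>{..<m}. f (j i (\<lambda>_. g z i)))"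
        have x: "x \<in> (\<Pi>\<^sub>E i\<in>{..<m}. N i)" using c unfolding x_def N restrict_PiE_iff by blast
        have sM: "(\<Oplus>\<^bsub>M\<^esub>i\<in>{..<m}. x i) \<in> carrier M"
        proof -
          have "x i \<in> carrier M" if "i < m" for i using NM[OF that] PiE_mem[OF x, of i] that by simp
          then show ?thesis by (intro M.finsum_closed) auto
        qed
        have "g (\<Oplus>\<^bsub>M\<^esub>i\<in>{..<m}. x i) t k = g z t k" for t k
        proof (cases "t < m")
          case True
          have "g (\<Oplus>\<^bsub>M\<^esub>i\<in>{..<m}. x i) t k = g (x t) t k" by (rule gsum[OF x True])
          also have "g (x t) = j t (\<lambda>_. g z t)" using True gf[OF jc[OF True c]] by (simp add: x_def)
          finally show ?thesis by (simp add: j_def)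
        next
          case False
          then show ?thesis using std_out[OF gz, of t k] std_out[OF mod_homD(1)[OF g sM], of t k] by simp
        qed
        then have "g (\<Oplus>\<^bsub>M\<^esub>i\<in>{..<m}. x i) = g z" by (intro ext)
        then have "f (g z) = f (g (\<Oplus>\<^bsub>M\<^esub>i\<in>{..<m}. x i))" by simp
        then have "z = (\<Oplus>\<^bsub>M\<^esub>i\<in>{..<m}. x i)" unfolding fg[OF z] fg[OF sM] .
        then show "z \<in> (\<lambda>x. \<Oplus>\<^bsub>M\<^esub>i\<in>{..<m}. x i) ` (\<Pi>\<^sub>E i\<in>{..<m}. N i)" using x by (rule image_eqI)
      qed
    qed
  qed
  moreover have "indecomposable (Lambda n) (M\<lparr>carrier := N i\<rparr>)" if "i < m" for i
    by (rule indecomposable_of_iso_std[OF M.left_module_submodule[OF sub[OF that]] Niso[OF that] valid[OF that]])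
  ultimately have "indec_decomp (Lambda n) M m N" using sub by (simp add: indec_decomp_def)
  then show thesis using Niso by (rule that)
qed

text \<open>\<open>fb_modules\<close> has vectors as elements, whereas \<open>std\<close> consists
  of functions. An injection of the carrier carries the module structure over.\<close>

lemma left_module_transport:
  fixes N :: "('a, 'v) module" and h :: "'v \<Rightarrow> 'w"
  assumes N: "left_module R N" and inj: "inj_on h (carrier N)"
  obtains M :: "('a, 'w) module" where "left_module R M" "mod_iso R N M"
proof -
  interpret N: left_module R N by fact
  define g where "g = inv_into (carrier N) h"
  have gh: "g (h x) = x" if "x \<in> carrier N" for x using inj that by (simp add: g_def)
  define M :: "('a, 'w) module" where "M = \<lparr>carrier = h ` carrier N, monoid.mult = undefined, one = undefined, zero = h \<zero>\<^bsub>N\<^esub>,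
    add = (\<lambda>x y. h (g x \<oplus>\<^bsub>N\<^esub> g y)), smult = (\<lambda>a x. h (a \<odot>\<^bsub>N\<^esub> g x))\<rparr>"
  have s: "carrier M = h ` carrier N" "zero M = h \<zero>\<^bsub>N\<^esub>" "add M = (\<lambda>x y. h (g x \<oplus>\<^bsub>N\<^esub> g y))"
    "smult M = (\<lambda>a x. h (a \<odot>\<^bsub>N\<^esub> g x))" by (simp_all add: M_def)
  have M: "left_module R M"
  proof (intro left_module.intro left_module_axioms.intro N.R.ring_axioms)
    show "abelian_group M"
    proof (rule abelian_groupI)
      fix x assume "x \<in> carrier M"
      then obtain y where y: "y \<in> carrier N" "x = h y" by (auto simp: s)
      then have "h (\<ominus>\<^bsub>N\<^esub> y) \<in> carrier M \<and> h (\<ominus>\<^bsub>N\<^esub> y) \<oplus>\<^bsub>M\<^esub> x = \<zero>\<^bsub>M\<^esub>"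
        by (simp add: s gh N.M.l_neg)
      then show "\<exists>y\<in>carrier M. y \<oplus>\<^bsub>M\<^esub> x = \<zero>\<^bsub>M\<^esub>" by blast
    qed (auto simp: s gh N.M.add.m_ac)
  qed (auto simp: s gh N.smult_l_distr N.smult_r_distr N.smult_assoc1)
  have "restrict h (carrier N) \<in> mod_hom R N M"
    by (rule mod_homI_restrict[OF N]) (auto simp: s gh)
  moreover have "bij_betw (restrict h (carrier N)) (carrier N) (carrier M)"
    using inj by (auto simp: s bij_betw_def inj_on_def)
  ultimately have "mod_iso R N M" unfolding mod_iso_def by blast
  with M show thesis by (rule that)
qed

text \<open>The coordinates in the finitely many positions with index in \<open>T\<close> and vertex
  below \<open>n\<close> are listed in one vector. They determine an element of \<open>std\<close>,
  which vanishes elsewhere.\<close>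

lemma std_vec_model:
  assumes "finite T"
  obtains M :: "('k::field mat, 'k vec) module" where "left_module (Lambda n) M"
    "mod_iso (Lambda n) (std n T s) M"
proof -
  let ?S = "std n T s :: ('k mat, _) module"
  obtain e where e: "bij_betw e {0..<card (T \<times> {..<n})} (T \<times> {..<n})"
    using ex_bij_betw_nat_finite[of "T \<times> {..<n}"] assms by auto
  define h where "h x = vec (card (T \<times> {..<n})) (\<lambda>i. x (fst (e i)) (snd (e i)))" for x :: "_ \<Rightarrow> nat \<Rightarrow> 'k"
  have "inj_on h (carrier ?S)"
  proof (rule inj_onI, intro ext)
    fix x y t k assume x: "x \<in> carrier ?S" and y: "y \<in> carrier ?S" and eq: "h x = h y"
    show "x t k = y t k"
    proof (cases "t \<in> T \<and> k < n")
      case True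
      then have "(t, k) \<in> e ` {0..<card (T \<times> {..<n})}" using e by (auto simp: bij_betw_def)
      then obtain i where "i < card (T \<times> {..<n})" "e i = (t, k)" by auto
      then show ?thesis using arg_cong[OF eq, of "\<lambda>v. v $ i"] by (simp add: h_def)
    next
      case False
      then have "\<not> (t \<in> T \<and> k \<in> supp n (s t))" by (auto dest: supp_less)
      then show ?thesis using std_out[OF x] std_out[OF y] by simp
    qed
  qed
  from left_module_transport[OF left_module_std this] that show thesis by blast
qed

text \<open>The images of the coordinate vectors generate, with diagonal matrix units as
  coefficients. As \<open>fin_gen\<close> sums over a set, \<open>h\<close> has to be injective for
  each coordinate to keep a coefficient of its own.\<close>

lemma fin_gen_of_std_iso:
  fixes M :: "('k::field mat, 'v) module"
  assumes M: "left_module (Lambda n) M" and iso: "mod_iso (Lambda n) (std n T s) M" and fin: "finite T"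
  shows "fin_gen (Lambda n) M"
proof -
  interpret M: left_module "Lambda n" M by fact
  let ?S = "std n T s :: ('k mat, _) module"
  obtain f where f: "f \<in> mod_hom (Lambda n) ?S M" "bij_betw f (carrier ?S) (carrier M)"
    using iso by (auto simp: mod_iso_def)
  define I where "I = Sigma T (\<lambda>t. supp n (s t))"
  have finI: "finite I" unfolding I_def
    using fin by (intro finite_SigmaI finite_subset[of "supp n _" "{..<n}"]) (auto simp: supp_def)
  define h where "h = (\<lambda>(t, k). f (eps t k))"
  have ec: "eps t k \<in> carrier ?S" if "(t, k) \<in> I" for t k using that by (auto simp: I_def intro: eps_carrier)
  have inj: "inj_on h I"
  proof (rule inj_onI)
    fix a b assume ab: "a \<in> I" "b \<in> I" "h a = h b"
    obtain t k u l where tk: "a = (t, k)" "b = (u, l)" by force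
    have "eps t k = (eps u l :: _ \<Rightarrow> _ \<Rightarrow> 'k)"
      using ab ec f(2) unfolding tk h_def bij_betw_def inj_on_def by auto
    then have "eps u l t k = (1 :: 'k)" by (metis eps_def)
    then show "a = b" by (auto simp: eps_def tk split: if_splits)
  qed
  have hM: "h i \<in> carrier M" if "i \<in> I" for i
    using that mod_homD(1)[OF f(1)] ec by (auto simp: h_def split: prod.split)
  show ?thesis unfolding fin_gen_def
  proof (intro exI[of _ "h ` I"] conjI ballI)
    show "finite (h ` I)" using finI by simp
    show "h ` I \<subseteq> carrier M" using hM by auto
    fix x assume "x \<in> carrier M"
    then obtain y where y: "y \<in> carrier ?S" "x = f y" using f(2) by (auto simp: bij_betw_def)
    define c where "c = (\<lambda>(t, k). mu n k k (y t k))"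
    have c: "c i \<in> carrier (Lambda n)" for i by (auto simp: c_def mu_Lambda split: prod.split)
    have t: "(case i of (t, k) \<Rightarrow> c i \<odot>\<^bsub>?S\<^esub> eps t k) = (\<lambda>u l. if i = (u, l) then y u l else 0)" if "i \<in> I" for i
      using that by (auto simp: c_def I_def eps_def mu_smult_std supp_less fun_eq_iff split: prod.split)
    have cc: "c (t, k) \<odot>\<^bsub>?S\<^esub> eps t k \<in> carrier ?S" if "(t, k) \<in> I" for t k
      by (rule left_module.smult_closed[OF left_module_std c ec[OF that]])
    have "y = (\<Oplus>\<^bsub>?S\<^esub>i\<in>I. case i of (t, k) \<Rightarrow> c i \<odot>\<^bsub>?S\<^esub> eps t k)"
    proof -
      have "(\<Oplus>\<^bsub>?S\<^esub>i\<in>I. case i of (t, k) \<Rightarrow> c i \<odot>\<^bsub>?S\<^esub> eps t k) =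
          (\<lambda>u l. \<Sum>i\<in>I. (case i of (t, k) \<Rightarrow> c i \<odot>\<^bsub>?S\<^esub> eps t k) u l)"
        using finI cc by (intro finsum_std) auto
      also have "\<dots> = (\<lambda>u l. \<Sum>i\<in>I. if i = (u, l) then y u l else 0)"
        using t by (intro ext sum.cong) auto
      also have "\<dots> = y"
        using finI std_out[OF y(1)] by (auto simp: fun_eq_iff I_def)
      finally show ?thesis by simp
    qed
    then have "x = f (\<Oplus>\<^bsub>?S\<^esub>i\<in>I. case i of (t, k) \<Rightarrow> c i \<odot>\<^bsub>?S\<^esub> eps t k)" using y(2) by simp
    also have "\<dots> = (\<Oplus>\<^bsub>M\<^esub>i\<in>I. f (case i of (t, k) \<Rightarrow> c i \<odot>\<^bsub>?S\<^esub> eps t k))"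
      using finI cc
      by (intro mod_hom_finsum[OF left_module_std M f(1)]) auto
    also have "\<dots> = (\<Oplus>\<^bsub>M\<^esub>i\<in>I. c i \<odot>\<^bsub>M\<^esub> h i)"
      using c ec hM mod_homD(4)[OF f(1)] by (intro M.finsum_cong') (auto simp: h_def)
    also have "\<dots> = (\<Oplus>\<^bsub>M\<^esub>i\<in>I. c (inv_into I h (h i)) \<odot>\<^bsub>M\<^esub> h i)"
      using c hM inj by (intro M.finsum_cong') auto
    also have "\<dots> = (\<Oplus>\<^bsub>M\<^esub>b\<in>h ` I. c (inv_into I h b) \<odot>\<^bsub>M\<^esub> b)"
      using c hM inj by (intro M.finsum_reindex[symmetric]) auto
    finally show "\<exists>r\<in>h ` I \<rightarrow> carrier (Lambda n). x = (\<Oplus>\<^bsub>M\<^esub>b\<in>h ` I. r b \<odot>\<^bsub>M\<^esub> b)"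
      using c by (intro bexI[of _ "\<lambda>b. c (inv_into I h b)"]) auto
  qed
qed

section \<open>Fillings and tree-like tableaux\<close>

definition rank :: "nat set \<Rightarrow> nat \<Rightarrow> nat" where
  "rank S x = card {y \<in> S. y < x}"

lemma rank_less_iff:
  assumes "finite S" "x \<in> S" "y \<in> S"
  shows "rank S x < rank S y \<longleftrightarrow> x < y"
proof -
  have less: "rank S u < rank S v" if "u \<in> S" "u < v" for u v
    unfolding rank_def using that assms(1) by (intro psubset_card_mono) auto
  show ?thesis using less[OF assms(2), of y] less[OF assms(3), of x] by (metis less_irrefl linorder_less_linear order.asym)
qed

lemma rank_eq_iff:
  assumes "finite S" "x \<in> S" "y \<in> S"
  shows "rank S x = rank S y \<longleftrightarrow> x = y"
  using rank_less_iff[OF assms] rank_less_iff[OF assms(1,3,2)] by (metis less_irrefl linorder_less_linear)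

lemma rank_image:
  assumes "finite S" shows "rank S ` S = {..<card S}"
proof (rule card_subset_eq)
  show "rank S ` S \<subseteq> {..<card S}"
    using assms unfolding rank_def by (auto intro!: psubset_card_mono)
  have "inj_on (rank S) S" by (rule inj_onI) (simp add: rank_eq_iff assms)
  then show "card (rank S ` S) = card {..<card S}" by (simp add: card_image)
qed simp

text \<open>The rank inverts an increasing enumeration, so shrinking undoes spreading out rows or
  columns.\<close>

lemma rank_strict_mono_image:
  assumes "strict_mono_on {..<a} \<rho>" "i < a"
  shows "rank (\<rho> ` {..<a}) (\<rho> i) = i"
proof -
  have "{y \<in> \<rho> ` {..<a}. y < \<rho> i} = \<rho> ` {..<i}"
    using strict_mono_on_less[OF assms(1)] assms(2) by auto
  moreover have "inj_on \<rho> {..<i}"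
    by (rule inj_on_subset[OF strict_mono_on_imp_inj_on[OF assms(1)]]) (use assms(2) in auto)
  ultimately show ?thesis by (simp add: rank_def card_image)
qed

lemma shrink_eq:
  "shrink (D, P) =
    ((\<lambda>(r, c). (rank (fst ` P) r, rank (snd ` P) c)) ` (D \<inter> fst ` P \<times> snd ` P),
     (\<lambda>(r, c). (rank (fst ` P) r, rank (snd ` P) c)) ` P)"
  by (simp add: shrink_def rank_def Let_def)

text \<open>The leftmost pointed cells of the rows and the topmost pointed cells of the columns have only
  the origin in common.\<close>

lemma card_rows_columns:
  fixes P :: "(nat \<times> nat) set"
  assumes fin: "finite P" and root: "(0, 0) \<in> P"
    and or: "\<And>r c. (r, c) \<in> P \<Longrightarrow> (r, c) \<noteq> (0, 0) \<Longrightarrow> (\<exists>r'<r. (r', c) \<in> P) \<or> (\<exists>c'<c. (r, c') \<in> P)"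
  shows "card (fst ` P) + card (snd ` P) \<le> card P + 1"
    and "card (fst ` P) + card (snd ` P) = card P + 1 \<longleftrightarrow>
      (\<forall>r c. (r, c) \<in> P \<longrightarrow> \<not> ((\<exists>r'<r. (r', c) \<in> P) \<and> (\<exists>c'<c. (r, c') \<in> P)))"
proof -
  define L where "L = {(r, c). (r, c) \<in> P \<and> \<not> (\<exists>c'<c. (r, c') \<in> P)}"
  define U where "U = {(r, c). (r, c) \<in> P \<and> \<not> (\<exists>r'<r. (r', c) \<in> P)}"
  have LP: "L \<subseteq> P" and UP: "U \<subseteq> P" by (auto simp: L_def U_def)
  have "bij_betw fst L (fst ` P)"
    unfolding bij_betw_def
  proof
    show "inj_on fst L"
      by (rule inj_onI) (auto simp: L_def, metis linorder_less_linear)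
    have "r \<in> fst ` L" if "(r, c) \<in> P" for r c
    proof -
      obtain m where "(r, m) \<in> P" "\<forall>c'<m. (r, c') \<notin> P"
        using exists_least_iff[of "\<lambda>c. (r, c) \<in> P"] \<open>(r, c) \<in> P\<close> by blast
      then have "(r, m) \<in> L" by (simp add: L_def)
      then show ?thesis by force
    qed
    then show "fst ` L = fst ` P" using LP by auto
  qed
  then have cL: "card L = card (fst ` P)" by (rule bij_betw_same_card)
  have "bij_betw snd U (snd ` P)"
    unfolding bij_betw_def
  proof
    show "inj_on snd U"
      by (rule inj_onI) (auto simp: U_def, metis linorder_less_linear)
    have "c \<in> snd ` U" if "(r, c) \<in> P" for r c
    proof -
      obtain m where "(m, c) \<in> P" "\<forall>r'<m. (r', c) \<notin> P"
        using exists_least_iff[of "\<lambda>r. (r, c) \<in> P"] \<open>(r, c) \<in> P\<close> by blast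
      then have "(m, c) \<in> U" by (simp add: U_def)
      then show ?thesis by force
    qed
    then show "snd ` U = snd ` P" using UP by auto
  qed
  then have cU: "card U = card (snd ` P)" by (rule bij_betw_same_card)
  have fL: "finite L" and fU: "finite U" using LP UP fin finite_subset by blast+
  have LU: "L \<inter> U = {(0, 0)}"
  proof
    show "L \<inter> U \<subseteq> {(0, 0)}"
    proof
      fix x assume x: "x \<in> L \<inter> U"
      obtain r c where rc: "x = (r, c)" by force
      show "x \<in> {(0, 0)}" using x or[of r c] unfolding rc L_def U_def by blast
    qed
    show "{(0, 0)} \<subseteq> L \<inter> U" using root by (simp add: L_def U_def)
  qed
  have eq: "card (fst ` P) + card (snd ` P) = card (L \<union> U) + 1"
    using card_Un_Int[OF fL fU] unfolding cL cU LU by simp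
  have le: "card (L \<union> U) \<le> card P" using LP UP fin by (intro card_mono) auto
  show "card (fst ` P) + card (snd ` P) \<le> card P + 1" using eq le by simp
  have "card (fst ` P) + card (snd ` P) = card P + 1 \<longleftrightarrow> card (L \<union> U) = card P" using eq by simp
  also have "\<dots> \<longleftrightarrow> L \<union> U = P" using card_subset_eq[OF fin, of "L \<union> U"] LP UP by auto
  also have "\<dots> \<longleftrightarrow> (\<forall>r c. (r, c) \<in> P \<longrightarrow> (r, c) \<in> L \<union> U)" using LP UP by auto
  also have "\<dots> \<longleftrightarrow> (\<forall>r c. (r, c) \<in> P \<longrightarrow> \<not> ((\<exists>r'<r. (r', c) \<in> P) \<and> (\<exists>c'<c. (r, c') \<in> P)))"
    unfolding L_def U_def by blast
  finally show "card (fst ` P) + card (snd ` P) = card P + 1 \<longleftrightarrow>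
      (\<forall>r c. (r, c) \<in> P \<longrightarrow> \<not> ((\<exists>r'<r. (r', c) \<in> P) \<and> (\<exists>c'<c. (r, c') \<in> P)))" .
qed

text \<open>Row \<open>b\<close> and column \<open>n - b\<close> meet just outside the staircase. Hence the index of a
  row is determined by its rank among the nonempty rows and by its length in the shrunk diagram.\<close>

lemma row_length_rank:
  assumes R: "R \<subseteq> {..<n}" and C: "C \<subseteq> {..<n}" and 0: "0 \<in> R"
    and ex: "\<And>x. 0 < x \<Longrightarrow> x < n \<Longrightarrow> x \<in> R \<longleftrightarrow> n - x \<notin> C" and r: "r \<in> R"
  shows "card {c \<in> C. r + c < n} + r = card C + rank R r"
proof -
  have finC: "finite C" using C finite_subset by blast
  have rn: "r < n" using r R by auto
  \<comment> \<open>A kept column that row \<open>r\<close> does not reach is paired with the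
    deleted row above \<open>r\<close> that meets it just outside the staircase.\<close>
  have "bij_betw (\<lambda>x. n - x) {x. x < r \<and> x \<notin> R} {c \<in> C. \<not> r + c < n}"
  proof (rule bij_betw_byWitness[where f' = "\<lambda>x. n - x"])
    show "(\<lambda>x. n - x) ` {x. x < r \<and> x \<notin> R} \<subseteq> {c \<in> C. \<not> r + c < n}"
    proof (rule image_subsetI)
      fix x assume "x \<in> {x. x < r \<and> x \<notin> R}"
      then have x: "x < r" "x \<notin> R" by auto
      then have "0 < x" using 0 by (cases x) auto
      then show "n - x \<in> {c \<in> C. \<not> r + c < n}" using ex[of x] x rn by auto
    qed
    show "(\<lambda>x. n - x) ` {c \<in> C. \<not> r + c < n} \<subseteq> {x. x < r \<and> x \<notin> R}"
    proof (rule image_subsetI)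
      fix c assume "c \<in> {c \<in> C. \<not> r + c < n}"
      then have c: "c \<in> C" "n \<le> r + c" "c < n" using C by auto
      then have "n - c \<notin> R" using ex[of "n - c"] rn by auto
      then have "n - c \<noteq> r" using r by auto
      then show "n - c \<in> {x. x < r \<and> x \<notin> R}" using c \<open>n - c \<notin> R\<close> by auto
    qed
  qed (use rn C in auto)
  then have w: "card {c \<in> C. \<not> r + c < n} = card {x. x < r \<and> x \<notin> R}" by (simp add: bij_betw_same_card)
  have "C = {c \<in> C. r + c < n} \<union> {c \<in> C. \<not> r + c < n}" by auto
  then have "card C = card {c \<in> C. r + c < n} + card {c \<in> C. \<not> r + c < n}"
    using finC by (metis (no_types, lifting) card_Un_disjoint disjoint_iff finite_Un mem_Collect_eq)
  moreover have "r = rank R r + card {x. x < r \<and> x \<notin> R}"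
  proof -
    have "{..<r} = {x \<in> R. x < r} \<union> {x. x < r \<and> x \<notin> R}" by auto
    then have "card {..<r} = card ({x \<in> R. x < r} \<union> {x. x < r \<and> x \<notin> R})" by (rule arg_cong)
    also have "\<dots> = rank R r + card {x. x < r \<and> x \<notin> R}"
      unfolding rank_def by (rule card_Un_disjoint) auto
    finally show ?thesis by simp
  qed
  ultimately show ?thesis using w by simp
qed

text \<open>The inverse of the map from fillings to tree-like tableaux. The row \<open>r\<close> of the tableau moves
  down by the number of columns that it does not meet, and likewise for the columns.\<close>

definition unshrink :: "pointed_diagram \<Rightarrow> (nat \<times> nat) set" where
  "unshrink T = (case T of (D, Q) \<Rightarrow>
    (\<lambda>(r, c). (card (snd ` Q) + r - card {c'. (r, c') \<in> D}, card (fst ` Q) + c - card {r'. (r', c) \<in> D})) ` Q)"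

section \<open>From fillings to tree-like tableaux\<close>

locale fb_n_filling =
  fixes n :: nat and P :: "(nat \<times> nat) set"
  assumes sub: "P \<subseteq> staircase n" and fb: "fb_filling n P" and card: "card P = n"
begin

abbreviation "R \<equiv> fst ` P"
abbreviation "C \<equiv> snd ` P"
abbreviation "pos \<equiv> \<lambda>(r, c). (rank R r, rank C c)"

lemma fin: "finite P" using finite_subset[OF sub finite_staircase] .
lemma finR: "finite R" and finC: "finite C" using fin by auto

lemma R_sub: "R \<subseteq> {..<n}" and C_sub: "C \<subseteq> {..<n}"
  using sub by (auto simp: staircase_eq)

lemma zero_R: "0 \<in> R" and zero_C: "0 \<in> C"
  using fb_fillingD(1)[OF fb] by force+

lemma counting:
  "card R + card C = n + 1" "{b. 0 < b \<and> b < n \<and> b \<in> R \<and> n - b \<in> C} = {}"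
proof -
  \<comment> \<open>The nonzero nonempty columns, reflected so that column \<open>n - b\<close> is
    recorded at \<open>b\<close>. Together with the nonzero nonempty rows they cover
    \<open>{1..<n}\<close>, and the bound of \<open>card_rows_columns\<close> leaves no room for an
    overlap.\<close>
  define C' where "C' = {b. 0 < b \<and> b < n \<and> n - b \<in> C}"
  have "bij_betw (\<lambda>b. n - b) {b. 0 < b \<and> b < n \<and> n - b \<in> X} (X - {0})" if "X \<subseteq> {..<n}" for X
    by (rule bij_betw_byWitness[where f' = "\<lambda>b. n - b"]) (use that in auto)
  from this[OF C_sub] have "bij_betw (\<lambda>b. n - b) C' (C - {0})" unfolding C'_def .
  then have cC': "card C' = card C - 1" using zero_C finC by (simp add: bij_betw_same_card)
  have cR: "card (R - {0}) = card R - 1" using zero_R finR by simp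
  have pos: "0 < card R" "0 < card C" using zero_R zero_C finR finC by (auto simp: card_gt_0_iff)
  have fC': "finite C'" by (rule finite_subset[of _ "{..<n}"]) (auto simp: C'_def)
  have un: "(R - {0}) \<union> C' = {1..<n}"
  proof
    show "(R - {0}) \<union> C' \<subseteq> {1..<n}" using R_sub by (auto simp: C'_def)
    show "{1..<n} \<subseteq> (R - {0}) \<union> C'"
    proof
      fix b assume "b \<in> {1..<n}"
      then have b: "0 < b" "b < n" by auto
      from fb_fillingD(3)[OF fb b] have "b \<in> R \<or> n - b \<in> C" by force
      then show "b \<in> (R - {0}) \<union> C'" using b by (auto simp: C'_def)
    qed
  qed
  have "card (R - {0}) + card C' = card ((R - {0}) \<union> C') + card ((R - {0}) \<inter> C')"
    by (rule card_Un_Int) (use finR fC' in auto)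
  then have sum: "card R - 1 + (card C - 1) = n - 1 + card ((R - {0}) \<inter> C')"
    unfolding un cR cC' by simp
  have "card R + card C \<le> n + 1"
    using card_rows_columns(1)[OF fin fb_fillingD(1)[OF fb] fb_fillingD(2)[OF fb]] card by simp
  moreover have "n > 0" using card fin fb_fillingD(1)[OF fb] by (auto simp: card_gt_0_iff)
  ultimately have "card R + card C = n + 1" "card ((R - {0}) \<inter> C') = 0" using sum pos by linarith+
  then show "card R + card C = n + 1" "{b. 0 < b \<and> b < n \<and> b \<in> R \<and> n - b \<in> C} = {}"
    using finR by (auto simp: C'_def)
qed

lemma exactly_one_R: "0 < x \<Longrightarrow> x < n \<Longrightarrow> x \<in> R \<longleftrightarrow> n - x \<notin> C"
proof -
  assume x: "0 < x" "x < n"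
  from fb_fillingD(3)[OF fb x] have "x \<in> R \<or> n - x \<in> C" by force
  then show ?thesis using counting(2) x by blast
qed

lemma exactly_one_C: "0 < x \<Longrightarrow> x < n \<Longrightarrow> x \<in> C \<longleftrightarrow> n - x \<notin> R"
  using exactly_one_R[of "n - x"] by simp

lemma not_both: "(r, c) \<in> P \<Longrightarrow> \<not> ((\<exists>r'<r. (r', c) \<in> P) \<and> (\<exists>c'<c. (r, c') \<in> P))"
  using card_rows_columns(2)[OF fin fb_fillingD(1)[OF fb] fb_fillingD(2)[OF fb]] counting(1) card by blast

definition "D = pos ` (staircase n \<inter> R \<times> C)"
definition "Q = pos ` P"

lemma shrink_DQ: "shrink (staircase n, P) = (D, Q)"
  by (simp add: shrink_eq D_def Q_def)

lemma PRC: "(r, c) \<in> P \<Longrightarrow> r \<in> R" "(r, c) \<in> P \<Longrightarrow> c \<in> C"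
  by force+

lemma mem_Q: "r \<in> R \<Longrightarrow> c \<in> C \<Longrightarrow> (rank R r, rank C c) \<in> Q \<longleftrightarrow> (r, c) \<in> P"
proof
  assume r: "r \<in> R" and c: "c \<in> C" and "(rank R r, rank C c) \<in> Q"
  then obtain r' c' where *: "(r', c') \<in> P" "rank R r = rank R r'" "rank C c = rank C c'" by (auto simp: Q_def)
  then show "(r, c) \<in> P" using rank_eq_iff[OF finR r PRC(1)[OF *(1)]] rank_eq_iff[OF finC c PRC(2)[OF *(1)]] by simp
qed (force simp: Q_def)

lemma mem_D: "r \<in> R \<Longrightarrow> c \<in> C \<Longrightarrow> (rank R r, rank C c) \<in> D \<longleftrightarrow> r + c < n"
proof
  assume r: "r \<in> R" and c: "c \<in> C" and "(rank R r, rank C c) \<in> D"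
  then obtain r' c' where *: "r' \<in> R" "c' \<in> C" "r' + c' < n" "rank R r = rank R r'" "rank C c = rank C c'"
    by (auto simp: D_def staircase_eq)
  then show "r + c < n" using rank_eq_iff[OF finR r *(1)] rank_eq_iff[OF finC c *(2)] by simp
next
  assume "r \<in> R" "c \<in> C" "r + c < n"
  then have "(r, c) \<in> staircase n \<inter> R \<times> C" by (simp add: staircase_eq)
  from imageI[OF this, of pos] show "(rank R r, rank C c) \<in> D" by (simp add: D_def)
qed

lemma D_cases:
  assumes "(i, j) \<in> D"
  obtains r c where "r \<in> R" "c \<in> C" "r + c < n" "i = rank R r" "j = rank C c"
  using assms that by (auto simp: D_def staircase_eq)

lemma Q_cases:
  assumes "(i, j) \<in> Q"
  obtains r c where "(r, c) \<in> P" "i = rank R r" "j = rank C c"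
  using assms that by (auto simp: Q_def)

lemma rank_zero: "rank S 0 = 0"
  by (simp add: rank_def)

text \<open>Ranks increase strictly on kept rows and columns and fill initial segments. So the
  relations above and to the left carry over, and a position above and to the left of a cell of
  \<open>D\<close> comes from a kept row and column with smaller or equal indices, hence from a cell
  of the staircase.\<close>

lemma tree_like: "tree_like_tableau (D, Q)"
  unfolding tree_like_tableau_def prod.case
proof (intro conjI ballI)
  show "young_diagram D"
    unfolding young_diagram_def
  proof (intro conjI allI impI)
    show "finite D" unfolding D_def by (intro finite_imageI finite_Int disjI1 finite_staircase)
    fix i j i' j' assume as: "(i, j) \<in> D \<and> i' \<le> i \<and> j' \<le> j"
    then obtain r c where rc: "r \<in> R" "c \<in> C" "r + c < n" "i = rank R r" "j = rank C c"
      using D_cases by blast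
    have "i' \<in> rank R ` R" "j' \<in> rank C ` C"
      using as rc imageI[OF rc(1), of "rank R"] imageI[OF rc(2), of "rank C"]
      unfolding rank_image[OF finR] rank_image[OF finC] by auto
    then obtain r' c' where r': "r' \<in> R" "i' = rank R r'" and c': "c' \<in> C" "j' = rank C c'" by blast
    have "r' \<le> r" "c' \<le> c"
      using as rank_less_iff[OF finR rc(1) r'(1)] rank_less_iff[OF finC rc(2) c'(1)] rc r' c' by (auto simp: not_less[symmetric])
    then show "(i', j') \<in> D" using rc(3) unfolding r'(2) c'(2) mem_D[OF r'(1) c'(1)] by simp
  qed
  show "Q \<subseteq> D"
  proof
    fix x assume x: "x \<in> Q"
    obtain i j where ij: "x = (i, j)" by force
    from x obtain r c where rc: "(r, c) \<in> P" "i = rank R r" "j = rank C c" unfolding ij by (rule Q_cases)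
    have "r + c < n" using rc(1) sub by (auto simp: staircase_eq)
    then show "x \<in> D" unfolding ij rc(2,3) using mem_D PRC[OF rc(1)] by simp
  qed
  show "(0, 0) \<in> Q" using mem_Q[OF zero_R zero_C] fb_fillingD(1)[OF fb] by (simp add: rank_zero)
next
  fix x assume x: "x \<in> Q"
  obtain i j where ij: "x = (i, j)" by force
  from x obtain r c where rc: "(r, c) \<in> P" "i = rank R r" "j = rank C c" unfolding ij by (rule Q_cases)
  note RC = PRC[OF rc(1)]
  have above: "(\<exists>i'<i. (i', j) \<in> Q) \<longleftrightarrow> (\<exists>r'<r. (r', c) \<in> P)"
  proof
    assume "\<exists>i'<i. (i', j) \<in> Q"
    then obtain i' where "i' < i" "(i', j) \<in> Q" by blast
    moreover from this(2) obtain r' c' where "(r', c') \<in> P" "i' = rank R r'" "j = rank C c'" by (rule Q_cases)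
    ultimately have *: "rank R r' < i" "(r', c') \<in> P" "j = rank C c'" by simp_all
    have "r' < r" using rank_less_iff[OF finR PRC(1)[OF *(2)] RC(1)] *(1) rc(2) by simp
    moreover have "c' = c" using rank_eq_iff[OF finC PRC(2)[OF *(2)] RC(2)] *(3) rc(3) by simp
    ultimately show "\<exists>r'<r. (r', c) \<in> P" using * by auto
  next
    assume "\<exists>r'<r. (r', c) \<in> P"
    then obtain r' where "r' < r" "(r', c) \<in> P" by blast
    then show "\<exists>i'<i. (i', j) \<in> Q"
      using rank_less_iff[OF finR PRC(1) RC(1)] mem_Q[OF PRC(1) RC(2)] unfolding rc(2,3) by blast
  qed
  have left: "(\<exists>j'<j. (i, j') \<in> Q) \<longleftrightarrow> (\<exists>c'<c. (r, c') \<in> P)"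
  proof
    assume "\<exists>j'<j. (i, j') \<in> Q"
    then obtain j' where "j' < j" "(i, j') \<in> Q" by blast
    moreover from this(2) obtain r' c' where "(r', c') \<in> P" "i = rank R r'" "j' = rank C c'" by (rule Q_cases)
    ultimately have *: "rank C c' < j" "(r', c') \<in> P" "i = rank R r'" by simp_all
    have "c' < c" using rank_less_iff[OF finC PRC(2)[OF *(2)] RC(2)] *(1) rc(3) by simp
    moreover have "r' = r" using rank_eq_iff[OF finR PRC(1)[OF *(2)] RC(1)] *(3) rc(2) by simp
    ultimately show "\<exists>c'<c. (r, c') \<in> P" using * by auto
  next
    assume "\<exists>c'<c. (r, c') \<in> P"
    then obtain c' where "c' < c" "(r, c') \<in> P" by blast
    then show "\<exists>j'<j. (i, j') \<in> Q"
      using rank_less_iff[OF finC PRC(2) RC(2)] mem_Q[OF RC(1) PRC(2)] unfolding rc(2,3) by blast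
  qed
  have "(i, j) \<noteq> (0, 0) \<longrightarrow> (r, c) \<noteq> (0, 0)" unfolding rc(2,3) by (cases "(r, c) = (0, 0)") (auto simp: rank_zero)
  then show "case x of (r, c) \<Rightarrow> (r, c) \<noteq> (0, 0) \<longrightarrow> (\<exists>r'<r. (r', c) \<in> Q) \<noteq> (\<exists>c'<c. (r, c') \<in> Q)"
    using fb_fillingD(2)[OF fb rc(1)] not_both[OF rc(1)] unfolding ij prod.case above left by blast
next
  fix x assume x: "x \<in> D"
  obtain i j where ij: "x = (i, j)" by force
  from x obtain r c where rc: "r \<in> R" "c \<in> C" "i = rank R r" "j = rank C c" unfolding ij by (rule D_cases)
  obtain c' where c': "(r, c') \<in> P" using rc(1) by force
  obtain r' where r': "(r', c) \<in> P" using rc(2) by force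
  have "(i, rank C c') \<in> Q" using mem_Q[OF rc(1) PRC(2)[OF c']] c' rc(3) by simp
  moreover have "(rank R r', j) \<in> Q" using mem_Q[OF PRC(1)[OF r'] rc(2)] r' rc(4) by simp
  ultimately show "case x of (r, c) \<Rightarrow> (\<exists>c'. (r, c') \<in> Q) \<and> (\<exists>r'. (r', c) \<in> Q)" unfolding ij by auto
qed

lemma card_Q: "card Q = n"
proof -
  have "inj_on pos P"
  proof (rule inj_onI)
    fix x y assume x: "x \<in> P" and y: "y \<in> P" and eq: "pos x = pos y"
    obtain r c r' c' where *: "x = (r, c)" "y = (r', c')" by force
    show "x = y"
      using eq rank_eq_iff[OF finR PRC(1) PRC(1), of r c r' c'] rank_eq_iff[OF finC PRC(2) PRC(2), of r c r' c'] x y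
      unfolding * by simp
  qed
  then show ?thesis by (simp add: Q_def card_image card)
qed

text \<open>The rows and columns of \<open>D\<close> have the lengths that
  \<open>row_length_rank\<close> speaks of, so it recovers the original indices, for columns with
  \<open>R\<close> and \<open>C\<close> exchanged.\<close>

lemma unshrink_DQ: "unshrink (D, Q) = P"
proof -
  have "fst ` Q = rank R ` R" "snd ` Q = rank C ` C"
    by (auto simp: Q_def image_image split_beta)
  then have cR: "card (fst ` Q) = card R" and cC: "card (snd ` Q) = card C"
    using rank_image[OF finR] rank_image[OF finC] by simp_all
  have row: "card C + rank R r - card {j. (rank R r, j) \<in> D} = r" if r: "r \<in> R" for r
  proof -
    have "{j. (rank R r, j) \<in> D} = rank C ` {c \<in> C. r + c < n}"
    proof
      show "{j. (rank R r, j) \<in> D} \<subseteq> rank C ` {c \<in> C. r + c < n}"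
      proof
        fix j assume j: "j \<in> {j. (rank R r, j) \<in> D}"
        then have "(rank R r, j) \<in> D" by simp
        then obtain r' c where "c \<in> C" "j = rank C c" by (rule D_cases)
        then show "j \<in> rank C ` {c \<in> C. r + c < n}" using j mem_D[OF r] by simp
      qed
      show "rank C ` {c \<in> C. r + c < n} \<subseteq> {j. (rank R r, j) \<in> D}" using mem_D[OF r] by auto
    qed
    moreover have "inj_on (rank C) {c \<in> C. r + c < n}"
      by (rule inj_onI) (auto simp: rank_eq_iff[OF finC])
    ultimately have "card {j. (rank R r, j) \<in> D} = card {c \<in> C. r + c < n}" by (simp add: card_image)
    then show ?thesis using row_length_rank[OF R_sub C_sub zero_R exactly_one_R r] by simp
  qed
  have column: "card R + rank C c - card {i. (i, rank C c) \<in> D} = c" if c: "c \<in> C" for c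
  proof -
    have "{i. (i, rank C c) \<in> D} = rank R ` {r \<in> R. c + r < n}"
    proof
      show "{i. (i, rank C c) \<in> D} \<subseteq> rank R ` {r \<in> R. c + r < n}"
      proof
        fix i assume i: "i \<in> {i. (i, rank C c) \<in> D}"
        then have "(i, rank C c) \<in> D" by simp
        then obtain r c' where "r \<in> R" "i = rank R r" by (rule D_cases)
        then show "i \<in> rank R ` {r \<in> R. c + r < n}" using i mem_D[OF _ c] by (simp add: add.commute)
      qed
      show "rank R ` {r \<in> R. c + r < n} \<subseteq> {i. (i, rank C c) \<in> D}" using mem_D[OF _ c] by (auto simp: add.commute)
    qed
    moreover have "inj_on (rank R) {r \<in> R. c + r < n}"
      by (rule inj_onI) (auto simp: rank_eq_iff[OF finR])
    ultimately have "card {i. (i, rank C c) \<in> D} = card {r \<in> R. c + r < n}" by (simp add: card_image)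
    then show ?thesis using row_length_rank[OF C_sub R_sub zero_C exactly_one_C c] by simp
  qed
  define g where "g = (\<lambda>(i, j). (card C + i - card {j'. (i, j') \<in> D}, card R + j - card {i'. (i', j) \<in> D}))"
  have "unshrink (D, Q) = g ` Q" by (simp add: unshrink_def cR cC g_def)
  also have "\<dots> = (\<lambda>x. g (pos x)) ` P" by (simp only: Q_def image_image)
  also have "\<dots> = (\<lambda>x. x) ` P"
    by (rule image_cong[OF refl]) (use row column PRC in \<open>auto simp: g_def\<close>)
  finally show ?thesis by simp
qed

end

section \<open>From tree-like tableaux to fillings\<close>

locale tree_like_n =
  fixes n :: nat and D Q :: "(nat \<times> nat) set"
  assumes tree: "tree_like_tableau (D, Q)" and card: "card Q = n"
begin

lemma young: "finite D" "(r, c) \<in> D \<Longrightarrow> r' \<le> r \<Longrightarrow> c' \<le> c \<Longrightarrow> (r', c') \<in> D"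
  using tree unfolding tree_like_tableau_def young_diagram_def prod.case by blast+

lemma QD: "Q \<subseteq> D" and root: "(0, 0) \<in> Q"
  using tree by (auto simp: tree_like_tableau_def)

lemma exactly_one: "(r, c) \<in> Q \<Longrightarrow> (r, c) \<noteq> (0, 0) \<Longrightarrow> (\<exists>r'<r. (r', c) \<in> Q) \<noteq> (\<exists>c'<c. (r, c') \<in> Q)"
proof -
  have "\<forall>(r, c)\<in>Q. (r, c) \<noteq> (0, 0) \<longrightarrow> (\<exists>r'<r. (r', c) \<in> Q) \<noteq> (\<exists>c'<c. (r, c') \<in> Q)"
    using tree unfolding tree_like_tableau_def prod.case by (elim conjE)
  from bspec[OF this, of "(r, c)"]
  show "(r, c) \<in> Q \<Longrightarrow> (r, c) \<noteq> (0, 0) \<Longrightarrow> (\<exists>r'<r. (r', c) \<in> Q) \<noteq> (\<exists>c'<c. (r, c') \<in> Q)"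
    by (simp only: prod.case simp_thms)
qed

lemma nonempty: "(r, c) \<in> D \<Longrightarrow> \<exists>c'. (r, c') \<in> Q" "(r, c) \<in> D \<Longrightarrow> \<exists>r'. (r', c) \<in> Q"
proof -
  have "\<forall>(r, c)\<in>D. (\<exists>c'. (r, c') \<in> Q) \<and> (\<exists>r'. (r', c) \<in> Q)"
    using tree unfolding tree_like_tableau_def prod.case by (elim conjE)
  from bspec[OF this, of "(r, c)"]
  show "(r, c) \<in> D \<Longrightarrow> \<exists>c'. (r, c') \<in> Q" "(r, c) \<in> D \<Longrightarrow> \<exists>r'. (r', c) \<in> Q"
    by (simp_all only: prod.case simp_thms)
qed

lemma finQ: "finite Q" using finite_subset[OF QD young(1)] .

definition "a = card (fst ` Q)"
definition "b = card (snd ` Q)"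

lemma down_closed: "S = {..<card S}" if "finite S" "\<And>x y. x \<in> S \<Longrightarrow> y \<le> x \<Longrightarrow> y \<in> S" for S :: "nat set"
proof -
  have "x < card S" if x: "x \<in> S" for x
  proof -
    have "{..x} \<subseteq> S" using \<open>\<And>x y. x \<in> S \<Longrightarrow> y \<le> x \<Longrightarrow> y \<in> S\<close> x by blast
    from card_mono[OF \<open>finite S\<close> this] show ?thesis by simp
  qed
  then have "S \<subseteq> {..<card S}" by auto
  then show ?thesis by (intro card_subset_eq) auto
qed

text \<open>A row above a nonempty one meets \<open>D\<close>, as \<open>D\<close> is a Young
  diagram, and therefore contains a pointed cell.\<close>

lemma rows: "fst ` Q = {..<a}"
  unfolding a_def
proof (rule down_closed)
  fix x y assume "x \<in> fst ` Q" "y \<le> x"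
  then obtain c where "(x, c) \<in> D" using QD by auto
  then have "(y, c) \<in> D" using \<open>y \<le> x\<close> by (rule young(2)) simp
  then show "y \<in> fst ` Q" using nonempty(1) by force
qed (use finQ in simp)

lemma columns: "snd ` Q = {..<b}"
  unfolding b_def
proof (rule down_closed)
  fix x y assume "x \<in> snd ` Q" "y \<le> x"
  then obtain r where "(r, x) \<in> D" using QD by auto
  then have "(r, y) \<in> D" using \<open>y \<le> x\<close> by (rule young(2)[OF _ order.refl])
  then show "y \<in> snd ` Q" using nonempty(2) by force
qed (use finQ in simp)

definition "rlen r = card {c. (r, c) \<in> D}"
definition "clen c = card {r. (r, c) \<in> D}"

lemma mem_D_row: "(r, c) \<in> D \<longleftrightarrow> c < rlen r"
proof -
  have "finite {c. (r, c) \<in> D}" by (rule finite_subset[of _ "snd ` D"]) (force, simp add: young(1))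
  then have "{c. (r, c) \<in> D} = {..<rlen r}"
    unfolding rlen_def by (rule down_closed) (auto intro: young(2))
  then show ?thesis by blast
qed

lemma mem_D_column: "(r, c) \<in> D \<longleftrightarrow> r < clen c"
proof -
  have "finite {r. (r, c) \<in> D}" by (rule finite_subset[of _ "fst ` D"]) (force, simp add: young(1))
  then have "{r. (r, c) \<in> D} = {..<clen c}"
    unfolding clen_def by (rule down_closed) (auto intro: young(2))
  then show ?thesis by blast
qed

lemma D_bounds: "(r, c) \<in> D \<Longrightarrow> r < a \<and> c < b"
proof -
  assume rc: "(r, c) \<in> D"
  have "r \<in> fst ` Q" "c \<in> snd ` Q" using nonempty[OF rc] by force+
  then show ?thesis unfolding rows columns by simp
qed

lemma Q_bounds: "(r, c) \<in> Q \<Longrightarrow> r < a \<and> c < b"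
  using D_bounds[of r c] QD by blast

lemma len_le: "rlen r \<le> b" "clen c \<le> a"
proof -
  have "(r, b) \<notin> D" "(a, c) \<notin> D" using D_bounds[of r b] D_bounds[of a c] by auto
  then show "rlen r \<le> b" "clen c \<le> a"
    unfolding mem_D_row[of r b] mem_D_column[of a c] by simp_all
qed

lemma rlen_mono: assumes "r \<le> r'" shows "rlen r' \<le> rlen r"
proof -
  have "(r, rlen r) \<notin> D" by (simp add: mem_D_row)
  then have "(r', rlen r) \<notin> D" using young(2)[OF _ assms order.refl] by blast
  then show ?thesis by (simp add: mem_D_row)
qed

lemma clen_mono: assumes "c \<le> c'" shows "clen c' \<le> clen c"
proof -
  have "(clen c, c) \<notin> D" by (simp add: mem_D_column)
  then have "(clen c, c') \<notin> D" using young(2)[OF _ order.refl assms] by blast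
  then show ?thesis by (simp add: mem_D_column)
qed

lemma ab: "a + b = n + 1"
  unfolding a_def b_def card[symmetric]
proof (subst card_rows_columns(2)[OF finQ root])
  show "(\<exists>r'<r. (r', c) \<in> Q) \<or> (\<exists>c'<c. (r, c') \<in> Q)" if "(r, c) \<in> Q" "(r, c) \<noteq> (0, 0)" for r c
    using exactly_one[OF that] by blast
  show "\<forall>r c. (r, c) \<in> Q \<longrightarrow> \<not> ((\<exists>r'<r. (r', c) \<in> Q) \<and> (\<exists>c'<c. (r, c') \<in> Q))"
  proof (intro allI impI)
    fix r c assume rc: "(r, c) \<in> Q"
    show "\<not> ((\<exists>r'<r. (r', c) \<in> Q) \<and> (\<exists>c'<c. (r, c') \<in> Q))"
      using exactly_one[OF rc] by (cases "(r, c) = (0, 0)") auto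
  qed
qed

text \<open>The equation of \<open>row_length_rank\<close> solved for the original row index. The
  subtraction is exact since \<open>rlen r\<close> \<le> \<open>b\<close>.\<close>

definition "\<rho> r = b + r - rlen r"
definition "\<gamma> c = a + c - clen c"

lemma \<rho>_mono: "r < r' \<Longrightarrow> \<rho> r < \<rho> r'"
  using rlen_mono[of r r'] len_le(1)[of r] unfolding \<rho>_def by linarith

lemma \<gamma>_mono: "c < c' \<Longrightarrow> \<gamma> c < \<gamma> c'"
  using clen_mono[of c c'] len_le(2)[of c] unfolding \<gamma>_def by linarith

lemma \<rho>_strict_mono: "strict_mono \<rho>" and \<gamma>_strict_mono: "strict_mono \<gamma>"
  by (simp_all add: strict_mono_def \<rho>_mono \<gamma>_mono)

lemmas \<rho>_eq = strict_mono_eq[OF \<rho>_strict_mono] and \<gamma>_eq = strict_mono_eq[OF \<gamma>_strict_mono]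
lemmas \<rho>_less = strict_mono_less[OF \<rho>_strict_mono] and \<gamma>_less = strict_mono_less[OF \<gamma>_strict_mono]

text \<open>As \<open>a + b = n + 1\<close>, the sum of \<rho> r and \<gamma> c is n + 1 + (r - clen
  c) + (c - rlen r). Inside the diagram both differences are at most -1, outside both are at least
  0. The value \<open>n\<close> is skipped, which \<open>covered\<close> exploits.\<close>

lemma sum_in: "(r, c) \<in> D \<Longrightarrow> \<rho> r + \<gamma> c < n"
  using mem_D_row[of r c] mem_D_column[of r c] len_le(1)[of r] len_le(2)[of c] ab
  unfolding \<rho>_def \<gamma>_def by linarith

lemma sum_out: "(r, c) \<notin> D \<Longrightarrow> n < \<rho> r + \<gamma> c"
  using mem_D_row[of r c] mem_D_column[of r c] len_le(1)[of r] len_le(2)[of c] ab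
  unfolding \<rho>_def \<gamma>_def by linarith

definition "P = (\<lambda>(r, c). (\<rho> r, \<gamma> c)) ` Q"

lemma unshrink_P: "unshrink (D, Q) = P"
  by (simp add: unshrink_def P_def \<rho>_def \<gamma>_def a_def b_def rlen_def clen_def)

lemma P_rows: "fst ` P = \<rho> ` {..<a}" and P_columns: "snd ` P = \<gamma> ` {..<b}"
  unfolding P_def rows[symmetric] columns[symmetric] by (auto simp: image_image split_beta)

lemma mem_P: "(\<rho> r, \<gamma> c) \<in> P \<longleftrightarrow> (r, c) \<in> Q"
  by (auto simp: P_def \<rho>_eq \<gamma>_eq)

lemma a_pos: "0 < a" and b_pos: "0 < b"
  using root rows columns by force+

text \<open>Column \<open>b - 1\<close> is not empty, so the first row has full length
  \<open>b\<close>; likewise for the first column.\<close>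

lemma \<rho>_zero: "\<rho> 0 = 0" and \<gamma>_zero: "\<gamma> 0 = 0"
proof -
  have "b - 1 \<in> snd ` Q" "a - 1 \<in> fst ` Q" using a_pos b_pos rows columns by auto
  then obtain r c where "(r, b - 1) \<in> Q" "(a - 1, c) \<in> Q" by force
  then have "(r, b - 1) \<in> D" "(a - 1, c) \<in> D" using QD by auto
  then have "(0, b - 1) \<in> D" "(a - 1, 0) \<in> D" using young(2) by blast+
  then show "\<rho> 0 = 0" "\<gamma> 0 = 0"
    using mem_D_row[of 0 "b - 1"] mem_D_column[of "a - 1" 0] a_pos b_pos by (auto simp: \<rho>_def \<gamma>_def)
qed

lemma card_P: "card P = n"
proof -
  have "inj_on (\<lambda>(r, c). (\<rho> r, \<gamma> c)) Q" by (auto simp: inj_on_def \<rho>_eq \<gamma>_eq)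
  then show ?thesis by (simp add: P_def card_image card)
qed

lemma P_staircase: "P \<subseteq> staircase n"
  using sum_in QD by (auto simp: P_def staircase_eq)

text \<open>The nonzero rows and the reflected nonzero columns are \<open>a - 1\<close> and
  \<open>b - 1\<close> numbers strictly between 0 and \<open>n\<close>. They are disjoint because no
  row index and column index add up to \<open>n\<close>, and since (a - 1) + (b - 1) = n - 1, no
  number is left out.\<close>

lemma covered:
  assumes "0 < x" "x < n" shows "x \<in> fst ` P \<or> n - x \<in> snd ` P"
proof -
  define A B where "A = \<rho> ` {0<..<a}" and "B = (\<lambda>c. n - \<gamma> c) ` {0<..<b}"
  have \<gamma>n: "\<gamma> c < n" if "c < b" for c
  proof -
    have "c \<in> snd ` Q" using that columns by simp
    then obtain r where "(r, c) \<in> Q" by force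
    then show ?thesis using sum_in[of r c] QD by auto
  qed
  have \<rho>n: "\<rho> r < n" if "r < a" for r
  proof -
    have "r \<in> fst ` Q" using that rows by simp
    then obtain c where "(r, c) \<in> Q" by force
    then show ?thesis using sum_in[of r c] QD by auto
  qed
  have "inj_on (\<lambda>c. n - \<gamma> c) {0<..<b}"
  proof (rule inj_onI)
    fix c c' assume "c \<in> {0<..<b}" "c' \<in> {0<..<b}" "n - \<gamma> c = n - \<gamma> c'"
    then have "\<gamma> c = \<gamma> c'" using \<gamma>n[of c] \<gamma>n[of c'] by auto
    then show "c = c'" by (simp add: \<gamma>_eq)
  qed
  then have "card B = b - 1" by (simp add: B_def card_image)
  moreover have "card A = a - 1" by (simp add: A_def card_image inj_on_def \<rho>_eq)
  moreover have "A \<inter> B = {}"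
  proof -
    have "\<rho> r \<noteq> n - \<gamma> c" if "c < b" for r c
      using sum_in[of r c] sum_out[of r c] \<gamma>n[OF that] by (cases "(r, c) \<in> D") auto
    then show ?thesis by (auto simp: A_def B_def)
  qed
  moreover have AB: "A \<union> B \<subseteq> {0<..<n}"
    using \<rho>n \<gamma>n \<rho>n[OF a_pos] \<rho>_less[of 0] \<gamma>_less[of 0] \<rho>_zero \<gamma>_zero
    by (auto simp: A_def B_def intro!: diff_less)
  moreover have "finite A" "finite B" by (auto simp: A_def B_def)
  ultimately have "card (A \<union> B) = card {0<..<n}"
    using ab a_pos b_pos by (simp add: card_Un_disjoint)
  then have "A \<union> B = {0<..<n}" using AB by (intro card_subset_eq) auto
  then have "x \<in> A \<union> B" using assms by simp
  then show ?thesis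
    unfolding P_rows P_columns A_def B_def using \<gamma>n assms by (auto simp: less_imp_le)
qed

lemma fb_filling_P: "fb_filling n P"
  unfolding fb_filling_def
proof (intro conjI ballI allI impI)
  show "(0, 0) \<in> P" using mem_P[of 0 0] root by (simp add: \<rho>_zero \<gamma>_zero)
  show "case x of (r, c) \<Rightarrow> (r, c) \<noteq> (0, 0) \<longrightarrow> (\<exists>r'<r. (r', c) \<in> P) \<or> (\<exists>c'<c. (r, c') \<in> P)" if "x \<in> P" for x
  proof -
    obtain r c where rc: "(r, c) \<in> Q" "x = (\<rho> r, \<gamma> c)" using \<open>x \<in> P\<close> by (auto simp: P_def)
    have "(\<exists>r'<\<rho> r. (r', \<gamma> c) \<in> P) \<or> (\<exists>c'<\<gamma> c. (\<rho> r, c') \<in> P)" if "(\<rho> r, \<gamma> c) \<noteq> (0, 0)"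
    proof -
      have "(r, c) \<noteq> (0, 0)" using that by (cases "(r, c) = (0, 0)") (auto simp: \<rho>_zero \<gamma>_zero)
      with exactly_one[OF rc(1)] consider r' where "r' < r" "(r', c) \<in> Q" | c' where "c' < c" "(r, c') \<in> Q" by blast
      then show ?thesis
      proof cases
        case (1 r')
        then have "\<rho> r' < \<rho> r" "(\<rho> r', \<gamma> c) \<in> P" by (simp_all add: \<rho>_mono mem_P)
        then show ?thesis by blast
      next
        case (2 c')
        then have "\<gamma> c' < \<gamma> c" "(\<rho> r, \<gamma> c') \<in> P" by (simp_all add: \<gamma>_mono mem_P)
        then show ?thesis by blast
      qed
    qed
    then show ?thesis unfolding rc(2) prod.case by blast
  qed
  show "(\<exists>c. (x, c) \<in> P) \<or> (\<exists>r. (r, n - x) \<in> P)" if "0 < x \<and> x < n" for x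
    using covered[of x] that by force
qed

text \<open>By \<open>sum_in\<close> and \<open>sum_out\<close>, the kept rows and columns meet
  inside the staircase exactly in the images of the cells of \<open>D\<close>, and ranks undo \<rho>
  and \<gamma>.\<close>

lemma shrink_P: "shrink (staircase n, P) = (D, Q)"
proof -
  have rR: "rank (fst ` P) (\<rho> r) = r" if "r < a" for r
    unfolding P_rows by (rule rank_strict_mono_image[OF _ that]) (simp add: strict_mono_on_def \<rho>_mono)
  have rC: "rank (snd ` P) (\<gamma> c) = c" if "c < b" for c
    unfolding P_columns by (rule rank_strict_mono_image[OF _ that]) (simp add: strict_mono_on_def \<gamma>_mono)
  let ?pos = "\<lambda>(r, c). (rank (fst ` P) r, rank (snd ` P) c)"
  have "staircase n \<inter> fst ` P \<times> snd ` P = (\<lambda>(r, c). (\<rho> r, \<gamma> c)) ` D"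
  proof (intro equalityI subsetI)
    fix x assume "x \<in> staircase n \<inter> fst ` P \<times> snd ` P"
    then obtain r c where "x = (\<rho> r, \<gamma> c)" "\<rho> r + \<gamma> c < n"
      unfolding P_rows P_columns by (auto simp: staircase_eq)
    moreover then have "(r, c) \<in> D" using sum_out[of r c] by auto
    ultimately show "x \<in> (\<lambda>(r, c). (\<rho> r, \<gamma> c)) ` D" by auto
  next
    fix x assume "x \<in> (\<lambda>(r, c). (\<rho> r, \<gamma> c)) ` D"
    then obtain r c where "x = (\<rho> r, \<gamma> c)" "(r, c) \<in> D" by auto
    then show "x \<in> staircase n \<inter> fst ` P \<times> snd ` P"
      using sum_in[of r c] D_bounds[of r c] unfolding P_rows P_columns by (auto simp: staircase_eq)
  qed
  then have "?pos ` (staircase n \<inter> fst ` P \<times> snd ` P) = (\<lambda>x. ?pos ((\<lambda>(r, c). (\<rho> r, \<gamma> c)) x)) ` D"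
    by (simp add: image_image)
  also have "\<dots> = (\<lambda>x. x) ` D" using D_bounds by (intro image_cong) (auto simp: rR rC)
  finally have 1: "?pos ` (staircase n \<inter> fst ` P \<times> snd ` P) = D" by simp
  have "?pos ` P = (\<lambda>x. ?pos ((\<lambda>(r, c). (\<rho> r, \<gamma> c)) x)) ` Q" by (subst (3) P_def) (simp add: image_image)
  also have "\<dots> = (\<lambda>x. x) ` Q" using Q_bounds by (intro image_cong) (auto simp: rR rC)
  finally have 2: "?pos ` P = Q" by simp
  show ?thesis unfolding shrink_eq 1 2 ..
qed

end

lemma bij_betw_shrink:
  "bij_betw (\<lambda>P. shrink (staircase n, P)) {P. P \<subseteq> staircase n \<and> fb_filling n P \<and> card P = n}
     {T. tree_like_tableau T \<and> card (snd T) = n}"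
proof (rule bij_betw_byWitness[where f' = unshrink])
  show "\<forall>P\<in>{P. P \<subseteq> staircase n \<and> fb_filling n P \<and> card P = n}. unshrink (shrink (staircase n, P)) = P"
  proof
    fix P assume "P \<in> {P. P \<subseteq> staircase n \<and> fb_filling n P \<and> card P = n}"
    then interpret fb_n_filling n P by unfold_locales auto
    show "unshrink (shrink (staircase n, P)) = P" by (simp add: shrink_DQ unshrink_DQ)
  qed
  show "(\<lambda>P. shrink (staircase n, P)) ` {P. P \<subseteq> staircase n \<and> fb_filling n P \<and> card P = n}
      \<subseteq> {T. tree_like_tableau T \<and> card (snd T) = n}"
  proof (rule image_subsetI)
    fix P assume "P \<in> {P. P \<subseteq> staircase n \<and> fb_filling n P \<and> card P = n}"
    then interpret fb_n_filling n P by unfold_locales auto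
    show "shrink (staircase n, P) \<in> {T. tree_like_tableau T \<and> card (snd T) = n}"
      by (simp add: shrink_DQ tree_like card_Q)
  qed
  show "\<forall>T\<in>{T. tree_like_tableau T \<and> card (snd T) = n}. shrink (staircase n, unshrink T) = T"
  proof
    fix T assume T: "T \<in> {T. tree_like_tableau T \<and> card (snd T) = n}"
    obtain D Q where DQ: "T = (D, Q)" by force
    interpret tree_like_n n D Q by unfold_locales (use T in \<open>auto simp: DQ\<close>)
    show "shrink (staircase n, unshrink T) = T" by (simp add: DQ unshrink_P shrink_P)
  qed
  show "unshrink ` {T. tree_like_tableau T \<and> card (snd T) = n}
      \<subseteq> {P. P \<subseteq> staircase n \<and> fb_filling n P \<and> card P = n}"
  proof (rule image_subsetI)
    fix T assume T: "T \<in> {T. tree_like_tableau T \<and> card (snd T) = n}"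
    obtain D Q where DQ: "T = (D, Q)" by force
    interpret tree_like_n n D Q by unfold_locales (use T in \<open>auto simp: DQ\<close>)
    show "unshrink T \<in> {P. P \<subseteq> staircase n \<and> fb_filling n P \<and> card P = n}"
      by (simp add: DQ unshrink_P P_staircase fb_filling_P card_P)
  qed
qed

section \<open>Faithfully balanced modules and tree-like tableaux\<close>

definition pointed_cells :: "nat \<Rightarrow> ('k::field mat, 'v) module \<Rightarrow> (nat \<times> nat) set" where
  "pointed_cells n M = {p \<in> staircase n. is_summand (Lambda n) (imod n p :: ('k mat, 'k vec) module) M}"

lemma filling_eq: "filling n M = (staircase n, pointed_cells n M)"
proof -
  have "cell_pos n ` {(i, j). 1 \<le> i \<and> i \<le> j \<and> j \<le> n \<and>
      is_summand (Lambda n) (interval_module n i j :: ('a mat, 'a vec) module) M} = pointed_cells n M"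
  proof (intro equalityI subsetI)
    fix p assume "p \<in> cell_pos n ` {(i, j). 1 \<le> i \<and> i \<le> j \<and> j \<le> n \<and>
      is_summand (Lambda n) (interval_module n i j :: ('a mat, 'a vec) module) M}"
    then obtain i j where ij: "1 \<le> i" "i \<le> j" "j \<le> n" "p = (i - 1, n - j)"
      "is_summand (Lambda n) (interval_module n i j :: ('a mat, 'a vec) module) M"
      by (auto simp: cell_pos_def)
    then have "Suc (fst p) = i" "n - snd p = j" by auto
    then show "p \<in> pointed_cells n M" using ij by (auto simp: pointed_cells_def staircase_eq)
  next
    fix p assume "p \<in> pointed_cells n M"
    then have "fst p + snd p < n" "is_summand (Lambda n) (imod n p :: ('a mat, 'a vec) module) M"
      by (auto simp: pointed_cells_def staircase_eq)
    then show "p \<in> cell_pos n ` {(i, j). 1 \<le> i \<and> i \<le> j \<and> j \<le> n \<and>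
      is_summand (Lambda n) (interval_module n i j :: ('a mat, 'a vec) module) M}"
      by (intro image_eqI[of _ _ "(Suc (fst p), n - snd p)"]) (auto simp: cell_pos_def)
  qed
  then show ?thesis by (simp add: filling_def)
qed

lemma pointed_cells_iso:
  assumes "left_module (Lambda n) M" "left_module (Lambda n) N" "mod_iso (Lambda n) M N"
  shows "pointed_cells n M = pointed_cells n N"
  using is_summand_iso[OF left_module_interval_module assms(1,2,3)]
    is_summand_iso[OF left_module_interval_module assms(2,1) mod_iso_sym[OF assms(1,3)]]
  by (auto simp: pointed_cells_def)

lemma faithfully_balanced_std_iff:
  assumes "P \<subseteq> staircase n" "0 < n"
  shows "faithfully_balanced (Lambda n) (std n P (\<lambda>p. p) :: ('k::field mat, _) module) \<longleftrightarrow> fb_filling n P"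
  using fb_filling_necessary[OF assms] fb_filling_sufficient[OF assms(1)] by blast

text \<open>The decomposition from \<open>basic\<close> has distinct labels but an unknown number
  \<open>m\<close> of summands; the one from \<open>num_indec_summands\<close> has \<open>n\<close>
  summands, whose labels might coincide. Both have the pointed cells as label set, and
  \<open>std_labels_distinct\<close> transfers distinctness to the second one, which gives the
  count.\<close>

lemma fb_modules_pointed_cells:
  fixes M :: "('k::field mat, 'k vec) module"
  assumes M: "M \<in> fb_modules n" and n: "0 < n"
  shows "fb_filling n (pointed_cells n M)" "card (pointed_cells n M) = n"
    "mod_iso (Lambda n) (std n (pointed_cells n M) (\<lambda>p. p)) M"
proof -
  have L: "left_module (Lambda n) M" and fb: "faithfully_balanced (Lambda n) M"
    and b: "basic (Lambda n) M" and num: "num_indec_summands (Lambda n) M n"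
    using M by (auto simp: fb_modules_def)
  interpret M: left_module "Lambda n" M by fact
  from b obtain m N where dec: "indec_decomp (Lambda n) M m N"
    and dist: "\<And>i j. i < m \<Longrightarrow> j < m \<Longrightarrow> i \<noteq> j \<Longrightarrow>
      \<not> mod_iso (Lambda n) (M\<lparr>carrier := N i\<rparr>) (M\<lparr>carrier := N j\<rparr>)"
    unfolding basic_def by blast
  obtain s where s: "\<And>i. i < m \<Longrightarrow> fst (s i) + snd (s i) < n"
    "\<And>i. i < m \<Longrightarrow> mod_iso (Lambda n) (std n {()} (\<lambda>_. s i)) (M\<lparr>carrier := N i\<rparr>)"
    "mod_iso (Lambda n) (std n {..<m} s) M"
    by (rule std_iso_of_indec_decomp[OF L dec]) blast
  have inj: "inj_on s {..<m}"
  proof (rule inj_onI, rule ccontr)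
    fix i j assume ij: "i \<in> {..<m}" "j \<in> {..<m}" "s i = s j" "i \<noteq> j"
    then have im: "i < m" "j < m" by auto
    have "submodule (N i) (Lambda n) M" using dec im(1) by (simp add: indec_decomp_def)
    then have Li: "left_module (Lambda n) (M\<lparr>carrier := N i\<rparr>)" by (rule M.left_module_submodule)
    have "mod_iso (Lambda n) (M\<lparr>carrier := N i\<rparr>) (std n {()} (\<lambda>_. s j) :: ('k mat, _) module)"
      using mod_iso_sym[OF left_module_std s(2)[OF im(1)]] ij(3) by simp
    from mod_iso_trans[OF Li this s(2)[OF im(2)]] show False using dist im ij(4) by blast
  qed
  have lab: "s ` {..<m} = pointed_cells n M"
    unfolding pointed_cells_def by (rule labels_eq_summands[OF L s(3)]) (use s(1) in auto)
  show iso: "mod_iso (Lambda n) (std n (pointed_cells n M) (\<lambda>p. p)) M"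
    unfolding lab[symmetric] by (rule mod_iso_trans[OF left_module_std mod_iso_std_reindex[OF inj] s(3)])
  from num obtain N' where dec': "indec_decomp (Lambda n) M n N'" by (auto simp: num_indec_summands_def)
  obtain s' where s': "\<And>i. i < n \<Longrightarrow> fst (s' i) + snd (s' i) < n"
    "mod_iso (Lambda n) (std n {..<n} s') M"
    by (rule std_iso_of_indec_decomp[OF L dec']) blast
  have lab': "s' ` {..<n} = pointed_cells n M"
    unfolding pointed_cells_def by (rule labels_eq_summands[OF L s'(2)]) (use s'(1) in auto)
  have "mod_iso (Lambda n) (std n {..<n} s' :: ('k mat, _) module) (std n {..<m} s)"
    by (rule mod_iso_trans[OF left_module_std s'(2) mod_iso_sym[OF left_module_std s(3)]])
  then have "inj_on s' {..<n}"
    by (rule std_labels_distinct) (use s(1) s'(1) inj in auto)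
  then show "card (pointed_cells n M) = n" unfolding lab'[symmetric] by (simp add: card_image)
  have "faithfully_balanced (Lambda n) (std n (pointed_cells n M) (\<lambda>p. p) :: ('k mat, _) module)"
    by (rule faithfully_balanced_iso[OF L left_module_std mod_iso_sym[OF left_module_std iso] fb])
  then show "fb_filling n (pointed_cells n M)"
    using faithfully_balanced_std_iff[of "pointed_cells n M" n] n by (auto simp: pointed_cells_def)
qed

lemma fb_module_with_filling:
  assumes P: "P \<subseteq> staircase n" "fb_filling n P" "card P = n" and n: "0 < n"
  obtains M :: "('k::field mat, 'k vec) module" where "M \<in> fb_modules n" "pointed_cells n M = P"
proof -
  have fin: "finite P" using finite_subset[OF P(1) finite_staircase] .
  obtain M :: "('k mat, 'k vec) module" where L: "left_module (Lambda n) M"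
    and iso: "mod_iso (Lambda n) (std n P (\<lambda>p. p)) M" by (rule std_vec_model[OF fin])
  interpret M: left_module "Lambda n" M by fact
  obtain s where s: "bij_betw s {0..<card P} P" using ex_bij_betw_nat_finite[OF fin] by blast
  then have s: "inj_on s {..<n}" "s ` {..<n} = P" using P(3) by (auto simp: bij_betw_def atLeast0LessThan)
  have "mod_iso (Lambda n) (std n P (\<lambda>p. p) :: ('k mat, _) module) (std n {..<n} s)"
    using mod_iso_std_reindex[OF s(1)] unfolding s(2) .
  then have iso': "mod_iso (Lambda n) (std n {..<n} s) M"
    using iso mod_iso_sym[OF left_module_std] mod_iso_trans[OF left_module_std] by blast
  have valid: "fst (s i) + snd (s i) < n" if "i < n" for i
  proof -
    have "s i \<in> staircase n" using that s(2) P(1) by blast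
    then show ?thesis by (auto simp: staircase_eq)
  qed
  obtain N where N: "indec_decomp (Lambda n) M n N"
    "\<And>i. i < n \<Longrightarrow> mod_iso (Lambda n) (std n {()} (\<lambda>_. s i)) (M\<lparr>carrier := N i\<rparr>)"
    by (rule indec_decomp_of_std_iso[OF L iso' valid]) blast+
  \<comment> \<open>An isomorphism would make one interval module a summand of the other, which
    forces equal labels.\<close>
  have "\<not> mod_iso (Lambda n) (M\<lparr>carrier := N i\<rparr>) (M\<lparr>carrier := N j\<rparr>)" if ij: "i < n" "j < n" "i \<noteq> j" for i j
  proof
    let ?S = "\<lambda>i. std n {()} (\<lambda>_. s i) :: ('k mat, unit \<Rightarrow> nat \<Rightarrow> 'k) module"
    assume "mod_iso (Lambda n) (M\<lparr>carrier := N i\<rparr>) (M\<lparr>carrier := N j\<rparr>)"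
    from mod_iso_trans[OF left_module_std mod_iso_trans[OF left_module_std N(2)[OF ij(1)] this]
        mod_iso_sym[OF left_module_std N(2)[OF ij(2)]]]
    have "mod_iso (Lambda n) (?S i) (?S j)" .
    then have "is_summand (Lambda n) (?S i) (?S j)"
      by (rule mod_iso_imp_is_summand[OF left_module_std left_module_std])
    then have "s i \<in> (\<lambda>_. s j) ` {()}"
      using is_summand_std[of "{()}" "\<lambda>_. s j" n "s i"] valid ij by auto
    then show False using s(1) ij by (auto simp: inj_on_def)
  qed
  then have "basic (Lambda n) M" unfolding basic_def using N(1) by blast
  moreover have "num_indec_summands (Lambda n) M n" unfolding num_indec_summands_def using N(1) by blast
  moreover have "fin_gen (Lambda n) M" by (rule fin_gen_of_std_iso[OF L iso fin])
  moreover have "faithfully_balanced (Lambda n) M"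
    by (rule faithfully_balanced_iso[OF left_module_std L iso]) (simp add: faithfully_balanced_std_iff P n)
  ultimately have "M \<in> fb_modules n" using L by (simp add: fb_modules_def)
  moreover have "pointed_cells n M = P"
  proof -
    have "(\<lambda>p. p) ` P = pointed_cells n M"
      unfolding pointed_cells_def by (rule labels_eq_summands[OF L iso fin]) (use P(1) in \<open>auto simp: staircase_eq\<close>)
    then show ?thesis by simp
  qed
  ultimately show thesis by (rule that)
qed

theorem proposition8p19:
  fixes n :: nat
  assumes "n \<ge> 1"
  shows "(sh n :: ('k::field mat, 'k vec) module \<Rightarrow> pointed_diagram)
           respects iso_rel (Lambda n) (fb_modules n) \<and>
         bij_betw (\<lambda>X. the_elem (sh n ` X))
           ((fb_modules n :: ('k mat, 'k vec) module set) // iso_rel (Lambda n) (fb_modules n))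
           {T. tree_like_tableau T \<and> card (snd T) = n}"
proof -
  let ?F = "fb_modules n :: ('k mat, 'k vec) module set"
  let ?r = "iso_rel (Lambda n) ?F"
  have n: "0 < n" using assms by simp
  have L: "left_module (Lambda n) M" if "M \<in> ?F" for M using that by (simp add: fb_modules_def)
  have sh: "sh n M = shrink (staircase n, pointed_cells n M)" for M :: "('k mat, 'k vec) module"
    by (simp add: sh_def filling_eq)
  have X: "pointed_cells n M \<in> {P. P \<subseteq> staircase n \<and> fb_filling n P \<and> card P = n}" if "M \<in> ?F" for M
    using fb_modules_pointed_cells(1,2)[OF that n] by (auto simp: pointed_cells_def)
  have shY: "sh n M \<in> {T. tree_like_tableau T \<and> card (snd T) = n}" if "M \<in> ?F" for M
    using bij_betwE[OF bij_betw_shrink] X[OF that] unfolding sh by blast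
  have equiv: "equiv ?F ?r"
  proof (rule equivI)
    show "?r \<subseteq> ?F \<times> ?F" by (auto simp: iso_rel_def)
    show "refl_on ?F ?r" using mod_iso_refl[OF L] by (auto simp: refl_on_def iso_rel_def)
    show "sym ?r" using mod_iso_sym[OF L] by (auto simp: sym_def iso_rel_def)
    show "trans ?r" using mod_iso_trans[OF L] by (auto simp: trans_def iso_rel_def)
  qed
  have resp: "sh n M = sh n N" if "(M, N) \<in> ?r" for M N
    using that pointed_cells_iso[OF L L] unfolding sh by (auto simp: iso_rel_def)
  \<comment> \<open>Equal shapes give equal fillings, and each module is isomorphic to the direct
    sum over its own filling.\<close>
  have sh_inj: "(M, N) \<in> ?r" if M: "M \<in> ?F" and N: "N \<in> ?F" and eq: "sh n M = sh n N" for M N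
  proof -
    have "pointed_cells n M = pointed_cells n N"
      by (rule inj_onD[OF bij_betw_imp_inj_on[OF bij_betw_shrink] eq[unfolded sh] X[OF M] X[OF N]])
    then have "mod_iso (Lambda n) M N"
      using mod_iso_trans[OF L[OF M] mod_iso_sym[OF left_module_std fb_modules_pointed_cells(3)[OF M n]]]
        fb_modules_pointed_cells(3)[OF N n] by simp
    then show ?thesis using M N by (simp add: iso_rel_def)
  qed
  \<comment> \<open>Since \<open>sh n\<close> is constant on a class, \<open>the_elem\<close>
    returns its value at any representative.\<close>
  have val: "the_elem (sh n ` (?r `` {M})) = sh n M" if M: "M \<in> ?F" for M
  proof -
    have "sh n ` (?r `` {M}) = {sh n M}"
    proof
      show "sh n ` (?r `` {M}) \<subseteq> {sh n M}" using resp by fastforce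
      show "{sh n M} \<subseteq> sh n ` (?r `` {M})" using equiv_class_self[OF equiv M] by simp
    qed
    then show ?thesis by simp
  qed
  have "bij_betw (\<lambda>X. the_elem (sh n ` X)) (?F // ?r) {T. tree_like_tableau T \<and> card (snd T) = n}"
    unfolding bij_betw_def
  proof
    show "inj_on (\<lambda>X. the_elem (sh n ` X)) (?F // ?r)"
    proof (rule inj_onI)
      fix X Y assume "X \<in> ?F // ?r" "Y \<in> ?F // ?r" and eq: "the_elem (sh n ` X) = the_elem (sh n ` Y)"
      then obtain M N where "M \<in> ?F" "X = ?r `` {M}" "N \<in> ?F" "Y = ?r `` {N}" by (auto elim!: quotientE)
      then show "X = Y" using eq sh_inj equiv_class_eq[OF equiv] by (simp add: val)
    qed
    show "(\<lambda>X. the_elem (sh n ` X)) ` (?F // ?r) = {T. tree_like_tableau T \<and> card (snd T) = n}"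
    proof (intro equalityI subsetI)
      fix T assume "T \<in> (\<lambda>X. the_elem (sh n ` X)) ` (?F // ?r)"
      then obtain M where "M \<in> ?F" "T = sh n M" by (auto elim!: quotientE simp: val)
      then show "T \<in> {T. tree_like_tableau T \<and> card (snd T) = n}" using shY by simp
    next
      fix T assume "T \<in> {T. tree_like_tableau T \<and> card (snd T) = n}"
      then obtain P where P: "P \<subseteq> staircase n" "fb_filling n P" "card P = n" "T = shrink (staircase n, P)"
        using bij_betw_imp_surj_on[OF bij_betw_shrink[of n]] by blast
      obtain M where M: "M \<in> ?F" "pointed_cells n M = P"
        by (rule fb_module_with_filling[OF P(1-3) n])
      then have "T = the_elem (sh n ` (?r `` {M}))" using P(4) by (simp only: val sh)
      then show "T \<in> (\<lambda>X. the_elem (sh n ` X)) ` (?F // ?r)" using M(1) by (auto intro: quotientI)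
    qed
  qed
  then show ?thesis using resp by (auto simp: congruent_def)
qed

end
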